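(* Let $R$ be an ordered (commutative) ring containing $\mathbb{Q}$, $C=R(\mathrm i)$ with $\mathrm i^2=-1$, and let $\mathfrak g$ be a Lie algebra over $R$, free of finite rank as an $R$-module, with a non-degenerate classical $r$-matrix $r\in\Lambda^2\mathfrak g$ and a Kähler structure $(s,\nabla)$ for $r$, with associated matrix $g=A+\mathrm iB\in M_n(C)$. Let $\mathcal A$ be a unital $^*$-algebra over $C$ with a $^*$-action of $\mathfrak g$, and let $\Omega=\Omega^*\in t\Lambda^2\mathfrak g_C^*[[t]]$ be a formal series of Hermitian $\delta_{CE}$-closed two-forms. Let $\star_{\mathrm{Wick}}$ be the Hermitian deformation of $\mathcal A$ obtained by the Fedosov construction from the fiberwise Wick product $\circ_{\mathrm{Wick}}$, with Fedosov-Taylor series $\tau_{\mathrm{Wick}}$. Then: (i) For all $a\in\mathcal A$, $$a^*\star_{\mathrm{Wick}}a=\sum_{m=0}^\infty\frac{(2t)^m}{m!}\sum_{k_1,\dots,k_m,\ell_1,\dots,\ell_m=1}^n g^{k_1\ell_1}\cdots g^{k_m\ell_m}\,a_{k_1\dots k_m}^*a_{\ell_1\dots\ell_m},$$ where $a_{k_1\dots k_m}=\sigma\bigl(i_s(\overline Z_{k_1})\cdots i_s(\overline Z_{k_m})\tau_{\mathrm{Wick}}(a)\bigr)$. (ii) The deformation $\star_{\mathrm{Wick}}$ is strongly positive.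
   Context: Positivity: $R[[t]]$ is ordered in the usual way (sign of the lowest non-vanishing coefficient), $C[[t]]=R[[t]](\mathrm i)$, $\bar t=t$. A linear functional $\omega:\mathcal A\to C$ on a $^*$-algebra is positive if $\omega(a^*a)\ge0$ for all $a$. A Hermitian deformation $\star$ (i.e. $(a\star b)^*=b^*\star a^*$) is strongly positive if for every positive $\omega:\mathcal A\to C$ the $C[[t]]$-linear extension satisfies $\omega(a^*\star a)\ge0$ for all $a\in\mathcal A[[t]]$. A $^*$-action of $\mathfrak g$ on $\mathcal A$ is an action $\triangleright$ by derivations with $(X\triangleright a)^*=X\triangleright a^*$ for $X\in\mathfrak g$. Basics. $\mathfrak g_C=\mathfrak g\otimes_RC$. $r\in\Lambda^2\mathfrak g$ is a classical $r$-matrix if $[[r,r]]=0$ for the Gerstenhaber extension of the Lie bracket to $\Lambda^\bullet\mathfrak g$; non-degenerate: its coefficient matrix $(r^{ij})$ in a basis $(x_i)$ of $\mathfrak g$ (dual basis $(x^i)$), $r=r^{ij}x_i\otimes x_j$, is invertible over $R$; $\omega_r=\frac12\omega_{ij}x^i\wedge x^j$ with $r^{ij}\omega_{jk}=\delta^i_k$. $\delta_{CE}$: Chevalley-Eilenberg differential on $\Lambda^\bullet\mathfrak g^*$. A covariant derivative is a bilinear $\nabla:\mathfrak g\times\mathfrak g\to\mathfrak g$; torsion-free: $\nabla_XY-\nabla_YX=[X,Y]$; $\nabla_X$ is extended to $\mathfrak g^*$ by $(\nabla_X\alpha)(Y)=-\alpha(\nabla_XY)$ and to tensors as a derivation; symplectic: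 $\nabla_X\omega_r=0$. Kähler structure for $r$: a basis $e_1,\dots,e_n,f_1,\dots,f_n$ of $\mathfrak g$, a symmetric $A\in M_n(R)$ and an antisymmetric $B\in M_n(R)$ with $r=A^{k\ell}(e_k\otimes f_\ell-f_\ell\otimes e_k)+B^{k\ell}(e_k\otimes e_\ell+f_k\otimes f_\ell)$, together with a symplectic torsion-free $\nabla$ such that $s=A^{k\ell}(e_k\otimes e_\ell+f_k\otimes f_\ell)-B^{k\ell}(e_k\otimes f_\ell+f_\ell\otimes e_k)$ satisfies $\nabla_Xs=0$ for all $X$ and $(x\otimes x)(s)\ge0$ for all $x\in\mathfrak g^*$. Put $Z_k=\frac12(e_k-\mathrm if_k)$, $\overline Z_k=\frac12(e_k+\mathrm if_k)$ and $g=A+\mathrm iB$; then $\overline{z_k}g^{k\ell}z_\ell\ge0$ for all $z\in C^n$. Fedosov construction (everything extended $C$-linearly; summation convention). $\mathcal W\otimes\Lambda^\bullet=(\prod_k\mathrm S^k\mathfrak g_C^*\otimes\Lambda^\bullet\mathfrak g_C^* )[[t]]$, product $\mu$: $(f\otimes\alpha)(h\otimes\beta)=f\vee h\otimes\alpha\wedge\beta$, with involution $^*$ the complex conjugation (elements of $\mathfrak g^*$ and $t$ fixed). Total degree of $t^m\mathrm S^k\otimes\Lambda^\ell$ is $k+2m$; $\mathcal W_k$: components of total degree $\ge k$ only. $i_s,i_a$: symmetric/antisymmetric insertion derivations. $\delta=x^i\wedge i_s(x_i)$; $\delta^{-1}=\frac1{k+\ell}x^i\vee i_a(x_i)$ on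 $\mathrm S^k\otimes\Lambda^\ell$ for $k+\ell>0$, and $0$ for $k=\ell=0$; $\sigma$: projection to symmetric and antisymmetric degree $0$. Fiberwise Wick product: $a\circ_{\mathrm{Wick}}b=\mu\circ e^{\frac{\mathrm it}2\mathcal P_\pi}(a\otimes b)$, $\mathcal P_\pi=\pi^{ij}i_s(x_i)\otimes i_s(x_j)$, $\pi=r-\mathrm is$; equivalently $a\circ_{\mathrm{Wick}}b=\mu\circ e^{2tg^{k\ell}i_s(Z_k)\otimes i_s(\overline Z_\ell)}(a\otimes b)$. $\mathrm{ad}$: graded commutator for $\circ_{\mathrm{Wick}}$ w.r.t. antisymmetric degree. $D(f\otimes\alpha)=\nabla_{x_i}f\otimes x^i\wedge\alpha+f\otimes\delta_{CE}\alpha$. $\mathsf R=\frac14\omega_r(x_k,\tilde R(x_i,x_j)x_l)x^k\vee x^l\otimes x^i\wedge x^j$ with $\tilde R(X,Y)=\nabla_X\nabla_Y-\nabla_Y\nabla_X-\nabla_{[X,Y]}$. $\varrho\in\mathcal W_2\otimes\Lambda^1$ is the unique element with $\delta\varrho=\mathsf R+D\varrho+\frac1{\mathrm it}\varrho\circ_{\mathrm{Wick}}\varrho+\Omega$, $\delta^{-1}\varrho=0$. On $\prod_k(\mathcal A\otimes\mathrm S^k\mathfrak g_C^*\otimes\Lambda^\bullet\mathfrak g_C^* )[[t]]$ (operators above acting on the last two factors): $L_{\mathcal A}(\xi\otimes f\otimes\alpha)=x_i\triangleright\xi\otimes f\otimes x^i\wedge\alpha$, $\tau_{\mathrm{Wick}}(a)=\sum_{k\ge0}[\delta^{-1},D+L_{\mathcal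 A}+\frac1{\mathrm it}\mathrm{ad}(\varrho)]^k(a)$ (supercommutator, here an anticommutator), and $a\star_{\mathrm{Wick}}b=\sigma(m(\tau_{\mathrm{Wick}}(a),\tau_{\mathrm{Wick}}(b)))$ for $a,b\in\mathcal A[[t]]$, where $m(\xi_1\otimes a_1,\xi_2\otimes a_2)=\xi_1\xi_2\otimes a_1\circ_{\mathrm{Wick}}a_2$. This $\star_{\mathrm{Wick}}$ is a Hermitian deformation. *)

theory Defs
  imports
    "HOL-Analysis.Finite_Cartesian_Product"
    "HOL-Computational_Algebra.Formal_Power_Series"
    "HOL-Library.Multiset"
    "HOL-Library.Function_Algebras"
begin

section \<open>The ordered ring \<open>R\<close>, and \<open>C = R(i)\<close>\<close>

text \<open>A ring order given by a multiplicatively closed set of positive elements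
  with trichotomy leaves no zero divisors, so an ordered ring is a \<^class>\<open>linordered_idom\<close>.
  A ring homomorphism from the rationals is unique and injective; fixing it is only a
  way to name the rational constants.\<close>

class ordered_ring_with_rat = linordered_idom +
  fixes of_Q :: "rat \<Rightarrow> 'a"
  assumes of_Q_1: "of_Q 1 = 1"
    and of_Q_add: "of_Q (p + q) = of_Q p + of_Q q"
    and of_Q_mult: "of_Q (p * q) = of_Q p * of_Q q"

datatype 'r cx = Cx (cRe: 'r) (cIm: 'r)

instantiation cx :: (comm_ring_1) comm_ring_1
begin
definition "0 = Cx 0 0"
definition "1 = Cx 1 0"
definition "z + w = Cx (cRe z + cRe w) (cIm z + cIm w)"
definition "z - w = Cx (cRe z - cRe w) (cIm z - cIm w)"
definition "- z = Cx (- cRe z) (- cIm z)"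
definition "z * w = Cx (cRe z * cRe w - cIm z * cIm w) (cRe z * cIm w + cIm z * cRe w)"
instance
  by standard
    (auto simp: zero_cx_def one_cx_def plus_cx_def minus_cx_def uminus_cx_def times_cx_def
      algebra_simps intro: cx.expand)
end

definition cx_of :: "'r::zero \<Rightarrow> 'r cx" where "cx_of c = Cx c 0"
definition cx_i :: "'r::zero_neq_one cx" where "cx_i = Cx 0 1"
definition cx_cnj :: "'r::uminus cx \<Rightarrow> 'r cx" where "cx_cnj z = Cx (cRe z) (- cIm z)"
definition cx_nonneg :: "'r::ordered_ring_with_rat cx \<Rightarrow> bool" where
  "cx_nonneg z \<longleftrightarrow> (\<exists>c\<ge>0. z = cx_of c)"
definition cx_rat :: "rat \<Rightarrow> 'r::ordered_ring_with_rat cx" where "cx_rat q = cx_of (of_Q q)"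


section \<open>Formal power series in \<open>t\<close>\<close>

text \<open>\<open>V[[t]]\<close> is the type \<open>'v fps\<close>, with \<^term>\<open>fps_X\<close> for \<open>t\<close>; infinite sums are taken in
  the library's \<open>t\<close>-adic topology.\<close>

definition fps_coeffwise :: "('a \<Rightarrow> 'b) \<Rightarrow> 'a fps \<Rightarrow> 'b fps" where
  "fps_coeffwise h F = Abs_fps (\<lambda>n. h (fps_nth F n))"

definition fps_bilinear :: "('a \<Rightarrow> 'b \<Rightarrow> 'c::comm_monoid_add) \<Rightarrow> 'a fps \<Rightarrow> 'b fps \<Rightarrow> 'c fps" where
  "fps_bilinear b F G = Abs_fps (\<lambda>n. \<Sum>i=0..n. b (fps_nth F i) (fps_nth G (n - i)))"

definition fps_nonneg :: "'r::ordered_ring_with_rat fps \<Rightarrow> bool" where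
  "fps_nonneg F \<longleftrightarrow> F = 0 \<or> 0 < fps_nth F (subdegree F)"

definition cx_fps_nonneg :: "'r::ordered_ring_with_rat cx fps \<Rightarrow> bool" where
  "cx_fps_nonneg F \<longleftrightarrow> (\<exists>H. fps_nonneg H \<and> F = fps_coeffwise cx_of H)"


section \<open>Lie algebras, \<open>*\<close>-algebras, \<open>*\<close>-actions\<close>

type_synonym ('r, 'i) sqmat = "'r^'i^'i"

definition bilinear_map ::
  "('r::comm_ring_1 \<Rightarrow> 'u::ab_group_add \<Rightarrow> 'u) \<Rightarrow> ('r \<Rightarrow> 'v::ab_group_add \<Rightarrow> 'v) \<Rightarrow>
   ('r \<Rightarrow> 'w::ab_group_add \<Rightarrow> 'w) \<Rightarrow> ('u \<Rightarrow> 'v \<Rightarrow> 'w) \<Rightarrow> bool" where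
  "bilinear_map s1 s2 s3 b \<longleftrightarrow>
     (\<forall>u. module_hom s2 s3 (b u)) \<and> (\<forall>v. module_hom s1 s3 (\<lambda>u. b u v))"

definition lie_algebra ::
  "('r::comm_ring_1 \<Rightarrow> 'g::ab_group_add \<Rightarrow> 'g) \<Rightarrow> ('g \<Rightarrow> 'g \<Rightarrow> 'g) \<Rightarrow> bool" where
  "lie_algebra sg br \<longleftrightarrow> bilinear_map sg sg sg br \<and> (\<forall>X. br X X = 0) \<and>
     (\<forall>X Y Z. br X (br Y Z) + br Y (br Z X) + br Z (br X Y) = 0)"

definition is_basis ::
  "('r::comm_ring_1 \<Rightarrow> 'g::ab_group_add \<Rightarrow> 'g) \<Rightarrow> ('i \<Rightarrow> 'g) \<Rightarrow> bool" where
  "is_basis sg x \<longleftrightarrow> inj x \<and> \<not> module.dependent sg (range x) \<and> module.span sg (range x) = UNIV"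

text \<open>The value \<open>x\<^sup>i(v)\<close> of the dual basis.\<close>
definition coord ::
  "('r::comm_ring_1 \<Rightarrow> 'g::ab_group_add \<Rightarrow> 'g) \<Rightarrow> ('i \<Rightarrow> 'g) \<Rightarrow> 'g \<Rightarrow> 'i \<Rightarrow> 'r" where
  "coord sg x v i = module.representation sg (range x) v (x i)"

definition star_algebra ::
  "('r::ordered_ring_with_rat cx \<Rightarrow> 'a::ring_1 \<Rightarrow> 'a) \<Rightarrow> ('a \<Rightarrow> 'a) \<Rightarrow> bool" where
  "star_algebra sc st \<longleftrightarrow> bilinear_map sc sc sc (*) \<and>
     (\<forall>a b. st (a + b) = st a + st b) \<and> (\<forall>c a. st (sc c a) = sc (cx_cnj c) (st a)) \<and>
     (\<forall>a b. st (a * b) = st b * st a) \<and> (\<forall>a. st (st a) = a)"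

definition star_action ::
  "('r::ordered_ring_with_rat \<Rightarrow> 'g::ab_group_add \<Rightarrow> 'g) \<Rightarrow> ('g \<Rightarrow> 'g \<Rightarrow> 'g) \<Rightarrow>
   ('r cx \<Rightarrow> 'a::ring_1 \<Rightarrow> 'a) \<Rightarrow> ('a \<Rightarrow> 'a) \<Rightarrow> ('g \<Rightarrow> 'a \<Rightarrow> 'a) \<Rightarrow> bool" where
  "star_action sg br sc st act \<longleftrightarrow>
     bilinear_map sg (\<lambda>c. sc (cx_of c)) (\<lambda>c. sc (cx_of c)) act \<and>
     (\<forall>X. module_hom sc sc (act X)) \<and>
     (\<forall>X a b. act X (a * b) = act X a * b + a * act X b) \<and>
     (\<forall>X Y a. act (br X Y) a = act X (act Y a) - act Y (act X a)) \<and>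
     (\<forall>X a. st (act X a) = act X (st a))"

definition positive_functional ::
  "('r::ordered_ring_with_rat cx \<Rightarrow> 'a::ring_1 \<Rightarrow> 'a) \<Rightarrow> ('a \<Rightarrow> 'a) \<Rightarrow> ('a \<Rightarrow> 'r cx) \<Rightarrow> bool" where
  "positive_functional sc st \<omega> \<longleftrightarrow> module_hom sc (*) \<omega> \<and> (\<forall>a. cx_nonneg (\<omega> (st a * a)))"

definition strongly_positive ::
  "('r::ordered_ring_with_rat cx \<Rightarrow> 'a::ring_1 \<Rightarrow> 'a) \<Rightarrow> ('a \<Rightarrow> 'a) \<Rightarrow>
   ('a fps \<Rightarrow> 'a fps \<Rightarrow> 'a fps) \<Rightarrow> bool" where
  "strongly_positive sc st sp \<longleftrightarrow> (\<forall>\<omega>. positive_functional sc st \<omega> \<longrightarrow>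
     (\<forall>a. cx_fps_nonneg (fps_coeffwise \<omega> (sp (fps_coeffwise st a) a))))"


section \<open>Multivectors and the Gerstenhaber bracket\<close>

text \<open>For a finite linearly ordered index set, the set \<open>I = {i\<^sub>1 < \<dots> < i\<^sub>p}\<close> stands for the
  exterior monomial \<open>x\<^sub>i\<^sub>1 \<and> \<dots> \<and> x\<^sub>i\<^sub>p\<close> (or that of the dual basis), and an element of the
  exterior algebra is the function giving its coefficients. For disjoint \<open>J\<close> and \<open>K\<close> the
  product of the monomials of \<open>J\<close> and \<open>K\<close> is, up to the sign below, that of \<open>J \<union> K\<close>.\<close>

definition wedge_sign :: "'i::linorder set \<Rightarrow> 'i set \<Rightarrow> 'v::ab_group_add \<Rightarrow> 'v" where
  "wedge_sign J K v = (if even (card {(j, k). j \<in> J \<and> k \<in> K \<and> k < j}) then v else - v)"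

definition mv_wedge ::
  "('i::{finite,linorder} set \<Rightarrow> 'r::comm_ring_1) \<Rightarrow> ('i set \<Rightarrow> 'r) \<Rightarrow> 'i set \<Rightarrow> 'r" where
  "mv_wedge P Q I = (\<Sum>J\<in>Pow I. wedge_sign J (I - J) (P J * Q (I - J)))"

definition mv_monomial :: "'i set \<Rightarrow> 'i set \<Rightarrow> 'r::comm_ring_1" where
  "mv_monomial J I = (if I = J then 1 else 0)"

definition mv_vector ::
  "('r::comm_ring_1 \<Rightarrow> 'g::ab_group_add \<Rightarrow> 'g) \<Rightarrow> ('i::finite \<Rightarrow> 'g) \<Rightarrow> 'g \<Rightarrow> 'i set \<Rightarrow> 'r" where
  "mv_vector sg x v I = (\<Sum>i\<in>UNIV. coord sg x v i * mv_monomial {i} I)"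

text \<open>\<open>[[X\<^sub>1\<and>\<dots>\<and>X\<^sub>p, Y\<^sub>1\<and>\<dots>\<and>Y\<^sub>q]] = \<Sum> (-1)\<^sup>a\<^sup>+\<^sup>b [X\<^sub>a,Y\<^sub>b] \<and> X\<^sub>1\<and>\<dots>(omit X\<^sub>a)\<dots>\<and>X\<^sub>p \<and> Y\<^sub>1\<and>\<dots>(omit Y\<^sub>b)\<dots>\<and>Y\<^sub>q\<close>,
  extended bilinearly from monomials.\<close>
definition gerstenhaber_bracket ::
  "('r::comm_ring_1 \<Rightarrow> 'g::ab_group_add \<Rightarrow> 'g) \<Rightarrow> ('g \<Rightarrow> 'g \<Rightarrow> 'g) \<Rightarrow> ('i::{finite,linorder} \<Rightarrow> 'g) \<Rightarrow>
   ('i set \<Rightarrow> 'r) \<Rightarrow> ('i set \<Rightarrow> 'r) \<Rightarrow> 'i set \<Rightarrow> 'r" where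
  "gerstenhaber_bracket sg br x P Q I =
     (\<Sum>J\<in>UNIV. \<Sum>K\<in>UNIV. \<Sum>j\<in>J. \<Sum>k\<in>K. P J * Q K *
        wedge_sign {j} (J - {j}) (wedge_sign {k} (K - {k})
          (mv_wedge (mv_vector sg x (br (x j) (x k)))
             (mv_wedge (mv_monomial (J - {j})) (mv_monomial (K - {k}))) I)))"

text \<open>A 2-tensor is given by its matrix in the basis \<open>x\<close>, with \<open>u \<and> v = u \<otimes> v - v \<otimes> u\<close>.\<close>
definition bivector :: "('r::comm_ring_1, 'i) sqmat \<Rightarrow> 'i::{finite,linorder} set \<Rightarrow> 'r" where
  "bivector r I = (\<Sum>i\<in>UNIV. \<Sum>j\<in>{i<..}. r $ i $ j * mv_monomial {i, j} I)"

definition classical_r_matrix ::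
  "('r::comm_ring_1 \<Rightarrow> 'g::ab_group_add \<Rightarrow> 'g) \<Rightarrow> ('g \<Rightarrow> 'g \<Rightarrow> 'g) \<Rightarrow> ('i::{finite,linorder} \<Rightarrow> 'g) \<Rightarrow>
   ('r, 'i) sqmat \<Rightarrow> bool" where
  "classical_r_matrix sg br x r \<longleftrightarrow> transpose r = - r \<and>
     gerstenhaber_bracket sg br x (bivector r) (bivector r) = (\<lambda>I. 0)"


section \<open>Kaehler structures\<close>

text \<open>\<open>\<omega>\<^sub>r(X,Y)\<close>, with \<open>\<alpha> \<and> \<beta>\<close> evaluated as \<open>\<alpha>(X)\<beta>(Y) - \<alpha>(Y)\<beta>(X)\<close>, so that \<open>\<omega>\<^sub>r(x\<^sub>i,x\<^sub>j) = \<omega>\<^sub>i\<^sub>j\<close>.\<close>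
definition omega_form ::
  "('r::comm_ring_1 \<Rightarrow> 'g::ab_group_add \<Rightarrow> 'g) \<Rightarrow> ('i::finite \<Rightarrow> 'g) \<Rightarrow> ('r, 'i) sqmat \<Rightarrow> 'g \<Rightarrow> 'g \<Rightarrow> 'r" where
  "omega_form sg x r X Y =
     (\<Sum>i\<in>UNIV. \<Sum>j\<in>UNIV. matrix_inv r $ i $ j * coord sg x X i * coord sg x Y j)"

definition torsion_free :: "('g::ab_group_add \<Rightarrow> 'g \<Rightarrow> 'g) \<Rightarrow> ('g \<Rightarrow> 'g \<Rightarrow> 'g) \<Rightarrow> bool" where
  "torsion_free br nabla \<longleftrightarrow> (\<forall>X Y. nabla X Y - nabla Y X = br X Y)"

definition nabla_bilinear_form ::
  "('g::ab_group_add \<Rightarrow> 'g \<Rightarrow> 'g) \<Rightarrow> 'g \<Rightarrow> ('g \<Rightarrow> 'g \<Rightarrow> 'r::comm_ring_1) \<Rightarrow> 'g \<Rightarrow> 'g \<Rightarrow> 'r" where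
  "nabla_bilinear_form nabla X b Y Z = - b (nabla X Y) Z - b Y (nabla X Z)"

definition tensor_matrix ::
  "('r::comm_ring_1 \<Rightarrow> 'g::ab_group_add \<Rightarrow> 'g) \<Rightarrow> ('i::finite \<Rightarrow> 'g) \<Rightarrow> 'g \<Rightarrow> 'g \<Rightarrow> ('r, 'i) sqmat" where
  "tensor_matrix sg x u v = (\<chi> i j. coord sg x u i * coord sg x v j)"

definition nabla_tensor ::
  "('r::comm_ring_1 \<Rightarrow> 'g::ab_group_add \<Rightarrow> 'g) \<Rightarrow> ('i::finite \<Rightarrow> 'g) \<Rightarrow> ('g \<Rightarrow> 'g \<Rightarrow> 'g) \<Rightarrow> 'g \<Rightarrow>
   ('r, 'i) sqmat \<Rightarrow> ('r, 'i) sqmat" where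
  "nabla_tensor sg x nabla X s = (\<chi> i j. \<Sum>k\<in>UNIV. \<Sum>l\<in>UNIV. s $ k $ l *
     (tensor_matrix sg x (nabla X (x k)) (x l) + tensor_matrix sg x (x k) (nabla X (x l))) $ i $ j)"

definition kaehler_r ::
  "('r::comm_ring_1 \<Rightarrow> 'g::ab_group_add \<Rightarrow> 'g) \<Rightarrow> ('i::finite \<Rightarrow> 'g) \<Rightarrow>
   ('n::finite \<Rightarrow> 'g) \<Rightarrow> ('n \<Rightarrow> 'g) \<Rightarrow> ('r, 'n) sqmat \<Rightarrow> ('r, 'n) sqmat \<Rightarrow> ('r, 'i) sqmat" where
  "kaehler_r sg x e f A B = (\<chi> i j. \<Sum>k\<in>UNIV. \<Sum>l\<in>UNIV.
     A $ k $ l * (tensor_matrix sg x (e k) (f l) - tensor_matrix sg x (f l) (e k)) $ i $ j +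
     B $ k $ l * (tensor_matrix sg x (e k) (e l) + tensor_matrix sg x (f k) (f l)) $ i $ j)"

definition kaehler_s ::
  "('r::comm_ring_1 \<Rightarrow> 'g::ab_group_add \<Rightarrow> 'g) \<Rightarrow> ('i::finite \<Rightarrow> 'g) \<Rightarrow>
   ('n::finite \<Rightarrow> 'g) \<Rightarrow> ('n \<Rightarrow> 'g) \<Rightarrow> ('r, 'n) sqmat \<Rightarrow> ('r, 'n) sqmat \<Rightarrow> ('r, 'i) sqmat" where
  "kaehler_s sg x e f A B = (\<chi> i j. \<Sum>k\<in>UNIV. \<Sum>l\<in>UNIV.
     A $ k $ l * (tensor_matrix sg x (e k) (e l) + tensor_matrix sg x (f k) (f l)) $ i $ j -
     B $ k $ l * (tensor_matrix sg x (e k) (f l) + tensor_matrix sg x (f l) (e k)) $ i $ j)"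

definition kaehler_structure ::
  "('r::ordered_ring_with_rat \<Rightarrow> 'g::ab_group_add \<Rightarrow> 'g) \<Rightarrow> ('g \<Rightarrow> 'g \<Rightarrow> 'g) \<Rightarrow> ('i::finite \<Rightarrow> 'g) \<Rightarrow>
   ('r, 'i) sqmat \<Rightarrow> ('n::finite \<Rightarrow> 'g) \<Rightarrow> ('n \<Rightarrow> 'g) \<Rightarrow> ('r, 'n) sqmat \<Rightarrow> ('r, 'n) sqmat \<Rightarrow> ('g \<Rightarrow> 'g \<Rightarrow> 'g) \<Rightarrow> bool" where
  "kaehler_structure sg br x r e f A B nabla \<longleftrightarrow>
     is_basis sg (case_sum e f) \<and> transpose A = A \<and> transpose B = - B \<and>
     r = kaehler_r sg x e f A B \<and>
     bilinear_map sg sg sg nabla \<and> torsion_free br nabla \<and>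
     (\<forall>X Y Z. nabla_bilinear_form nabla X (omega_form sg x r) Y Z = 0) \<and>
     (\<forall>X. nabla_tensor sg x nabla X (kaehler_s sg x e f A B) = 0) \<and>
     (\<forall>\<phi>. module_hom sg (*) \<phi> \<longrightarrow>
        0 \<le> (\<Sum>i\<in>UNIV. \<Sum>j\<in>UNIV. kaehler_s sg x e f A B $ i $ j * \<phi> (x i) * \<phi> (x j)))"

definition kaehler_g :: "('r, 'n::finite) sqmat \<Rightarrow> ('r, 'n) sqmat \<Rightarrow> 'n \<Rightarrow> 'n \<Rightarrow> 'r::comm_ring_1 cx" where
  "kaehler_g A B k l = Cx (A $ k $ l) (B $ k $ l)"

text \<open>Elements of \<open>g\<^sub>C\<close> are given by their coordinates in the basis \<open>x\<close>.\<close>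
definition Zbar ::
  "('r::ordered_ring_with_rat \<Rightarrow> 'g::ab_group_add \<Rightarrow> 'g) \<Rightarrow> ('i \<Rightarrow> 'g) \<Rightarrow>
   ('n \<Rightarrow> 'g) \<Rightarrow> ('n \<Rightarrow> 'g) \<Rightarrow> 'n \<Rightarrow> 'i \<Rightarrow> 'r cx" where
  "Zbar sg x e f k i =
     cx_rat (1/2) * (cx_of (coord sg x (e k) i) + cx_i * cx_of (coord sg x (f k) i))"

definition wick_tensor :: "('r::ordered_ring_with_rat, 'i::finite) sqmat \<Rightarrow> ('r, 'i) sqmat \<Rightarrow> 'i \<Rightarrow> 'i \<Rightarrow> 'r cx" where
  "wick_tensor r s i j = cx_of (r $ i $ j) - cx_i * cx_of (s $ i $ j)"


section \<open>The algebras \<open>W \<otimes> \<Lambda>\<close> and \<open>A \<otimes> W \<otimes> \<Lambda>\<close>\<close>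

text \<open>An element of \<open>(\<Prod>\<^sub>k A \<otimes> S\<^sup>k \<otimes> \<Lambda>)[[t]]\<close> is given by its coefficients in \<open>A[[t]]\<close> at the monomials
  \<open>x\<^sup>M \<otimes> x\<^sup>I\<close>, where the multiset \<open>M\<close> of indices stands for a symmetric and the set \<open>I\<close> for an
  exterior monomial in the dual basis \<open>(x\<^sup>i)\<close>. The algebra \<open>W \<otimes> \<Lambda>\<close> itself is the case \<open>A = C\<close>.
  Operators that need scalars from \<open>C\<close> take the scalar multiplication \<open>sc\<close> of \<open>A\<close>.\<close>

type_synonym ('i, 'a) weyl = "'i multiset \<Rightarrow> 'i set \<Rightarrow> 'a fps"

definition weyl_scale :: "('c \<Rightarrow> 'a \<Rightarrow> 'b) \<Rightarrow> 'c \<Rightarrow> ('i, 'a) weyl \<Rightarrow> ('i, 'b) weyl" where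
  "weyl_scale sc c F = (\<lambda>M I. fps_coeffwise (sc c) (F M I))"

definition weyl_embed :: "'a fps \<Rightarrow> ('i, 'a::zero) weyl" where
  "weyl_embed a = (\<lambda>M I. if M = {#} \<and> I = {} then a else 0)"

definition weyl_sigma :: "('i, 'a) weyl \<Rightarrow> 'a fps" where
  "weyl_sigma F = F {#} {}"

text \<open>\<open>i\<^sub>s(x\<^sub>i)\<close>, \<open>i\<^sub>a(x\<^sub>i)\<close>, \<open>x\<^sup>i \<or>\<close> and \<open>x\<^sup>i \<and>\<close> (all acting from the left).\<close>
definition ins_s :: "'i \<Rightarrow> ('i, 'a::ring_1) weyl \<Rightarrow> ('i, 'a) weyl" where
  "ins_s i F = (\<lambda>M I. of_nat (Suc (count M i)) * F (add_mset i M) I)"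

definition ins_a :: "'i::linorder \<Rightarrow> ('i, 'a::ring_1) weyl \<Rightarrow> ('i, 'a) weyl" where
  "ins_a i F = (\<lambda>M I. if i \<in> I then 0 else wedge_sign {i} I (F M (insert i I)))"

definition mult_s :: "'i \<Rightarrow> ('i, 'a::ring_1) weyl \<Rightarrow> ('i, 'a) weyl" where
  "mult_s i F = (\<lambda>M I. if i \<in># M then F (M - {#i#}) I else 0)"

definition mult_a :: "'i::linorder \<Rightarrow> ('i, 'a::ring_1) weyl \<Rightarrow> ('i, 'a) weyl" where
  "mult_a i F = (\<lambda>M I. if i \<in> I then wedge_sign {i} (I - {i}) (F M (I - {i})) else 0)"

definition ins_s_vec ::
  "('c \<Rightarrow> 'a \<Rightarrow> 'a) \<Rightarrow> ('i::finite \<Rightarrow> 'c) \<Rightarrow> ('i, 'a::ring_1) weyl \<Rightarrow> ('i, 'a) weyl" where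
  "ins_s_vec sc z F = (\<Sum>i\<in>UNIV. weyl_scale sc (z i) (ins_s i F))"

definition weyl_mult ::
  "('a \<Rightarrow> 'b \<Rightarrow> 'c) \<Rightarrow> ('i::{finite,linorder}, 'a) weyl \<Rightarrow> ('i, 'b) weyl \<Rightarrow> ('i, 'c::ring_1) weyl" where
  "weyl_mult pr F G = (\<lambda>M I. \<Sum>K\<in>{K. K \<subseteq># M}. \<Sum>J\<in>Pow I.
     wedge_sign J (I - J) (fps_bilinear pr (F K J) (G (M - K) (I - J))))"

text \<open>The fiberwise Wick product, with the exponential written out. The bilinear map \<open>pr\<close>
  multiplies the coefficients of the two factors: it is the product of \<open>C\<close> or \<open>A\<close>, or the scalar
  multiplication when only one of the factors has coefficients in \<open>A\<close>.\<close>
definition wick_power ::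
  "('r cx \<Rightarrow> 'c \<Rightarrow> 'c) \<Rightarrow> ('a \<Rightarrow> 'b \<Rightarrow> 'c) \<Rightarrow> ('i \<Rightarrow> 'i \<Rightarrow> 'r::ordered_ring_with_rat cx) \<Rightarrow> nat \<Rightarrow>
   ('i::{finite,linorder}, 'a::ring_1) weyl \<Rightarrow> ('i, 'b::ring_1) weyl \<Rightarrow> ('i, 'c::ring_1) weyl" where
  "wick_power sc pr \<pi> m F G =
     (\<Sum>is | length is = m. \<Sum>js | length js = m. weyl_scale sc (\<Prod>p<m. \<pi> (is ! p) (js ! p))
        (weyl_mult pr (foldr ins_s is F) (foldr ins_s js G)))"

definition wick_mult ::
  "('r cx \<Rightarrow> 'c \<Rightarrow> 'c) \<Rightarrow> ('a \<Rightarrow> 'b \<Rightarrow> 'c) \<Rightarrow> ('i \<Rightarrow> 'i \<Rightarrow> 'r::ordered_ring_with_rat cx) \<Rightarrow>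
   ('i::{finite,linorder}, 'a::ring_1) weyl \<Rightarrow> ('i, 'b::ring_1) weyl \<Rightarrow> ('i, 'c::ring_1) weyl" where
  "wick_mult sc pr \<pi> F G = (\<lambda>M I. \<Sum>m.
     fps_bilinear sc (fps_const (cx_rat (1 / fact m)) * (fps_const (cx_i * cx_rat (1/2)) * fps_X) ^ m)
       (wick_power sc pr \<pi> m F G M I))"

text \<open>Multiplication by \<open>1/(it)\<close>; only meaningful on elements divisible by \<open>t\<close>.\<close>
definition div_it ::
  "('r::ordered_ring_with_rat cx \<Rightarrow> 'a \<Rightarrow> 'a) \<Rightarrow> ('i, 'a::ring_1) weyl \<Rightarrow> ('i, 'a) weyl" where
  "div_it sc F = weyl_scale sc (- cx_i) (\<lambda>M I. fps_shift 1 (F M I))"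

text \<open>The graded commutator with an element of odd antisymmetric degree.\<close>
definition ad_odd ::
  "('r cx \<Rightarrow> 'a \<Rightarrow> 'a) \<Rightarrow> ('i \<Rightarrow> 'i \<Rightarrow> 'r::ordered_ring_with_rat cx) \<Rightarrow>
   ('i::{finite,linorder}, 'r cx) weyl \<Rightarrow> ('i, 'a::ring_1) weyl \<Rightarrow> ('i, 'a) weyl" where
  "ad_odd sc \<pi> \<rho> F = wick_mult sc sc \<pi> \<rho> F -
     wick_mult sc (\<lambda>a c. sc c a) \<pi> (\<lambda>M I. if even (card I) then F M I else - F M I) \<rho>"


section \<open>The Fedosov construction\<close>

definition delta :: "('i::{finite,linorder}, 'a::ring_1) weyl \<Rightarrow> ('i, 'a) weyl" where
  "delta F = (\<Sum>i\<in>UNIV. mult_a i (ins_s i F))"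

text \<open>Since \<open>1/0 = 0\<close>, the case \<open>k = l = 0\<close> is covered.\<close>
definition delta_inv ::
  "('r::ordered_ring_with_rat cx \<Rightarrow> 'a \<Rightarrow> 'a) \<Rightarrow>
   ('i::{finite,linorder}, 'a::ring_1) weyl \<Rightarrow> ('i, 'a) weyl" where
  "delta_inv sc F = (\<Sum>i\<in>UNIV. mult_s i (ins_a i
     (\<lambda>M I. fps_coeffwise (sc (cx_rat (1 / of_nat (size M + card I)))) (F M I))))"

text \<open>On the symmetric algebra, the derivation with \<open>\<nabla>\<^sub>X x\<^sup>k = - \<Sum>\<^sub>j x\<^sup>k(\<nabla>\<^sub>X x\<^sub>j) x\<^sup>j\<close>.\<close>
definition nabla_S ::
  "('r::ordered_ring_with_rat \<Rightarrow> 'g::ab_group_add \<Rightarrow> 'g) \<Rightarrow> ('i::{finite,linorder} \<Rightarrow> 'g) \<Rightarrow>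
   ('g \<Rightarrow> 'g \<Rightarrow> 'g) \<Rightarrow> ('r cx \<Rightarrow> 'a \<Rightarrow> 'a) \<Rightarrow> 'g \<Rightarrow> ('i, 'a::ring_1) weyl \<Rightarrow> ('i, 'a) weyl" where
  "nabla_S sg x nabla sc X F = (\<Sum>k\<in>UNIV. \<Sum>j\<in>UNIV.
     weyl_scale sc (cx_of (- coord sg x (nabla X (x j)) k)) (mult_s j (ins_s k F)))"

text \<open>The graded derivation with \<open>(\<delta>\<^sub>C\<^sub>E x\<^sup>k)(X,Y) = - x\<^sup>k([X,Y])\<close>.\<close>
definition delta_CE ::
  "('r::ordered_ring_with_rat \<Rightarrow> 'g::ab_group_add \<Rightarrow> 'g) \<Rightarrow> ('g \<Rightarrow> 'g \<Rightarrow> 'g) \<Rightarrow>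
   ('i::{finite,linorder} \<Rightarrow> 'g) \<Rightarrow> ('r cx \<Rightarrow> 'a \<Rightarrow> 'a) \<Rightarrow> ('i, 'a::ring_1) weyl \<Rightarrow> ('i, 'a) weyl" where
  "delta_CE sg br x sc F = (\<Sum>k\<in>UNIV. \<Sum>i\<in>UNIV. \<Sum>j\<in>UNIV.
     weyl_scale sc (cx_rat (- 1/2) * cx_of (coord sg x (br (x i) (x j)) k))
       (mult_a i (mult_a j (ins_a k F))))"

definition fedosov_D ::
  "('r::ordered_ring_with_rat \<Rightarrow> 'g::ab_group_add \<Rightarrow> 'g) \<Rightarrow> ('g \<Rightarrow> 'g \<Rightarrow> 'g) \<Rightarrow>
   ('i::{finite,linorder} \<Rightarrow> 'g) \<Rightarrow> ('g \<Rightarrow> 'g \<Rightarrow> 'g) \<Rightarrow> ('r cx \<Rightarrow> 'a \<Rightarrow> 'a) \<Rightarrow>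
   ('i, 'a::ring_1) weyl \<Rightarrow> ('i, 'a) weyl" where
  "fedosov_D sg br x nabla sc F =
     (\<Sum>i\<in>UNIV. mult_a i (nabla_S sg x nabla sc (x i) F)) + delta_CE sg br x sc F"

definition curvature ::
  "('g::ab_group_add \<Rightarrow> 'g \<Rightarrow> 'g) \<Rightarrow> ('g \<Rightarrow> 'g \<Rightarrow> 'g) \<Rightarrow> 'g \<Rightarrow> 'g \<Rightarrow> 'g \<Rightarrow> 'g" where
  "curvature br nabla X Y Z = nabla X (nabla Y Z) - nabla Y (nabla X Z) - nabla (br X Y) Z"

definition fedosov_R ::
  "('r::ordered_ring_with_rat \<Rightarrow> 'g::ab_group_add \<Rightarrow> 'g) \<Rightarrow> ('g \<Rightarrow> 'g \<Rightarrow> 'g) \<Rightarrow>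
   ('i::{finite,linorder} \<Rightarrow> 'g) \<Rightarrow> ('r, 'i) sqmat \<Rightarrow> ('g \<Rightarrow> 'g \<Rightarrow> 'g) \<Rightarrow> ('i, 'r cx) weyl" where
  "fedosov_R sg br x r nabla = (\<Sum>i\<in>UNIV. \<Sum>j\<in>UNIV. \<Sum>k\<in>UNIV. \<Sum>l\<in>UNIV.
     weyl_scale (*) (cx_rat (1/4) * cx_of (omega_form sg x r (x k) (curvature br nabla (x i) (x j) (x l))))
       (mult_s k (mult_s l (mult_a i (mult_a j (weyl_embed 1))))))"

definition closed_hermitian_two_form ::
  "('r::ordered_ring_with_rat \<Rightarrow> 'g::ab_group_add \<Rightarrow> 'g) \<Rightarrow> ('g \<Rightarrow> 'g \<Rightarrow> 'g) \<Rightarrow>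
   ('i::{finite,linorder} \<Rightarrow> 'g) \<Rightarrow> ('i, 'r cx) weyl \<Rightarrow> bool" where
  "closed_hermitian_two_form sg br x \<Omega> \<longleftrightarrow>
     (\<forall>M I m. fps_nth (\<Omega> M I) m \<noteq> 0 \<longrightarrow> M = {#} \<and> card I = 2 \<and> 1 \<le> m) \<and>
     (\<forall>M I. fps_coeffwise cx_cnj (\<Omega> M I) = \<Omega> M I) \<and>
     delta_CE sg br x (*) \<Omega> = 0"

text \<open>The conditions that single out \<open>\<rho> \<in> W\<^sub>2 \<otimes> \<Lambda>\<^sup>1\<close>.\<close>
definition is_fedosov_rho ::
  "('r::ordered_ring_with_rat \<Rightarrow> 'g::ab_group_add \<Rightarrow> 'g) \<Rightarrow> ('g \<Rightarrow> 'g \<Rightarrow> 'g) \<Rightarrow>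
   ('i::{finite,linorder} \<Rightarrow> 'g) \<Rightarrow> ('r, 'i) sqmat \<Rightarrow> ('g \<Rightarrow> 'g \<Rightarrow> 'g) \<Rightarrow> ('i \<Rightarrow> 'i \<Rightarrow> 'r cx) \<Rightarrow>
   ('i, 'r cx) weyl \<Rightarrow> ('i, 'r cx) weyl \<Rightarrow> bool" where
  "is_fedosov_rho sg br x r nabla \<pi> \<Omega> \<rho> \<longleftrightarrow>
     (\<forall>M I m. fps_nth (\<rho> M I) m \<noteq> 0 \<longrightarrow> card I = 1 \<and> 2 \<le> size M + 2 * m) \<and>
     delta \<rho> = fedosov_R sg br x r nabla + fedosov_D sg br x nabla (*) \<rho>
       + div_it (*) (wick_mult (*) (*) \<pi> \<rho> \<rho>) + \<Omega> \<and>
     delta_inv (*) \<rho> = 0"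

definition action_L ::
  "('g \<Rightarrow> 'a \<Rightarrow> 'a) \<Rightarrow> ('i::{finite,linorder} \<Rightarrow> 'g) \<Rightarrow> ('i, 'a::ring_1) weyl \<Rightarrow> ('i, 'a) weyl" where
  "action_L act x F = (\<Sum>i\<in>UNIV. mult_a i (weyl_scale act (x i) F))"

definition fedosov_step ::
  "('r::ordered_ring_with_rat \<Rightarrow> 'g::ab_group_add \<Rightarrow> 'g) \<Rightarrow> ('g \<Rightarrow> 'g \<Rightarrow> 'g) \<Rightarrow>
   ('i::{finite,linorder} \<Rightarrow> 'g) \<Rightarrow> ('g \<Rightarrow> 'g \<Rightarrow> 'g) \<Rightarrow> ('i \<Rightarrow> 'i \<Rightarrow> 'r cx) \<Rightarrow> ('i, 'r cx) weyl \<Rightarrow>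
   ('r cx \<Rightarrow> 'a \<Rightarrow> 'a) \<Rightarrow> ('g \<Rightarrow> 'a \<Rightarrow> 'a) \<Rightarrow> ('i, 'a::ring_1) weyl \<Rightarrow> ('i, 'a) weyl" where
  "fedosov_step sg br x nabla \<pi> \<rho> sc act F =
     (let T = (\<lambda>G. fedosov_D sg br x nabla sc G + action_L act x G + div_it sc (ad_odd sc \<pi> \<rho> G))
      in delta_inv sc (T F) + T (delta_inv sc F))"

definition fedosov_tau ::
  "('r::ordered_ring_with_rat \<Rightarrow> 'g::ab_group_add \<Rightarrow> 'g) \<Rightarrow> ('g \<Rightarrow> 'g \<Rightarrow> 'g) \<Rightarrow>
   ('i::{finite,linorder} \<Rightarrow> 'g) \<Rightarrow> ('g \<Rightarrow> 'g \<Rightarrow> 'g) \<Rightarrow> ('i \<Rightarrow> 'i \<Rightarrow> 'r cx) \<Rightarrow> ('i, 'r cx) weyl \<Rightarrow>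
   ('r cx \<Rightarrow> 'a \<Rightarrow> 'a) \<Rightarrow> ('g \<Rightarrow> 'a \<Rightarrow> 'a) \<Rightarrow> 'a fps \<Rightarrow> ('i, 'a::ring_1) weyl" where
  "fedosov_tau sg br x nabla \<pi> \<rho> sc act a =
     (\<lambda>M I. \<Sum>k. (fedosov_step sg br x nabla \<pi> \<rho> sc act ^^ k) (weyl_embed a) M I)"

definition fedosov_star ::
  "('r::ordered_ring_with_rat \<Rightarrow> 'g::ab_group_add \<Rightarrow> 'g) \<Rightarrow> ('g \<Rightarrow> 'g \<Rightarrow> 'g) \<Rightarrow>
   ('i::{finite,linorder} \<Rightarrow> 'g) \<Rightarrow> ('g \<Rightarrow> 'g \<Rightarrow> 'g) \<Rightarrow> ('i \<Rightarrow> 'i \<Rightarrow> 'r cx) \<Rightarrow> ('i, 'r cx) weyl \<Rightarrow>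
   ('r cx \<Rightarrow> 'a \<Rightarrow> 'a) \<Rightarrow> ('g \<Rightarrow> 'a \<Rightarrow> 'a) \<Rightarrow> 'a fps \<Rightarrow> 'a fps \<Rightarrow> 'a::ring_1 fps" where
  "fedosov_star sg br x nabla \<pi> \<rho> sc act a b =
     weyl_sigma (wick_mult sc (*) \<pi> (fedosov_tau sg br x nabla \<pi> \<rho> sc act a)
                                    (fedosov_tau sg br x nabla \<pi> \<rho> sc act b))"

text \<open>\<open>a\<^bsub>k\<^sub>1\<dots>k\<^sub>m\<^esub> = \<sigma>(i\<^sub>s(Z\<^sub>1) \<dots> i\<^sub>s(Z\<^sub>m) F)\<close> for \<open>F = \<tau>(a)\<close> and a list of vectors \<open>Z\<^sub>p\<close>.\<close>
definition taylor_component ::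
  "('c \<Rightarrow> 'a \<Rightarrow> 'a) \<Rightarrow> ('n \<Rightarrow> 'i::finite \<Rightarrow> 'c) \<Rightarrow> ('i, 'a::ring_1) weyl \<Rightarrow> 'n list \<Rightarrow> 'a fps" where
  "taylor_component sc Z F ks = weyl_sigma (foldr (\<lambda>k. ins_s_vec sc (Z k)) ks F)"

end

theory Submission
  imports Defs
begin

text \<open>In the basis \<open>Z\<^sub>k\<close>, \<open>Z\<^sub>l\<close>-bar the tensor \<open>(i/2) \<pi>\<close> of the fiberwise Wick product is
  \<open>2 g\<^sup>k\<^sup>l Z\<^sub>k \<otimes> Z\<^sub>l\<close>-bar (\<open>wick_tensor_kaehler\<close>). Hence in \<open>\<sigma>(F\<^sup>* \<circ> F)\<close> the term of order \<open>m\<close> of the exponential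
  is \<open>(2t)\<^sup>m/m!\<close> times the contraction of \<open>g \<otimes> \<dots> \<otimes> g\<close> with \<open>F\<^sub>k\<^sup>* F\<^sub>l\<close>, where \<open>F\<^sub>l\<close> runs through the
  components of \<open>F\<close> along the \<open>Z\<^sub>l\<close>-bar: an antiholomorphic derivative of \<open>F\<close>, conjugated, is a
  holomorphic derivative of \<open>F\<^sup>*\<close> (\<open>wick_product_squares\<close>). Both claims are about \<open>F = \<tau>(a)\<close>, and they
  follow once \<open>\<tau>(a\<^sup>*) = \<tau>(a)\<^sup>*\<close>.

  This reality of \<open>\<tau>\<close> is the main part of the proof. Since \<open>(i/2) \<pi>\<close> is Hermitian, the involution
  reverses fiberwise products with a one-form, up to the sign of the exterior algebra (\<open>weyl_conj_wick_mult\<close>). It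
  therefore changes the sign of a commutator with a real one-form, and as \<open>1/(it)\<close> is imaginary,
  \<open>ad(\<rho>)/(it)\<close> commutes with it as soon as \<open>\<rho>\<close> is real. Now \<open>\<rho>\<^sup>*\<close> solves the equations that define
  \<open>\<rho>\<close>, and these have at most one solution (\<open>fedosov_rho_unique\<close>): by the Hodge identity
  \<open>\<delta>\<^sup>-\<^sup>1 \<delta> + \<delta> \<delta>\<^sup>-\<^sup>1 = id - \<sigma>\<close> they amount to a fixed point equation \<open>\<rho> = \<delta>\<^sup>-\<^sup>1(\<dots>)\<close> which is contracting
  for the total degree. The same degree count shows that the series for \<open>\<tau>\<close> is locally finite, so the
  involution may be applied to it term by term (\<open>weyl_conj_fedosov_tau\<close>).

  For strong positivity it remains to see that the contraction of \<open>g \<otimes> \<dots> \<otimes> g\<close> with \<open>\<omega>(b\<^sub>k\<^sup>* b\<^sub>l)\<close> is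
  nonnegative for all families \<open>b\<close> in \<open>A[[t]]\<close> (\<open>tensor_power_nonneg\<close>). The ring \<open>R\<close> need not
  contain inverses or square roots, but elimination without fractions gives \<open>N g = \<Sum>\<^sub>i d\<^sub>i v\<^sub>i\<^sup>* v\<^sub>i\<close> with \<open>N > 0\<close>
  and \<open>d\<^sub>i \<ge> 0\<close> (\<open>psd_matrix_decomposition\<close>), so that \<open>N\<^sup>m\<close> times the contraction is a combination of
  values \<open>\<omega>(c\<^sup>* c)\<close> with nonnegative coefficients. Finally \<open>\<omega>(c\<^sup>* c) \<ge> 0\<close> for \<open>c\<close> in \<open>A[[t]]\<close> by the
  Cauchy-Schwarz inequality (\<open>positive_functional_fps\<close>), and \<open>t\<close>-adic sums of nonnegative series are
  nonnegative (\<open>cx_fps_nonneg_suminf\<close>).\<close>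


section \<open>Arithmetic in \<open>C = R(i)\<close> and in power series\<close>

lemmas cx_defs = zero_cx_def one_cx_def plus_cx_def minus_cx_def uminus_cx_def times_cx_def
  cx_of_def cx_i_def cx_cnj_def

lemma cx_sel [simp]:
  "cRe 0 = 0" "cIm 0 = 0" "cRe 1 = 1" "cIm 1 = 0"
  "cRe (z + w) = cRe z + cRe w" "cIm (z + w) = cIm z + cIm w"
  "cRe (z - w) = cRe z - cRe w" "cIm (z - w) = cIm z - cIm w"
  "cRe (- z) = - cRe z" "cIm (- z) = - cIm z"
  "cRe (z * w) = cRe z * cRe w - cIm z * cIm w" "cIm (z * w) = cRe z * cIm w + cIm z * cRe w"
  by (simp_all add: cx_defs)

lemma cx_of_sel [simp]: "cRe (cx_of c) = c" "cIm (cx_of c) = 0"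
  by (simp_all add: cx_defs)

lemma cx_i_sel [simp]: "cRe cx_i = 0" "cIm cx_i = 1"
  by (simp_all add: cx_defs)

lemma cx_cnj_sel [simp]: "cRe (cx_cnj z) = cRe z" "cIm (cx_cnj z) = - cIm z"
  by (simp_all add: cx_defs)

lemma cx_eqI: "cRe z = cRe w \<Longrightarrow> cIm z = cIm w \<Longrightarrow> z = w"
  by (rule cx.expand) simp

lemma cx_cnj_simps [simp]:
  fixes z w :: "'r::comm_ring_1 cx"
  shows "cx_cnj (z + w) = cx_cnj z + cx_cnj w" "cx_cnj (z * w) = cx_cnj z * cx_cnj w"
    "cx_cnj (- z) = - cx_cnj z" "cx_cnj (cx_cnj z) = z" "cx_cnj (cx_of c) = cx_of (c::'r)"
    "cx_cnj (0::'r cx) = 0" "cx_cnj (1::'r cx) = 1" "cx_cnj (cx_i::'r cx) = - cx_i"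
  by (auto intro!: cx_eqI)

lemma cx_cnj_rat [simp]: "cx_cnj (cx_rat q :: 'r::ordered_ring_with_rat cx) = cx_rat q"
  by (simp add: cx_rat_def)

lemma cx_cnj_sum: "cx_cnj (\<Sum>i\<in>S. z i) = (\<Sum>i\<in>S. cx_cnj (z i :: 'r::comm_ring_1 cx))"
  by (induction S rule: infinite_finite_induct) auto

lemma cx_cnj_prod: "cx_cnj (\<Prod>i\<in>S. z i) = (\<Prod>i\<in>S. cx_cnj (z i :: 'r::comm_ring_1 cx))"
  by (induction S rule: infinite_finite_induct) auto

lemma cx_cnj_power: "cx_cnj (z ^ m) = cx_cnj (z :: 'r::comm_ring_1 cx) ^ m"
  by (induction m) auto

lemma cx_of_simps:
  fixes c d :: "'r::comm_ring_1"
  shows "cx_of (c + d) = cx_of c + cx_of d" "cx_of (c * d) = cx_of c * cx_of d"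
    "cx_of (- c) = - cx_of c" "cx_of (0::'r) = 0" "cx_of (1::'r) = 1"
  by (auto intro!: cx_eqI)

lemma cx_of_prod: "cx_of (\<Prod>i\<in>S. c i) = (\<Prod>i\<in>S. cx_of (c i :: 'r::comm_ring_1))"
  by (induction S rule: infinite_finite_induct) (auto simp: cx_of_simps)

lemma of_Q_of_nat: "of_Q (of_nat n) = (of_nat n :: 'r::ordered_ring_with_rat)"
proof (induction n)
  case 0
  have "of_Q (0 + 0) = of_Q 0 + (of_Q 0 :: 'r)" by (rule of_Q_add)
  then show ?case by simp
qed (auto simp: of_Q_add of_Q_1)

lemma cx_rat_mult: "cx_rat (p * q) = cx_rat p * cx_rat q"
  and cx_rat_1: "cx_rat 1 = 1"
  by (simp_all add: cx_rat_def of_Q_mult of_Q_1 cx_of_simps)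

lemma cx_rat_power: "cx_rat (p ^ m) = cx_rat p ^ m"
  by (induction m) (simp_all add: cx_rat_1 cx_rat_mult)

lemma cx_of_of_nat: "cx_of (of_nat n :: 'r::comm_ring_1) = of_nat n"
  by (induction n) (simp_all add: cx_of_simps)

lemma cx_rat_of_nat: "cx_rat (of_nat n) = of_nat n"
  by (simp add: cx_rat_def of_Q_of_nat cx_of_of_nat)

lemma fps_coeffwise_nth [simp]: "fps_nth (fps_coeffwise h F) n = h (fps_nth F n)"
  by (simp add: fps_coeffwise_def)

lemma fps_bilinear_nth:
  "fps_nth (fps_bilinear b F G) n = (\<Sum>i=0..n. b (fps_nth F i) (fps_nth G (n - i)))"
  by (simp add: fps_bilinear_def)

lemma fps_bilinear_times: "fps_bilinear (*) F G = F * G"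
  by (simp add: fps_eq_iff fps_bilinear_nth fps_mult_nth)

lemma fps_bilinear_monom_nth:
  fixes b :: "'a::ring_1 \<Rightarrow> 'b::ab_group_add \<Rightarrow> 'c::ab_group_add"
  assumes "\<And>v. b 0 v = 0"
  shows "fps_nth (fps_bilinear b (fps_const c * fps_X ^ m) F) n =
    (if n < m then 0 else b c (fps_nth F (n - m)))"
proof -
  have "fps_nth (fps_bilinear b (fps_const c * fps_X ^ m) F) n =
      (\<Sum>i=0..n. if i = m then b c (fps_nth F (n - m)) else 0)"
    unfolding fps_bilinear_nth
    by (rule sum.cong) (auto simp: assms fps_X_power_nth)
  then show ?thesis by (auto simp: sum.delta)
qed

text \<open>The exponential of the Wick product and the series of \<open>\<tau>\<close> are of this kind: only finitely many
  terms reach a given coefficient, so that coefficients can be compared through finite sums. The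
  number \<open>K n\<close> of relevant terms is left free, since it is \<open>n\<close> for the former and depends on the
  symmetric degree for the latter.\<close>

lemma fps_sums_locally_finite:
  fixes f :: "nat \<Rightarrow> 'v::ab_group_add fps"
  assumes vanish: "\<And>m n. K n < m \<Longrightarrow> fps_nth (f m) n = 0"
  shows "f sums Abs_fps (\<lambda>n. \<Sum>m\<le>K n. fps_nth (f m) n)"
  unfolding sums_def
proof (rule metric_LIMSEQ_I)
  fix e :: real assume "0 < e"
  then obtain N where N: "(1/2) ^ N < e"
    using real_arch_pow_inv[of e "1/2"] by auto
  define L where "L = Abs_fps (\<lambda>n. \<Sum>m\<le>K n. fps_nth (f m) n)"
  define m0 where "m0 = Suc (Max (K ` {..N}))"
  have "dist (sum f {..<m}) L < e" if m: "m \<ge> m0" for m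
  proof -
    have eq: "fps_nth (sum f {..<m}) n = fps_nth L n" if "n \<le> N" for n
    proof -
      have "K n \<le> Max (K ` {..N})" using that by (intro Max_ge) auto
      then have "K n < m" using m by (simp add: m0_def)
      then show ?thesis
        unfolding L_def fps_sum_nth fps_nth_Abs_fps
        by (intro sum.mono_neutral_right) (auto intro: vanish)
    qed
    show ?thesis
    proof (cases "sum f {..<m} = L")
      case False
      then have "subdegree (sum f {..<m} - L) \<ge> N"
        by (intro subdegree_geI) (auto simp: eq)
      then have "(2::real) ^ N \<le> 2 ^ subdegree (sum f {..<m} - L)"
        by (intro power_increasing) auto
      then have "dist (sum f {..<m}) L \<le> inverse (2 ^ N)"
        using False by (simp add: dist_fps_def le_imp_inverse_le)
      also have "\<dots> < e" using N by (simp add: power_one_over inverse_eq_divide)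
      finally show ?thesis .
    qed (use \<open>0 < e\<close> in simp)
  qed
  then show "\<exists>no. \<forall>n\<ge>no. dist (sum f {..<n}) (Abs_fps (\<lambda>n. \<Sum>m\<le>K n. fps_nth (f m) n)) < e"
    unfolding L_def by blast
qed

lemma fps_suminf_locally_finite_nth:
  fixes f :: "nat \<Rightarrow> 'v::ab_group_add fps"
  assumes "\<And>m n. K n < m \<Longrightarrow> fps_nth (f m) n = 0"
  shows "fps_nth (suminf f) n = (\<Sum>m\<le>K n. fps_nth (f m) n)"
  by (subst sums_unique[OF fps_sums_locally_finite[of K f, OF assms], symmetric]) simp_all


section \<open>Complex conjugation on \<open>A \<otimes> W \<otimes> \<Lambda>\<close>\<close>

lemma weyl_sum_apply: "(\<Sum>i\<in>S. F i) M I = (\<Sum>i\<in>S. (F i M I :: 'a::comm_monoid_add fps))"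
  by (induction S rule: infinite_finite_induct) auto

definition weyl_conj :: "('a \<Rightarrow> 'a) \<Rightarrow> ('i, 'a) weyl \<Rightarrow> ('i, 'a) weyl" where
  "weyl_conj st F = (\<lambda>M I. fps_coeffwise st (F M I))"

lemma weyl_conj_nth [simp]: "fps_nth (weyl_conj st F M I) n = st (fps_nth (F M I) n)"
  by (simp add: weyl_conj_def)

lemma weyl_scale_nth [simp]: "fps_nth (weyl_scale sc c F M I) n = sc c (fps_nth (F M I) n)"
  by (simp add: weyl_scale_def)

lemma weyl_eqI: "(\<And>M I n. fps_nth (F M I) n = fps_nth (G M I) n) \<Longrightarrow> F = G"
  by (intro ext fps_ext) auto

lemma wedge_sign_nth:
  "fps_nth (wedge_sign J K F) n = wedge_sign J K (fps_nth (F :: 'v::ab_group_add fps) n)"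
  by (simp add: wedge_sign_def)

lemma of_nat_times_nth [simp]: "fps_nth (of_nat k * F) n = of_nat k * fps_nth (F :: 'v::ring_1 fps) n"
  by (simp add: fps_of_nat[symmetric] del: fps_of_nat)

lemma ins_s_nth: "fps_nth (ins_s i F M I) n = of_nat (Suc (count M i)) * fps_nth (F (add_mset i M) I) n"
  unfolding ins_s_def of_nat_times_nth ..

lemma ins_a_nth: "fps_nth (ins_a i F M I) n =
    (if i \<in> I then 0 else wedge_sign {i} I (fps_nth (F M (insert i I)) n))"
  by (simp add: ins_a_def wedge_sign_nth)

lemma mult_s_nth: "fps_nth (mult_s i F M I) n =
    (if i \<in># M then fps_nth (F (M - {#i#}) I) n else 0)"
  by (simp add: mult_s_def)

lemma mult_a_nth: "fps_nth (mult_a i F M I) n =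
    (if i \<in> I then wedge_sign {i} (I - {i}) (fps_nth (F M (I - {i})) n) else 0)"
  by (simp add: mult_a_def wedge_sign_nth)

text \<open>The two factors of a product and the product itself may have coefficients in different
  algebras, each with its own involution. What concerns the involution of one factor alone only
  uses that it is additive.\<close>

locale conj_additive =
  fixes st :: "'v::ring_1 \<Rightarrow> 'v"
  assumes st_add: "st (v + w) = st v + st w"
begin

lemma st_0 [simp]: "st 0 = 0"
  using st_add[of 0 0] by simp

lemma st_minus: "st (- v) = - st v"
  using st_add[of v "- v"] by (simp add: eq_neg_iff_add_eq_0 add.commute)

lemma st_sum: "st (\<Sum>i\<in>S. v i) = (\<Sum>i\<in>S. st (v i))"
  by (induction S rule: infinite_finite_induct) (auto simp: st_add)

lemma st_of_nat: "st (of_nat n * v) = of_nat n * st v"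
  by (induction n) (auto simp: st_add algebra_simps)

lemma st_wedge_sign: "st (wedge_sign J K v) = wedge_sign J K (st v)"
  by (simp add: wedge_sign_def st_minus)

lemma weyl_conj_add: "weyl_conj st (F + G) = weyl_conj st F + weyl_conj st G"
  by (rule weyl_eqI) (simp add: st_add)

lemma weyl_conj_0: "weyl_conj st 0 = 0"
  by (rule weyl_eqI) simp

lemma weyl_conj_sum: "weyl_conj st (\<Sum>i\<in>S. F i) = (\<Sum>i\<in>S. weyl_conj st (F i))"
  by (rule weyl_eqI) (simp add: weyl_sum_apply fps_sum_nth st_sum)

lemma weyl_conj_diff: "weyl_conj st (F - G) = weyl_conj st F - weyl_conj st G"
  by (rule weyl_eqI) (use st_add[of _ "- _"] in \<open>simp add: st_minus\<close>)

lemma weyl_conj_ins_s: "weyl_conj st (ins_s i F) = ins_s i (weyl_conj st F)"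
  by (rule weyl_eqI) (simp only: weyl_conj_nth ins_s_nth st_of_nat)

lemma weyl_conj_ins_a: "weyl_conj st (ins_a i F) = ins_a i (weyl_conj st F)"
  by (rule weyl_eqI) (simp add: ins_a_nth st_wedge_sign)

lemma weyl_conj_mult_s: "weyl_conj st (mult_s i F) = mult_s i (weyl_conj st F)"
  by (rule weyl_eqI) (simp add: mult_s_nth)

lemma weyl_conj_mult_a: "weyl_conj st (mult_a i F) = mult_a i (weyl_conj st F)"
  by (rule weyl_eqI) (simp add: mult_a_nth st_wedge_sign)

lemma weyl_conj_foldr_ins_s: "weyl_conj st (foldr ins_s is F) = foldr ins_s is (weyl_conj st F)"
  by (induction "is") (auto simp: weyl_conj_ins_s)

lemma weyl_conj_embed: "weyl_conj st (weyl_embed a) = weyl_embed (fps_coeffwise st a)"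
  by (rule weyl_eqI) (simp add: weyl_embed_def)

end

text \<open>Common to the coefficients \<open>C\<close> and \<open>A\<close>.\<close>

locale star_module = conj_additive st + module sc
  for sc :: "'r::ordered_ring_with_rat cx \<Rightarrow> 'v::ring_1 \<Rightarrow> 'v" and st :: "'v \<Rightarrow> 'v" +
  assumes st_scale: "st (sc c v) = sc (cx_cnj c) (st v)"
    and st_st: "st (st v) = v"
begin

lemma weyl_conj_scale: "weyl_conj st (weyl_scale sc c F) = weyl_scale sc (cx_cnj c) (weyl_conj st F)"
  by (rule weyl_eqI) (simp add: st_scale)

lemma weyl_conj_conj: "weyl_conj st (weyl_conj st F) = F"
  by (rule weyl_eqI) (simp add: st_st)

text \<open>The factor \<open>1/(it)\<close> is imaginary. This sign cancels that of \<open>weyl_conj_ad_odd\<close> below.\<close>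

lemma weyl_conj_div_it: "weyl_conj st (div_it sc F) = - div_it sc (weyl_conj st F)"
  by (rule weyl_eqI) (simp add: div_it_def st_scale st_minus)

lemma weyl_conj_delta: "weyl_conj st (delta F) = delta (weyl_conj st F)"
  by (simp add: delta_def weyl_conj_sum weyl_conj_mult_a weyl_conj_ins_s)

lemma weyl_conj_delta_inv: "weyl_conj st (delta_inv sc F) = delta_inv sc (weyl_conj st F)"
  unfolding delta_inv_def weyl_conj_sum weyl_conj_mult_s weyl_conj_ins_a
  by (intro sum.cong arg_cong[where f = "mult_s _"] arg_cong[where f = "ins_a _"] weyl_eqI)
    (auto simp: st_scale)

text \<open>The structure constants of \<open>\<nabla>\<close> and of the Lie bracket lie in \<open>R\<close>.\<close>

lemma weyl_conj_fedosov_D: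
  "weyl_conj st (fedosov_D sg br x nabla sc F) = fedosov_D sg br x nabla sc (weyl_conj st F)"
  by (simp add: fedosov_D_def nabla_S_def delta_CE_def weyl_conj_add weyl_conj_sum weyl_conj_mult_a
      weyl_conj_mult_s weyl_conj_ins_s weyl_conj_ins_a weyl_conj_scale)

end

lemma star_module_cx: "star_module (*) (cx_cnj :: 'r::ordered_ring_with_rat cx \<Rightarrow> 'r cx)"
  by unfold_locales (auto simp: algebra_simps)


section \<open>The total degree\<close>

text \<open>\<open>F - G \<in> W\<^sub>N\<close>. Comparing two elements, instead of bounding one, yields contraction estimates for
  operators without going through their linearity. Degrees are integers because insertions lower
  the bound by one each time, possibly below zero.\<close>

definition agree_below :: "int \<Rightarrow> ('i, 'v) weyl \<Rightarrow> ('i, 'v::zero) weyl \<Rightarrow> bool" where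
  "agree_below N F G \<longleftrightarrow>
     (\<forall>M I n. int (size M) + 2 * int n < N \<longrightarrow> fps_nth (F M I) n = fps_nth (G M I) n)"

lemma agree_belowI:
  "(\<And>M I n. int (size M) + 2 * int n < N \<Longrightarrow> fps_nth (F M I) n = fps_nth (G M I) n) \<Longrightarrow> agree_below N F G"
  by (simp add: agree_below_def)

lemma agree_belowD:
  "agree_below N F G \<Longrightarrow> int (size M) + 2 * int n < N \<Longrightarrow> fps_nth (F M I) n = fps_nth (G M I) n"
  by (simp add: agree_below_def)

lemma agree_below_mono: "agree_below N F G \<Longrightarrow> N' \<le> N \<Longrightarrow> agree_below N' F G"
  by (auto simp: agree_below_def)

lemma agree_below_refl [simp]: "agree_below N F F"
  by (simp add: agree_below_def)

lemma agree_below_add: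
  "agree_below N F F' \<Longrightarrow> agree_below N G G' \<Longrightarrow>
    agree_below N (F + G) (F' + G' :: ('i, 'v::monoid_add) weyl)"
  by (auto simp: agree_below_def)

lemma agree_below_diff:
  "agree_below N F F' \<Longrightarrow> agree_below N G G' \<Longrightarrow>
    agree_below N (F - G) (F' - G' :: ('i, 'v::group_add) weyl)"
  by (auto simp: agree_below_def)

lemma agree_below_sum:
  "(\<And>i. i \<in> S \<Longrightarrow> agree_below N (F i) (G i)) \<Longrightarrow>
    agree_below N (\<Sum>i\<in>S. F i) (\<Sum>i\<in>S. (G i :: ('i, 'v::comm_monoid_add) weyl))"
  by (rule agree_belowI) (auto simp: weyl_sum_apply fps_sum_nth intro!: sum.cong agree_belowD)

lemma agree_below_scale: "agree_below N F G \<Longrightarrow> agree_below N (weyl_scale sc c F) (weyl_scale sc c G)"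
  by (simp add: agree_below_def)

lemma agree_below_ins_s: "agree_below N F G \<Longrightarrow> agree_below (N - 1) (ins_s i F) (ins_s i G)"
  by (rule agree_belowI) (simp add: ins_s_nth agree_belowD[of N F G] del: of_nat_Suc)

lemma agree_below_mult_s:
  assumes "agree_below N F G"
  shows "agree_below (N + 1) (mult_s i F) (mult_s i G)"
proof (rule agree_belowI)
  fix M :: "'a multiset" and I :: "'a set" and n
  assume deg: "int (size M) + 2 * int n < N + 1"
  show "fps_nth (mult_s i F M I) n = fps_nth (mult_s i G M I) n"
  proof (cases "i \<in># M")
    case True
    then obtain M' where "M = add_mset i M'" by (meson multi_member_split)
    moreover from this have "int (size M') + 2 * int n < N" using deg by simp
    ultimately show ?thesis using agree_belowD[OF assms, of M' n I] by (simp add: mult_s_nth)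
  qed (simp add: mult_s_nth)
qed

lemma agree_below_ins_a: "agree_below N F G \<Longrightarrow> agree_below N (ins_a i F) (ins_a i G)"
  by (rule agree_belowI) (auto simp: ins_a_nth agree_belowD[of N F G])

lemma agree_below_mult_a: "agree_below N F G \<Longrightarrow> agree_below N (mult_a i F) (mult_a i G)"
  by (rule agree_belowI) (auto simp: mult_a_nth agree_belowD[of N F G])

lemma agree_below_foldr_ins_s:
  assumes "agree_below N F G"
  shows "agree_below (N - int (length is)) (foldr ins_s is F) (foldr ins_s is G)"
proof (induction "is")
  case (Cons i "is")
  have *: "N - int (length (i # is)) = N - int (length is) - 1" by simp
  show ?case unfolding * foldr_Cons o_apply by (rule agree_below_ins_s) (rule Cons)
qed (use assms in simp)

lemma agree_below_delta_inv:
  assumes "agree_below N F G"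
  shows "agree_below (N + 1) (delta_inv sc F) (delta_inv sc G)"
  unfolding delta_inv_def using assms
  by (intro agree_below_sum agree_below_mult_s agree_below_ins_a) (auto simp: agree_below_def)

lemma agree_below_fedosov_D:
  assumes "agree_below N F G"
  shows "agree_below N (fedosov_D sg br x nabla sc F) (fedosov_D sg br x nabla sc G)"
proof -
  have "agree_below N (mult_s j (ins_s k F)) (mult_s j (ins_s k G))" for j k
    using agree_below_mult_s[OF agree_below_ins_s[OF assms]] by simp
  then show ?thesis
    unfolding fedosov_D_def nabla_S_def delta_CE_def using assms
    by (intro agree_below_sum agree_below_add agree_below_scale agree_below_mult_a agree_below_ins_a)
qed

lemma agree_below_action_L:
  "agree_below N F G \<Longrightarrow> agree_below N (action_L act x F) (action_L act x G)"
  unfolding action_L_def by (intro agree_below_sum agree_below_mult_a agree_below_scale)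

text \<open>Dividing by \<open>t\<close> lowers the total degree by two.\<close>

lemma agree_below_div_it:
  "agree_below N F G \<Longrightarrow> agree_below (N - 2) (div_it sc F) (div_it sc G)"
  unfolding div_it_def by (intro agree_below_scale agree_belowI) (auto intro!: agree_belowD[of N])

text \<open>Products of factors of degree at least \<open>p\<close> and \<open>q\<close> have degree at least \<open>p + q\<close>, and changing
  the factors from the relative order \<open>d\<close> on changes the product from the relative order \<open>d\<close> on.\<close>

lemma agree_below_weyl_mult:
  fixes F F' :: "('i::{finite,linorder}, 'a::zero) weyl" and G G' :: "('i, 'b::zero) weyl"
    and pr :: "'a \<Rightarrow> 'b \<Rightarrow> 'c::ring_1"
  assumes pr: "\<And>v. pr 0 v = 0" "\<And>v. pr v 0 = 0"
    and F: "agree_below p F 0" "agree_below p F' 0" "agree_below (p + d) F F'"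
    and G: "agree_below q G 0" "agree_below q G' 0" "agree_below (q + d) G G'"
  shows "agree_below (p + q + d) (weyl_mult pr F G) (weyl_mult pr F' G')"
proof (rule agree_belowI)
  fix M :: "'i multiset" and I :: "'i set" and n
  assume deg: "int (size M) + 2 * int n < p + q + d"
  have "pr (fps_nth (F K J) i) (fps_nth (G (M - K) (I - J)) (n - i)) =
      pr (fps_nth (F' K J) i) (fps_nth (G' (M - K) (I - J)) (n - i))"
    if K: "K \<subseteq># M" and i: "i \<le> n" for K J i
  proof -
    define u v where "u = int (size K) + 2 * int i" and "v = int (size (M - K)) + 2 * int (n - i)"
    have uv: "u + v < p + q + d"
      using deg K i size_mset_mono[OF K] by (simp add: u_def v_def size_Diff_submset)
    (* In the third case u < p + d and v < q + d, where the factors agree. *)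
    consider "u < p" | "v < q" | "u \<ge> p" "v \<ge> q" by linarith
    then show ?thesis
    proof cases
      case 1
      then show ?thesis
        using agree_belowD[OF F(1), of K i J] agree_belowD[OF F(2), of K i J] by (simp add: u_def pr)
    next
      case 2
      then show ?thesis
        using agree_belowD[OF G(1), of "M - K" "n - i" "I - J"]
          agree_belowD[OF G(2), of "M - K" "n - i" "I - J"] by (simp add: v_def pr)
    next
      case 3
      then show ?thesis
        using uv agree_belowD[OF F(3), of K i J] agree_belowD[OF G(3), of "M - K" "n - i" "I - J"]
        by (simp add: u_def v_def)
    qed
  qed
  then show "fps_nth (weyl_mult pr F G M I) n = fps_nth (weyl_mult pr F' G' M I) n"
    unfolding weyl_mult_def fps_sum_nth wedge_sign_nth fps_bilinear_nth
    by (intro sum.cong arg_cong[where f = "wedge_sign _ _"]) auto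
qed


section \<open>The fiberwise Wick product\<close>

definition wick_coeff :: "nat \<Rightarrow> 'r::ordered_ring_with_rat cx" where
  "wick_coeff m = cx_rat (1 / fact m) * (cx_i * cx_rat (1/2)) ^ m"

lemma wick_exponent:
  "fps_const (cx_rat (1 / fact m)) * (fps_const (cx_i * cx_rat (1/2)) * fps_X) ^ m =
    fps_const (wick_coeff m :: 'r::ordered_ring_with_rat cx) * fps_X ^ m"
  by (simp add: wick_coeff_def power_mult_distrib fps_const_power mult.assoc[symmetric]
      del: fps_const_mult add: fps_const_mult[symmetric])

lemma wick_term_nth:
  assumes "module (sc :: 'r::ordered_ring_with_rat cx \<Rightarrow> 'v::ring_1 \<Rightarrow> 'v)"
  shows "fps_nth (fps_bilinear sc (fps_const c * fps_X ^ m) F) n =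
    (if n < m then 0 else sc c (fps_nth F (n - m)))"
  by (rule fps_bilinear_monom_nth) (simp add: module.scale_zero_left[OF assms])

lemma wick_mult_nth:
  assumes "module (sc :: 'r::ordered_ring_with_rat cx \<Rightarrow> 'v::ring_1 \<Rightarrow> 'v)"
  shows "fps_nth (wick_mult sc pr \<pi> F G M I) n =
    (\<Sum>m\<le>n. sc (wick_coeff m) (fps_nth (wick_power sc pr \<pi> m F G M I) (n - m)))"
  unfolding wick_mult_def wick_exponent
  by (subst fps_suminf_locally_finite_nth[where K = "\<lambda>n. n"])
    (auto simp: wick_term_nth[OF assms] intro!: sum.cong)

lemma foldr_ins_s_0: "foldr ins_s is 0 = 0"
  by (induction "is") (auto simp: ins_s_def fun_eq_iff)

text \<open>In the term of order \<open>m\<close> the \<open>2m\<close> insertions lower the degree by \<open>2m\<close>, and \<open>t\<^sup>m\<close> raises it again: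
  the Wick product respects the total degree.\<close>

lemma agree_below_wick_mult:
  fixes F F' :: "('i::{finite,linorder}, 'a::ring_1) weyl" and G G' :: "('i, 'b::ring_1) weyl"
    and pr :: "'a \<Rightarrow> 'b \<Rightarrow> 'v::ring_1"
  assumes "module (sc :: 'r::ordered_ring_with_rat cx \<Rightarrow> 'v \<Rightarrow> 'v)"
    and pr: "\<And>v. pr 0 v = 0" "\<And>v. pr v 0 = 0"
    and F: "agree_below p F 0" "agree_below p F' 0" "agree_below (p + d) F F'"
    and G: "agree_below q G 0" "agree_below q G' 0" "agree_below (q + d) G G'"
  shows "agree_below (p + q + d) (wick_mult sc pr \<pi> F G) (wick_mult sc pr \<pi> F' G')"
proof -
  have "agree_below (p + q + d - 2 * int m) (wick_power sc pr \<pi> m F G) (wick_power sc pr \<pi> m F' G')" for m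
    unfolding wick_power_def
  proof (intro agree_below_sum agree_below_scale)
    fix "is" js :: "'i list"
    assume "is \<in> {is. length is = m}" "js \<in> {js. length js = m}"
    then have len: "length is = m" "length js = m" by auto
    note [simp] = foldr_ins_s_0
    have "agree_below ((p - int m) + (q - int m) + d)
        (weyl_mult pr (foldr ins_s is F) (foldr ins_s js G))
        (weyl_mult pr (foldr ins_s is F') (foldr ins_s js G'))"
      using agree_below_foldr_ins_s[OF F(1), of "is"] agree_below_foldr_ins_s[OF F(2), of "is"]
        agree_below_foldr_ins_s[OF F(3), of "is"]
        agree_below_foldr_ins_s[OF G(1), of js] agree_below_foldr_ins_s[OF G(2), of js]
        agree_below_foldr_ins_s[OF G(3), of js]
      by (intro agree_below_weyl_mult pr) (auto simp: len algebra_simps)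
    then show "agree_below (p + q + d - 2 * int m)
        (weyl_mult pr (foldr ins_s is F) (foldr ins_s js G))
        (weyl_mult pr (foldr ins_s is F') (foldr ins_s js G'))"
      by (simp add: algebra_simps)
  qed
  note * = agree_belowD[OF this]
  show ?thesis
    by (rule agree_belowI, unfold wick_mult_nth[OF assms(1)], intro sum.cong refl arg_cong[where f = "sc _"] *)
      auto
qed

text \<open>The sign \<open>(-1)\<^sup>k\<close> in exterior degree \<open>k\<close>, which arises when a one-form is moved past the
  argument.\<close>

definition parity_twist :: "('i, 'a) weyl \<Rightarrow> ('i, 'a::ring_1) weyl" where
  "parity_twist F = (\<lambda>M I. if even (card I) then F M I else - F M I)"

lemma parity_twist_nth:
  "fps_nth (parity_twist F M I) n = (if even (card I) then fps_nth (F M I) n else - fps_nth (F M I) n)"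
  by (simp add: parity_twist_def)

lemma parity_twist_foldr_ins_s: "parity_twist (foldr ins_s is F) = foldr ins_s is (parity_twist F)"
proof (induction "is")
  case (Cons i "is")
  have "parity_twist (ins_s i G) = ins_s i (parity_twist G)" for G :: "('a, 'b) weyl"
    by (rule weyl_eqI) (simp add: parity_twist_nth ins_s_nth del: of_nat_Suc)
  then show ?case using Cons by simp
qed simp

definition one_form :: "('i, 'a::zero) weyl \<Rightarrow> bool" where
  "one_form F \<longleftrightarrow> (\<forall>M I. card I \<noteq> 1 \<longrightarrow> F M I = 0)"

lemma one_form_foldr_ins_s: "one_form F \<Longrightarrow> one_form (foldr ins_s is F)"
  by (induction "is") (auto simp: one_form_def ins_s_def)

lemma parity_twist_odd: "one_form F \<Longrightarrow> parity_twist F = - F"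
  by (auto simp: one_form_def parity_twist_def fun_eq_iff)

lemma wedge_sign_minus: "wedge_sign J K (- v) = - wedge_sign J K v"
  by (simp add: wedge_sign_def)

lemma wedge_sign_swap:
  fixes J K :: "'i::{finite,linorder} set"
  assumes "J \<inter> K = {}"
  shows "wedge_sign J K v =
    (if even (card J * card K) then wedge_sign K J v else - wedge_sign K J (v :: 'v::ab_group_add))"
proof -
  let ?L = "{(j, k). j \<in> J \<and> k \<in> K \<and> k < j}" and ?G = "{(j, k). j \<in> J \<and> k \<in> K \<and> j < k}"
  have "bij_betw prod.swap ?G {(k, j). k \<in> K \<and> j \<in> J \<and> j < k}"
    by (rule bij_betw_byWitness[where f' = prod.swap]) auto
  then have G: "card {(k, j). k \<in> K \<and> j \<in> J \<and> j < k} = card ?G"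
    by (rule bij_betw_same_card[symmetric])
  have "x < y \<or> y < x" if "x \<in> J" "y \<in> K" for x y
    using assms that by (cases x y rule: linorder_cases) auto
  then have "J \<times> K = ?L \<union> ?G" by auto
  moreover have "?L \<inter> ?G = {}" by auto
  ultimately have "card (J \<times> K) = card ?L + card ?G"
    using card_Un_disjoint[of ?L ?G] by simp
  then have "card J * card K = card ?L + card ?G"
    unfolding card_cartesian_product .
  then have parity: "even (card J * card K) \<longleftrightarrow> (even (card ?L) \<longleftrightarrow> even (card ?G))"
    by simp
  show ?thesis unfolding wedge_sign_def G parity by simp
qed

text \<open>Exchanging the factors amounts to replacing the symmetric part \<open>K\<close> of the first factor by
  \<open>M - K\<close> and its exterior part \<open>J\<close> by \<open>I - J\<close>. As the one-form \<open>F\<close> only contributes for \<open>card J = 1\<close>,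
  the sign of \<open>wedge_sign_swap\<close> is the twist of the other factor.\<close>

lemma weyl_conj_weyl_mult:
  fixes F :: "('i::{finite,linorder}, 'a::ring_1) weyl" and G :: "('i, 'b::ring_1) weyl"
    and pr :: "'a \<Rightarrow> 'b \<Rightarrow> 'c::ring_1"
  assumes "conj_additive st_c"
    and swap: "\<And>v w. st_c (pr v w) = pr' (st_b w) (st_a v)"
    and pr: "\<And>w. pr 0 w = 0" and st_a: "st_a 0 = 0" and pr': "\<And>w. pr' w 0 = 0"
    and minus: "\<And>v w. pr' (- w) v = - pr' w v"
    and odd: "one_form F"
  shows "weyl_conj st_c (weyl_mult pr F G) =
    weyl_mult pr' (parity_twist (weyl_conj st_b G)) (weyl_conj st_a F)"
proof (rule weyl_eqI)
  interpret conj_additive st_c by fact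
  fix M :: "'i multiset" and I :: "'i set" and n
  have term_eq: "st_c (wedge_sign J (I - J) (\<Sum>i=0..n. pr (fps_nth (F K J) i) (fps_nth (G (M - K) (I - J)) (n - i)))) =
      wedge_sign (I - J) J (\<Sum>i=0..n. pr' (fps_nth (parity_twist (weyl_conj st_b G) (M - K) (I - J)) i)
        (fps_nth (weyl_conj st_a F K J) (n - i)))" (is "?l = ?r")
    if "J \<subseteq> I" for K J
  proof (cases "card J = 1")
    case True
    have "?l = wedge_sign J (I - J) (\<Sum>i=0..n. pr' (st_b (fps_nth (G (M - K) (I - J)) (n - i)))
        (st_a (fps_nth (F K J) i)))"
      by (simp add: st_wedge_sign st_sum swap)
    also have "\<dots> = wedge_sign J (I - J) (\<Sum>i=0..n. pr' (st_b (fps_nth (G (M - K) (I - J)) i))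
        (st_a (fps_nth (F K J) (n - i))))"
      by (subst sum.atLeastAtMost_rev) simp
    also have "\<dots> = ?r"
      by (cases "even (card (I - J))")
        (simp_all add: wedge_sign_swap[of J "I - J"] True parity_twist_nth minus sum_negf wedge_sign_minus)
    finally show ?thesis .
  next
    case False
    then have "F K J = 0" using odd by (auto simp: one_form_def)
    then show ?thesis by (simp add: pr pr' st_a wedge_sign_def)
  qed
  have "fps_nth (weyl_conj st_c (weyl_mult pr F G) M I) n =
      (\<Sum>K\<in>{K. K \<subseteq># M}. \<Sum>J\<in>Pow I. st_c (wedge_sign J (I - J)
        (\<Sum>i=0..n. pr (fps_nth (F K J) i) (fps_nth (G (M - K) (I - J)) (n - i)))))"
    by (simp add: weyl_mult_def fps_sum_nth wedge_sign_nth fps_bilinear_nth st_sum)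
  also have "\<dots> = (\<Sum>K\<in>{K. K \<subseteq># M}. \<Sum>J\<in>Pow I. wedge_sign (I - J) J
        (\<Sum>i=0..n. pr' (fps_nth (parity_twist (weyl_conj st_b G) (M - K) (I - J)) i)
          (fps_nth (weyl_conj st_a F K J) (n - i))))"
    by (intro sum.cong refl term_eq) auto
  also have "\<dots> = (\<Sum>K\<in>{K. K \<subseteq># M}. \<Sum>J\<in>Pow I. wedge_sign J (I - J)
        (\<Sum>i=0..n. pr' (fps_nth (parity_twist (weyl_conj st_b G) K J) i)
          (fps_nth (weyl_conj st_a F (M - K) (I - J)) (n - i))))"
  proof (rule sum.reindex_bij_witness[where i = "\<lambda>K. M - K" and j = "\<lambda>K. M - K"], goal_cases)
    case (5 K)
    show ?case
    proof (rule sum.reindex_bij_witness[where i = "\<lambda>J. I - J" and j = "\<lambda>J. I - J"], goal_cases)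
      case (5 J)
      then have "I - (I - J) = J" by auto
      moreover have "M - (M - K) = K"
        using \<open>K \<in> _\<close> by (auto simp: multiset_eq_iff subseteq_mset_def)
      ultimately show ?case by simp
    qed auto
  qed (auto simp: multiset_eq_iff subseteq_mset_def)
  also have "\<dots> = fps_nth (weyl_mult pr' (parity_twist (weyl_conj st_b G)) (weyl_conj st_a F) M I) n"
    by (simp add: weyl_mult_def fps_sum_nth wedge_sign_nth fps_bilinear_nth)
  finally show "fps_nth (weyl_conj st_c (weyl_mult pr F G) M I) n = \<dots>" .
qed


text \<open>The hypothesis on \<open>\<pi>\<close> says that \<open>(i/2) \<pi>\<close> is Hermitian, so that conjugation of the exponential
  exchanges the two legs of each contraction, as the reversal of the factors does. In the proof the
  signs \<open>(-1)\<^sup>m\<close> from \<open>\<pi>\<close> and from \<open>i\<^sup>m\<close> appear separately and cancel.\<close>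

lemma (in star_module) weyl_conj_wick_mult:
  fixes F :: "('i::{finite,linorder}, 'a::ring_1) weyl" and G :: "('i, 'b::ring_1) weyl"
    and pr :: "'a \<Rightarrow> 'b \<Rightarrow> 'v"
  assumes "conj_additive st_a" "conj_additive st_b"
    and swap: "\<And>v w. st (pr v w) = pr' (st_b w) (st_a v)"
    and pr: "\<And>w. pr 0 w = 0" and pr': "\<And>w. pr' w 0 = 0"
    and minus: "\<And>v w. pr' (- w) v = - pr' w v"
    and odd: "one_form F"
    and \<pi>: "\<And>i j. cx_cnj (\<pi> i j) = - \<pi> j i"
  shows "weyl_conj st (wick_mult sc pr \<pi> F G) =
    wick_mult sc pr' \<pi> (parity_twist (weyl_conj st_b G)) (weyl_conj st_a F)"
proof -
  interpret a: conj_additive st_a by fact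
  interpret b: conj_additive st_b by fact
  have power: "weyl_conj st (wick_power sc pr \<pi> m F G) = weyl_scale sc ((- 1) ^ m)
      (wick_power sc pr' \<pi> m (parity_twist (weyl_conj st_b G)) (weyl_conj st_a F))" for m
  proof -
    let ?W = "\<lambda>is js. weyl_mult pr' (foldr ins_s js (parity_twist (weyl_conj st_b G)))
      (foldr ins_s is (weyl_conj st_a F))"
    have "weyl_conj st (weyl_mult pr (foldr ins_s is F) (foldr ins_s js G)) = ?W is js" for "is" js
      using weyl_conj_weyl_mult[where st_c = st and st_b = st_b and st_a = st_a and pr = pr and pr' = pr',
          OF conj_additive_axioms swap pr a.st_0 pr' minus one_form_foldr_ins_s[OF odd],
          of "is" "foldr ins_s js G"]
      by (simp add: a.weyl_conj_foldr_ins_s b.weyl_conj_foldr_ins_s parity_twist_foldr_ins_s)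
    then have "weyl_conj st (wick_power sc pr \<pi> m F G) =
        (\<Sum>is | length is = m. \<Sum>js | length js = m.
          weyl_scale sc (\<Prod>p<m. - \<pi> (js ! p) (is ! p)) (?W is js))"
      by (simp add: wick_power_def weyl_conj_sum weyl_conj_scale cx_cnj_prod \<pi>)
    also have "\<dots> = (\<Sum>js | length js = m. \<Sum>is | length is = m.
          weyl_scale sc (\<Prod>p<m. - \<pi> (js ! p) (is ! p)) (?W is js))"
      by (rule sum.swap)
    also have "\<dots> = weyl_scale sc ((- 1) ^ m)
        (wick_power sc pr' \<pi> m (parity_twist (weyl_conj st_b G)) (weyl_conj st_a F))"
      unfolding wick_power_def
      by (rule weyl_eqI)
        (simp add: weyl_sum_apply fps_sum_nth scale_sum_right prod.distrib
          prod_uminus)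
    finally show ?thesis .
  qed
  have coeff: "cx_cnj (wick_coeff m :: 'r cx) * (- 1) ^ m = wick_coeff m" for m
  proof -
    have square: "(- (1::'r cx)) ^ m * (- 1) ^ m = 1" by (simp flip: power_mult_distrib)
    have cnj: "cx_cnj (wick_coeff m :: 'r cx) = wick_coeff m * (- (1::'r cx)) ^ m"
      by (simp add: wick_coeff_def cx_cnj_power power_minus[of "cx_i * cx_rat (1/2)"])
    show ?thesis unfolding cnj mult.assoc square by simp
  qed
  show ?thesis
  proof (rule weyl_eqI)
    fix M I n
    have "fps_nth (weyl_conj st (wick_mult sc pr \<pi> F G) M I) n =
        (\<Sum>m\<le>n. sc (cx_cnj (wick_coeff m)) (fps_nth (weyl_conj st (wick_power sc pr \<pi> m F G) M I) (n - m)))"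
      by (simp add: wick_mult_nth[OF module_axioms] st_sum st_scale)
    also have "\<dots> = (\<Sum>m\<le>n. sc (wick_coeff m)
        (fps_nth (wick_power sc pr' \<pi> m (parity_twist (weyl_conj st_b G)) (weyl_conj st_a F) M I) (n - m)))"
      by (simp add: power coeff)
    finally show "fps_nth (weyl_conj st (wick_mult sc pr \<pi> F G) M I) n =
        fps_nth (wick_mult sc pr' \<pi> (parity_twist (weyl_conj st_b G)) (weyl_conj st_a F) M I) n"
      by (simp add: wick_mult_nth[OF module_axioms])
  qed
qed

lemma conj_additive_cx: "conj_additive (cx_cnj :: 'r::ordered_ring_with_rat cx \<Rightarrow> 'r cx)"
  by unfold_locales simp

lemma one_form_conj: "conj_additive st \<Longrightarrow> one_form F \<Longrightarrow> one_form (weyl_conj st F)"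
  by (auto simp: one_form_def weyl_conj_def fps_eq_iff conj_additive.st_0)

text \<open>The involution exchanges the two terms of the graded commutator.\<close>

lemma (in star_module) weyl_conj_ad_odd:
  assumes odd: "one_form \<rho>" and \<pi>: "\<And>i j. cx_cnj (\<pi> i j) = - \<pi> j i"
  shows "weyl_conj st (ad_odd sc \<pi> \<rho> F) = - ad_odd sc \<pi> (weyl_conj cx_cnj \<rho>) (weyl_conj st F)"
proof -
  interpret cx: star_module "(*)" "cx_cnj :: 'r cx \<Rightarrow> 'r cx" by (rule star_module_cx)
  have conj: "weyl_conj st (wick_mult sc sc \<pi> \<rho>' G) =
      wick_mult sc (\<lambda>a c. sc c a) \<pi> (parity_twist (weyl_conj st G)) (weyl_conj cx_cnj \<rho>')"
    if "one_form \<rho>'" for \<rho>' G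
    using that by (intro weyl_conj_wick_mult conj_additive_cx conj_additive_axioms st_scale \<pi>) auto
  have ad: "ad_odd sc \<pi> \<rho>' G = wick_mult sc sc \<pi> \<rho>' G - wick_mult sc (\<lambda>a c. sc c a) \<pi> (parity_twist G) \<rho>'"
    for \<rho>' G by (simp add: ad_odd_def parity_twist_def)
  (* The rule above for the conjugated arguments, read backwards. *)
  have "wick_mult sc (\<lambda>a c. sc c a) \<pi> (parity_twist F) \<rho> =
      weyl_conj st (wick_mult sc sc \<pi> (weyl_conj cx_cnj \<rho>) (weyl_conj st F))"
    by (simp add: conj one_form_conj odd conj_additive_cx weyl_conj_conj cx.weyl_conj_conj)
  then show ?thesis
    by (simp add: ad weyl_conj_diff weyl_conj_conj conj[OF odd])
qed


section \<open>The Hodge identity and the uniqueness of \<open>\<rho>\<close>\<close>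

lemma mult_s_add: "mult_s i (F + G) = mult_s i F + mult_s i G"
  and ins_s_add: "ins_s i (F + G) = ins_s i F + ins_s i G"
  by (rule weyl_eqI; simp add: mult_s_nth ins_s_nth distrib_left)+

lemma mult_a_add: "mult_a i (F + G) = mult_a i F + mult_a i G"
  and ins_a_add: "ins_a i (F + G) = ins_a i F + ins_a i G"
  by (rule weyl_eqI; simp add: mult_a_nth ins_a_nth wedge_sign_def)+

lemma mult_s_0 [simp]: "mult_s i 0 = 0"
  and ins_s_0 [simp]: "ins_s i 0 = 0"
  by (rule weyl_eqI; simp add: mult_s_nth ins_s_nth)+

lemma mult_a_0 [simp]: "mult_a i 0 = 0"
  and ins_a_0 [simp]: "ins_a i 0 = 0"
  by (rule weyl_eqI; simp add: mult_a_nth ins_a_nth wedge_sign_def)+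

lemma mult_s_sum: "mult_s i (\<Sum>j\<in>S. F j) = (\<Sum>j\<in>S. mult_s i (F j))"
  and ins_s_sum: "ins_s i (\<Sum>j\<in>S. F j) = (\<Sum>j\<in>S. ins_s i (F j))"
  by (induction S rule: infinite_finite_induct;
      simp only: sum.infinite sum.empty sum.insert mult_s_0 ins_s_0 mult_s_add ins_s_add not_False_eq_True)+

lemma mult_a_sum: "mult_a i (\<Sum>j\<in>S. F j) = (\<Sum>j\<in>S. mult_a i (F j))"
  and ins_a_sum: "ins_a i (\<Sum>j\<in>S. F j) = (\<Sum>j\<in>S. ins_a i (F j))"
  by (induction S rule: infinite_finite_induct;
      simp only: sum.infinite sum.empty sum.insert mult_a_0 ins_a_0 mult_a_add ins_a_add not_False_eq_True)+

text \<open>The canonical commutation relation, and below the anticommutation relation in exterior degree.\<close>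

lemma ins_s_mult_s: "ins_s i (mult_s j F) = mult_s j (ins_s i F) + (if i = j then F else 0)"
proof (rule weyl_eqI)
  fix M :: "'a multiset" and I :: "'a set" and n
  show "fps_nth (ins_s i (mult_s j F) M I) n =
      fps_nth ((mult_s j (ins_s i F) + (if i = j then F else 0)) M I) n"
  proof (cases "j \<in># M")
    case True
    then obtain M' where "M = add_mset j M'" by (meson multi_member_split)
    then show ?thesis
      by (auto simp: ins_s_nth mult_s_nth algebra_simps add_mset_commute)
  next
    case False
    then have "count M j = 0" by (simp add: count_eq_zero_iff)
    with False show ?thesis
      by (cases "i = j") (simp_all add: ins_s_nth mult_s_nth)
  qed
qed

lemma wedge_sign_single:
  "wedge_sign {i} K v = (if even (card {k \<in> K. k < i}) then v else - v)"
proof -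
  have "{(j, k). j \<in> {i} \<and> k \<in> K \<and> k < j} = Pair i ` {k \<in> K. k < i}" by auto
  then have "card {(j, k). j \<in> {i} \<and> k \<in> K \<and> k < j} = card {k \<in> K. k < i}"
    by (simp add: card_image inj_on_def)
  then show ?thesis by (simp only: wedge_sign_def)
qed

lemma wedge_sign_insert:
  fixes i j :: "'i::{finite,linorder}"
  assumes "j \<notin> K"
  shows "wedge_sign {i} (insert j K) v = (if j < i then - wedge_sign {i} K v else wedge_sign {i} K v)"
proof (cases "j < i")
  case True
  then have "{k \<in> insert j K. k < i} = insert j {k \<in> K. k < i}" by auto
  then have "card {k \<in> insert j K. k < i} = Suc (card {k \<in> K. k < i})" using assms by simp
  then show ?thesis using True by (simp add: wedge_sign_single)
next
  case False
  then have "{k \<in> insert j K. k < i} = {k \<in> K. k < i}" by auto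
  then show ?thesis using False by (simp add: wedge_sign_single)
qed

lemma wedge_sign_0 [simp]: "wedge_sign J K 0 = 0"
  by (simp add: wedge_sign_def)

lemma wedge_sign_involution: "wedge_sign {i} K (wedge_sign {i} K v) = v"
  by (simp add: wedge_sign_def)

lemma ins_a_mult_a:
  fixes F :: "('i::{finite,linorder}, 'v::ring_1) weyl"
  shows "ins_a i (mult_a j F) = (if i = j then F else 0) - mult_a j (ins_a i F)"
proof (rule weyl_eqI)
  fix M :: "'i multiset" and I :: "'i set" and n
  show "fps_nth (ins_a i (mult_a j F) M I) n =
      fps_nth (((if i = j then F else 0) - mult_a j (ins_a i F)) M I) n"
  proof (cases "i = j")
    case True
    then show ?thesis
      by (cases "i \<in> I") (simp_all add: ins_a_nth mult_a_nth wedge_sign_involution insert_absorb)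
  next
    case False
    show ?thesis
    proof (cases "j \<in> I \<and> i \<notin> I")
      case True
      define K where "K = I - {j}"
      have K: "I = insert j K" "j \<notin> K" "i \<notin> K" using True by (auto simp: K_def)
      have *: "insert i (insert j K) - {j} = insert i K" "insert j K - {j} = K" using K False by auto
      have "wedge_sign {i} (insert j K) (wedge_sign {j} (insert i K) v) =
          - wedge_sign {j} K (wedge_sign {i} K v)" for v :: 'v
      proof -
        have "i < j \<and> \<not> j < i \<or> j < i \<and> \<not> i < j" using False by auto
        then show ?thesis
          using K(2,3) by (elim disjE conjE) (simp_all add: wedge_sign_insert, simp_all add: wedge_sign_def)
      qed
      then show ?thesis
        using K False by (simp add: ins_a_nth mult_a_nth *)
    qed (use False in \<open>auto simp: ins_a_nth mult_a_nth\<close>)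
  qed
qed

lemma ins_s_ins_a: "ins_s i (ins_a j F) = ins_a j (ins_s i F)"
  and mult_a_mult_s: "mult_a i (mult_s j F) = mult_s j (mult_a i F)"
  by (rule weyl_eqI; simp add: ins_a_nth ins_s_nth mult_s_nth mult_a_nth wedge_sign_def)+

text \<open>\<open>\<delta>\<^sup>-\<^sup>1\<close> before normalization.\<close>

definition koszul :: "('i::{finite,linorder}, 'v::ring_1) weyl \<Rightarrow> ('i, 'v) weyl" where
  "koszul F = (\<Sum>i\<in>UNIV. mult_s i (ins_a i F))"

lemma sum_diag: "finite S \<Longrightarrow> i \<in> S \<Longrightarrow>
    (\<Sum>j\<in>S. if i = j then F j else 0) = (F i :: ('i, 'v::comm_monoid_add) weyl)"
  by (rule sum.delta'[THEN trans]) auto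

text \<open>By the (anti)commutation relations the anticommutator of \<open>\<delta>\<close> with \<open>koszul\<close> is the sum of the
  number operators \<open>\<Sum>\<^sub>i x\<^sup>i \<or> i\<^sub>s(x\<^sub>i)\<close> and \<open>\<Sum>\<^sub>i x\<^sup>i \<and> i\<^sub>a(x\<^sub>i)\<close>; the mixed terms \<open>?A\<close> cancel.\<close>

lemma hodge_delta_koszul:
  fixes F :: "('i::{finite,linorder}, 'v::ring_1) weyl"
  shows "(koszul (delta F) + delta (koszul F)) M I = of_nat (size M + card I) * F M I"
proof -
  let ?A = "\<lambda>i j. mult_s j (mult_a i (ins_a j (ins_s i F)))"
  have "koszul (delta F) = (\<Sum>j\<in>UNIV. \<Sum>i\<in>UNIV. mult_s j (ins_a j (mult_a i (ins_s i F))))"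
    by (simp only: koszul_def delta_def ins_a_sum mult_s_sum)
  also have "\<dots> = (\<Sum>j\<in>UNIV. \<Sum>i\<in>UNIV. (if j = i then mult_s i (ins_s i F) else 0) - ?A i j)"
    by (intro sum.cong refl weyl_eqI) (simp add: ins_a_mult_a mult_s_nth)
  also have "\<dots> = (\<Sum>i\<in>UNIV. mult_s i (ins_s i F)) - (\<Sum>j\<in>UNIV. \<Sum>i\<in>UNIV. ?A i j)"
    by (simp only: sum_subtractf sum_diag finite UNIV_I)
  finally have 1: "koszul (delta F) = \<dots>" .
  have "delta (koszul F) = (\<Sum>i\<in>UNIV. \<Sum>j\<in>UNIV. mult_a i (ins_s i (mult_s j (ins_a j F))))"
    by (simp only: koszul_def delta_def ins_s_sum mult_a_sum)
  also have "\<dots> = (\<Sum>i\<in>UNIV. \<Sum>j\<in>UNIV. ?A i j + (if i = j then mult_a i (ins_a i F) else 0))"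
    by (intro sum.cong refl) (simp only: ins_s_mult_s ins_s_ins_a mult_a_add mult_a_mult_s mult_a_0 if_distrib[of "mult_a _"] cong: if_cong)
  also have "\<dots> = (\<Sum>i\<in>UNIV. \<Sum>j\<in>UNIV. ?A i j) + (\<Sum>i\<in>UNIV. mult_a i (ins_a i F))"
    by (simp only: sum.distrib sum_diag finite UNIV_I)
  also have "(\<Sum>i\<in>UNIV. \<Sum>j\<in>UNIV. ?A i j) = (\<Sum>j\<in>UNIV. \<Sum>i\<in>UNIV. ?A i j)"
    by (rule sum.swap)
  finally have 2: "delta (koszul F) =
      (\<Sum>j\<in>UNIV. \<Sum>i\<in>UNIV. ?A i j) + (\<Sum>i\<in>UNIV. mult_a i (ins_a i F))" .
  have "(koszul (delta F) + delta (koszul F)) M I =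
      (\<Sum>i\<in>UNIV. mult_s i (ins_s i F) M I) + (\<Sum>i\<in>UNIV. mult_a i (ins_a i F) M I)"
    unfolding 1 2 by (simp add: weyl_sum_apply)
  moreover have "(\<Sum>i\<in>UNIV. mult_s i (ins_s i F) M I) = (\<Sum>i\<in>UNIV. of_nat (count M i) * F M I)"
  proof (rule sum.cong)
    fix i
    show "mult_s i (ins_s i F) M I = of_nat (count M i) * F M I"
    proof (cases "i \<in># M")
      case True
      then obtain M' where "M = add_mset i M'" by (meson multi_member_split)
      then show ?thesis by (simp add: mult_s_def ins_s_def)
    qed (simp add: mult_s_def count_eq_zero_iff[THEN iffD2])
  qed simp
  moreover have "(\<Sum>i\<in>UNIV. of_nat (count M i) * F M I) = of_nat (size M) * F M I"
  proof -
    have "size M = (\<Sum>i\<in>UNIV. count M i)"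
      unfolding size_multiset_overloaded_eq by (rule sum.mono_neutral_left) (auto simp: not_in_iff)
    then show ?thesis by (simp only: of_nat_sum sum_distrib_right)
  qed
  moreover have "(\<Sum>i\<in>UNIV. mult_a i (ins_a i F) M I) = (\<Sum>i\<in>UNIV. if i \<in> I then F M I else 0)"
    by (intro sum.cong) (auto simp: mult_a_def ins_a_def wedge_sign_involution insert_absorb)
  moreover have "(\<Sum>i\<in>UNIV. if i \<in> I then F M I else 0) = of_nat (card I) * F M I"
    by (simp add: sum.If_cases)
  ultimately show ?thesis by (simp add: distrib_right)
qed


context star_module
begin

lemma scale_of_nat: "sc (of_nat n) v = of_nat n * v"
  by (induction n) (auto simp: scale_left_distrib distrib_right)

lemma scale_wedge_sign: "sc c (wedge_sign J K v) = wedge_sign J K (sc c v)"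
  by (simp add: wedge_sign_def)

lemma scale_inverse_of_nat: "0 < n \<Longrightarrow> sc (cx_rat (1 / of_nat n)) (of_nat n * v) = v"
  unfolding scale_of_nat[symmetric] scale_scale cx_rat_of_nat[symmetric] cx_rat_mult[symmetric]
  by (simp add: cx_rat_1)

text \<open>The insertion lowers the exterior degree and the multiplication raises the symmetric one, so the
  normalization factor may be read off before or after them.\<close>

lemma delta_inv_koszul:
  "fps_nth (delta_inv sc F M I) n = sc (cx_rat (1 / of_nat (size M + card I))) (fps_nth (koszul F M I) n)"
proof -
  have "fps_nth (mult_s i (ins_a i (\<lambda>M I. fps_coeffwise (sc (cx_rat (1 / of_nat (size M + card I)))) (F M I))) M I) n =
      sc (cx_rat (1 / of_nat (size M + card I))) (fps_nth (mult_s i (ins_a i F) M I) n)" for i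
  proof (cases "i \<in># M \<and> i \<notin> I")
    case True
    then obtain M' where "M = add_mset i M'" by (meson multi_member_split)
    then show ?thesis using True
      by (simp add: mult_s_nth ins_a_nth scale_wedge_sign del: of_nat_add of_nat_Suc)
  qed (auto simp: mult_s_nth ins_a_nth)
  then show ?thesis
    by (simp add: delta_inv_def koszul_def weyl_sum_apply fps_sum_nth scale_sum_right)
qed

text \<open>The Hodge identity on the kernel of \<open>\<delta>\<^sup>-\<^sup>1\<close>.\<close>

lemma delta_inv_delta:
  assumes ker: "delta_inv sc F = 0" and "weyl_sigma F = 0"
  shows "delta_inv sc (delta F) = F"
proof -
  have koszul_0: "koszul F = 0"
  proof (rule weyl_eqI)
    fix M I n
    let ?k = "fps_nth (koszul F M I) n"
    show "?k = fps_nth (0 M I) n"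
    proof (cases "M = {#}")
      case True
      then show ?thesis by (simp add: koszul_def weyl_sum_apply fps_sum_nth mult_s_nth)
    next
      case False
      then have pos: "0 < size M + card I" by (simp add: nonempty_has_size)
      have "?k = sc (cx_rat (1 / of_nat (size M + card I))) (of_nat (size M + card I) * ?k)"
        using scale_inverse_of_nat[OF pos] by simp
      also have "\<dots> = of_nat (size M + card I) * fps_nth (delta_inv sc F M I) n"
        by (simp only: delta_inv_koszul scale_of_nat[symmetric] scale_scale mult.commute)
      also have "\<dots> = 0" by (simp add: ker)
      finally show ?thesis by simp
    qed
  qed
  have delta_0: "delta (0 :: ('i::{finite,linorder}, 'v) weyl) = 0" by (simp add: delta_def)
  show ?thesis
  proof (rule weyl_eqI)
    fix M I n
    have k: "koszul (delta F) M I = of_nat (size M + card I) * F M I"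
      using hodge_delta_koszul[of F M I] by (simp add: koszul_0 delta_0)
    show "fps_nth (delta_inv sc (delta F) M I) n = fps_nth (F M I) n"
    proof (cases "size M + card I = 0")
      case True
      then have "M = {#}" "I = {}" by auto
      then show ?thesis using assms(2) k by (simp add: delta_inv_koszul weyl_sigma_def)
    next
      case False
      then show ?thesis by (simp only: delta_inv_koszul k of_nat_times_nth scale_inverse_of_nat)
    qed
  qed
qed

end

lemma agree_below_all: "(\<And>k::nat. agree_below (int k) F G) \<Longrightarrow> F = G"
  by (rule weyl_eqI, rule_tac N = "int (size M + 2 * n + 1)" in agree_belowD) (blast, simp)

lemma is_fedosov_rho_degree: "is_fedosov_rho sg br x r nabla \<pi> \<Omega> \<rho> \<Longrightarrow> agree_below 2 \<rho> 0"
  unfolding is_fedosov_rho_def agree_below_def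
  by (metis (no_types, lifting) fps_zero_nth linorder_not_less of_nat_add of_nat_less_numeral_iff
      of_nat_mult of_nat_numeral zero_fun_apply)

lemma is_fedosov_rho_one_form: "is_fedosov_rho sg br x r nabla \<pi> \<Omega> \<rho> \<Longrightarrow> one_form \<rho>"
  unfolding is_fedosov_rho_def one_form_def by (metis fps_ext fps_zero_nth)

text \<open>With \<open>\<delta>\<^sup>-\<^sup>1 \<rho> = 0\<close> the defining equation reads \<open>\<rho> = \<delta>\<^sup>-\<^sup>1(R + D\<rho> + \<rho> \<circ> \<rho>/(it) + \<Omega>)\<close>. As \<open>\<rho>\<close> has degree at
  least two, the quadratic term gains the two degrees that \<open>1/(it)\<close> loses, and \<open>\<delta>\<^sup>-\<^sup>1\<close> gains one. So
  two solutions that agree up to some degree agree up to the next one.\<close>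

lemma fedosov_rho_unique:
  fixes \<rho> \<rho>' :: "('i::{finite,linorder}, 'r::ordered_ring_with_rat cx) weyl"
  assumes \<rho>: "is_fedosov_rho sg br x r nabla \<pi> \<Omega> \<rho>"
    and \<rho>': "is_fedosov_rho sg br x r nabla \<pi> \<Omega> \<rho>'"
  shows "\<rho> = \<rho>'"
proof -
  interpret cx: star_module "(*)" "cx_cnj :: 'r cx \<Rightarrow> 'r cx" by (rule star_module_cx)
  let ?T = "\<lambda>\<rho>. fedosov_R sg br x r nabla + fedosov_D sg br x nabla (*) \<rho>
       + div_it (*) (wick_mult (*) (*) \<pi> \<rho> \<rho>) + \<Omega>"
  have fixpoint: "\<rho> = delta_inv (*) (?T \<rho>)" if "is_fedosov_rho sg br x r nabla \<pi> \<Omega> \<rho>" for \<rho>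
  proof -
    have "weyl_sigma \<rho> = 0"
      using is_fedosov_rho_one_form[OF that] by (simp add: one_form_def weyl_sigma_def)
    then show ?thesis
      using cx.delta_inv_delta[of \<rho>] that unfolding is_fedosov_rho_def by metis
  qed
  have "agree_below (2 + int k) \<rho> \<rho>'" for k
  proof (induction k)
    case 0
    show ?case
      using is_fedosov_rho_degree[OF \<rho>] is_fedosov_rho_degree[OF \<rho>'] by (simp add: agree_below_def)
  next
    case (Suc k)
    have "agree_below (2 + 2 + int k) (wick_mult (*) (*) \<pi> \<rho> \<rho>) (wick_mult (*) (*) \<pi> \<rho>' \<rho>')"
      using Suc is_fedosov_rho_degree[OF \<rho>] is_fedosov_rho_degree[OF \<rho>']
      by (intro agree_below_wick_mult cx.module_axioms) auto
    then have "agree_below (2 + int k) (div_it (*) (wick_mult (*) (*) \<pi> \<rho> \<rho>))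
        (div_it (*) (wick_mult (*) (*) \<pi> \<rho>' \<rho>'))"
      using agree_below_div_it by fastforce
    then have "agree_below (2 + int k) (?T \<rho>) (?T \<rho>')"
      using Suc by (intro agree_below_add agree_below_fedosov_D agree_below_refl)
    then have "agree_below (2 + int k + 1) (delta_inv (*) (?T \<rho>)) (delta_inv (*) (?T \<rho>'))"
      by (rule agree_below_delta_inv)
    then show ?case using fixpoint[OF \<rho>] fixpoint[OF \<rho>'] by (simp add: add.assoc add.commute)
  qed
  then have "agree_below (int k) \<rho> \<rho>'" for k
    using agree_below_mono[of "2 + int k" \<rho> \<rho>' "int k"] by simp
  then show ?thesis by (rule agree_below_all)
qed


section \<open>Reality of \<open>\<rho>\<close> and of the Fedosov-Taylor series\<close>

lemma wick_mult_minus_left: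
  fixes pr :: "'a::ring_1 \<Rightarrow> 'b::ring_1 \<Rightarrow> 'v::ring_1"
  assumes "module (sc :: 'r::ordered_ring_with_rat cx \<Rightarrow> 'v \<Rightarrow> 'v)"
    and pr: "\<And>v w. pr (- v) w = - pr v w"
  shows "wick_mult sc pr \<pi> (- F) G = - wick_mult sc pr \<pi> F G"
proof -
  have ins: "foldr ins_s is (- F) = - foldr ins_s is F" for "is"
  proof (induction "is")
    case (Cons i "is")
    have "ins_s i (- H) = - ins_s i H" for H :: "('c, 'a) weyl"
      by (rule weyl_eqI) (simp add: ins_s_nth)
    with Cons show ?case by (simp only: foldr_Cons o_apply)
  qed simp
  have mult: "weyl_mult pr (- H) G' = - weyl_mult pr H G'" for H G'
    by (rule weyl_eqI)
      (simp add: weyl_mult_def fps_sum_nth wedge_sign_nth fps_bilinear_nth pr sum_negf wedge_sign_minus)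
  have "fps_nth (wick_power sc pr \<pi> m (- F) G M I) n = - fps_nth (wick_power sc pr \<pi> m F G M I) n" for m M I n
    by (simp add: wick_power_def ins mult weyl_sum_apply fps_sum_nth sum_negf
        module.scale_minus_right[OF assms(1)])
  then show ?thesis
    by (intro weyl_eqI)
      (simp add: wick_mult_nth[OF assms(1)] sum_negf module.scale_minus_right[OF assms(1)])
qed

text \<open>The conjugate of \<open>\<rho>\<close> satisfies the equations of \<open>\<rho>\<close>: in the quadratic term, the sign from
  exchanging the two one-forms cancels that of \<open>1/(it)\<close>.\<close>

lemma fedosov_rho_real:
  fixes \<rho> :: "('i::{finite,linorder}, 'r::ordered_ring_with_rat cx) weyl"
  assumes \<rho>: "is_fedosov_rho sg br x r nabla \<pi> \<Omega> \<rho>"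
    and \<pi>: "\<And>i j. cx_cnj (\<pi> i j) = - \<pi> j i"
    and \<Omega>: "weyl_conj cx_cnj \<Omega> = \<Omega>"
  shows "weyl_conj cx_cnj \<rho> = \<rho>"
proof (rule fedosov_rho_unique[OF _ \<rho>])
  interpret cx: star_module "(*)" "cx_cnj :: 'r cx \<Rightarrow> 'r cx" by (rule star_module_cx)
  have odd: "one_form \<rho>" using \<rho> by (rule is_fedosov_rho_one_form)
  let ?\<rho> = "weyl_conj cx_cnj \<rho>"
  have R: "weyl_conj cx_cnj (fedosov_R sg br x r nabla) = fedosov_R sg br x r nabla"
  proof -
    have one: "fps_coeffwise cx_cnj 1 = (1 :: 'r cx fps)"
      by (rule fps_ext) simp
    show ?thesis
      by (simp add: fedosov_R_def cx.weyl_conj_sum cx.weyl_conj_scale cx.weyl_conj_mult_s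
          cx.weyl_conj_mult_a cx.weyl_conj_embed one)
  qed
  have "weyl_conj cx_cnj (wick_mult (*) (*) \<pi> \<rho> \<rho>) = wick_mult (*) (*) \<pi> (parity_twist ?\<rho>) ?\<rho>"
    using odd by (intro cx.weyl_conj_wick_mult conj_additive_cx \<pi>) auto
  also have "parity_twist ?\<rho> = - ?\<rho>"
    by (intro parity_twist_odd one_form_conj conj_additive_cx odd)
  also have "wick_mult (*) (*) \<pi> (- ?\<rho>) ?\<rho> = - wick_mult (*) (*) \<pi> ?\<rho> ?\<rho>"
    by (rule wick_mult_minus_left[OF cx.module_axioms]) simp
  finally have "weyl_conj cx_cnj (div_it (*) (wick_mult (*) (*) \<pi> \<rho> \<rho>)) =
      - div_it (*) (- wick_mult (*) (*) \<pi> ?\<rho> ?\<rho>)"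
    by (simp add: cx.weyl_conj_div_it)
  also have "\<dots> = div_it (*) (wick_mult (*) (*) \<pi> ?\<rho> ?\<rho>)"
    by (rule weyl_eqI) (simp add: div_it_def)
  finally have "delta ?\<rho> = fedosov_R sg br x r nabla + fedosov_D sg br x nabla (*) ?\<rho>
       + div_it (*) (wick_mult (*) (*) \<pi> ?\<rho> ?\<rho>) + \<Omega>"
    using \<rho> unfolding is_fedosov_rho_def
    by (simp only: cx.weyl_conj_delta[symmetric] cx.weyl_conj_add R \<Omega> cx.weyl_conj_fedosov_D)
  moreover have "delta_inv (*) ?\<rho> = 0"
    using \<rho> unfolding is_fedosov_rho_def
    by (simp only: cx.weyl_conj_delta_inv[symmetric] cx.weyl_conj_0)
  moreover have "card I = 1 \<and> 2 \<le> size M + 2 * m" if "fps_nth (?\<rho> M I) m \<noteq> 0" for M I m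
  proof -
    have "fps_nth (\<rho> M I) m \<noteq> 0" using that by auto
    then show ?thesis using \<rho> unfolding is_fedosov_rho_def by blast
  qed
  ultimately show "is_fedosov_rho sg br x r nabla \<pi> \<Omega> ?\<rho>"
    unfolding is_fedosov_rho_def by blast
qed

text \<open>The operator whose anticommutator with \<open>\<delta>\<^sup>-\<^sup>1\<close> is iterated in the series of \<open>\<tau>\<close>.\<close>

definition fedosov_connection where
  "fedosov_connection sg br x nabla \<pi> \<rho> sc act G =
    fedosov_D sg br x nabla sc G + action_L act x G + div_it sc (ad_odd sc \<pi> \<rho> G)"

lemma fedosov_step_connection:
  "fedosov_step sg br x nabla \<pi> \<rho> sc act F =
    delta_inv sc (fedosov_connection sg br x nabla \<pi> \<rho> sc act F) + fedosov_connection sg br x nabla \<pi> \<rho> sc act (delta_inv sc F)"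
  by (simp add: fedosov_step_def fedosov_connection_def Let_def)

text \<open>Again the degree two of \<open>\<rho>\<close> makes up for \<open>1/(it)\<close>, and the one degree gained is that of \<open>\<delta>\<^sup>-\<^sup>1\<close>.\<close>

lemma agree_below_fedosov_step:
  fixes F G :: "('i::{finite,linorder}, 'v::ring_1) weyl"
    and sc :: "'r::ordered_ring_with_rat cx \<Rightarrow> 'v \<Rightarrow> 'v"
  assumes sc: "module sc" and \<rho>: "agree_below 2 \<rho> 0" and agree: "agree_below N F G"
  shows "agree_below (N + 1) (fedosov_step sg br x nabla \<pi> \<rho> sc act F) (fedosov_step sg br x nabla \<pi> \<rho> sc act G)"
proof -
  have T: "agree_below N (fedosov_connection sg br x nabla \<pi> \<rho> sc act F) (fedosov_connection sg br x nabla \<pi> \<rho> sc act G)"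
    if FG: "agree_below N F G" for N and F G :: "('i, 'v) weyl"
  proof -
    have pr: "\<And>v. sc 0 v = 0" "\<And>c. sc c 0 = 0"
      by (simp_all add: module.scale_zero_left[OF sc] module.scale_zero_right[OF sc])
    have deg0: "agree_below 0 H 0" for H :: "('i, 'v) weyl" by (simp add: agree_below_def)
    have tw: "agree_below N (\<lambda>M I. if even (card I) then F M I else - F M I)
        (\<lambda>M I. if even (card I) then G M I else - G M I)"
      using FG by (simp add: agree_below_def)
    have "agree_below (2 + 0 + N) (wick_mult sc sc \<pi> \<rho> F) (wick_mult sc sc \<pi> \<rho> G)"
      using FG by (intro agree_below_wick_mult sc pr \<rho> deg0) auto
    moreover have "agree_below (0 + 2 + N) (wick_mult sc (\<lambda>a c. sc c a) \<pi> (\<lambda>M I. if even (card I) then F M I else - F M I) \<rho>)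
      (wick_mult sc (\<lambda>a c. sc c a) \<pi> (\<lambda>M I. if even (card I) then G M I else - G M I) \<rho>)"
      using tw by (intro agree_below_wick_mult sc pr \<rho> deg0) auto
    ultimately have "agree_below (2 + N) (ad_odd sc \<pi> \<rho> F) (ad_odd sc \<pi> \<rho> G)"
      unfolding ad_odd_def by (intro agree_below_diff) auto
    then have "agree_below N (div_it sc (ad_odd sc \<pi> \<rho> F)) (div_it sc (ad_odd sc \<pi> \<rho> G))"
      using agree_below_div_it[of "2 + N"] by simp
    then show ?thesis
      unfolding fedosov_connection_def
      using FG by (intro agree_below_add agree_below_fedosov_D agree_below_action_L)
  qed
  show ?thesis
    unfolding fedosov_step_connection
    by (intro agree_below_add agree_below_delta_inv T agree)
qed

lemma fedosov_step_0:
  fixes sc :: "'r::ordered_ring_with_rat cx \<Rightarrow> 'v::ring_1 \<Rightarrow> 'v"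
  assumes sc: "module sc" and act: "\<And>X. act X 0 = 0"
  shows "fedosov_step sg br x nabla \<pi> \<rho> sc act 0 = (0 :: ('i::{finite,linorder}, 'v) weyl)"
proof -
  interpret module sc by fact
  have scale0: "weyl_scale h c 0 = (0 :: ('i, 'v) weyl)" if "h c 0 = 0" for h and c :: 'c
    by (rule weyl_eqI) (simp add: that)
  have D: "fedosov_D sg br x nabla sc 0 = (0 :: ('i, 'v) weyl)"
    by (simp add: fedosov_D_def nabla_S_def delta_CE_def scale0)
  have L: "action_L act x 0 = (0 :: ('i, 'v) weyl)"
    by (simp add: action_L_def scale0 act)
  have inv: "delta_inv sc 0 = (0 :: ('i, 'v) weyl)"
  proof -
    have "(\<lambda>M I. fps_coeffwise (sc (cx_rat (1 / of_nat (size M + card I)))) ((0 :: ('i, 'v) weyl) M I)) = 0"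
      by (rule weyl_eqI) simp
    then show ?thesis by (simp add: delta_inv_def)
  qed
  have wick: "wick_mult sc sc \<pi> \<rho> 0 = (0 :: ('i, 'v) weyl)"
    "wick_mult sc (\<lambda>a c. sc c a) \<pi> (0 :: ('i, 'v) weyl) \<rho> = 0"
    by (rule weyl_eqI;
      simp add: wick_mult_nth[OF sc] wick_power_def foldr_ins_s_0 weyl_sum_apply fps_sum_nth
        weyl_mult_def fps_bilinear_nth wedge_sign_nth)+
  have "(\<lambda>M I. if even (card I) then 0 M I else - 0 M I) = (0 :: ('i, 'v) weyl)"
    by (rule weyl_eqI) simp
  then have "ad_odd sc \<pi> \<rho> 0 = (0 :: ('i, 'v) weyl)"
    by (simp add: ad_odd_def wick)
  moreover have "div_it sc 0 = (0 :: ('i, 'v) weyl)"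
    by (rule weyl_eqI) (simp add: div_it_def)
  ultimately show ?thesis
    by (simp add: fedosov_step_connection fedosov_connection_def D L inv)
qed

lemma fedosov_tau_nth:
  fixes sc :: "'r::ordered_ring_with_rat cx \<Rightarrow> 'v::ring_1 \<Rightarrow> 'v"
    and x :: "'i::{finite,linorder} \<Rightarrow> 'g::ab_group_add"
  assumes sc: "module sc" and \<rho>: "agree_below 2 \<rho> 0" and act: "\<And>X. act X 0 = 0"
  shows "fps_nth (fedosov_tau sg br x nabla \<pi> \<rho> sc act a M I) n =
    (\<Sum>k\<le>size M + 2 * n. fps_nth ((fedosov_step sg br x nabla \<pi> \<rho> sc act ^^ k) (weyl_embed a) M I) n)"
proof -
  let ?S = "fedosov_step sg br x nabla \<pi> \<rho> sc act"
  have "agree_below (int k) ((?S ^^ k) (weyl_embed a)) 0" for k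
  proof (induction k)
    case (Suc k)
    then show ?case
      using agree_below_fedosov_step[OF sc \<rho> Suc, of sg br x nabla \<pi> act]
      by (simp only: fedosov_step_0[where act = act, OF sc act] funpow.simps o_apply of_nat_Suc add.commute)
  qed (simp add: agree_below_def)
  from agree_belowD[OF this] show ?thesis
    unfolding fedosov_tau_def
    by (intro fps_suminf_locally_finite_nth[where K = "\<lambda>n. size M + 2 * n"]) auto
qed

text \<open>\<open>\<tau>(a)\<^sup>* = \<tau>(a\<^sup>*)\<close>: for real \<open>\<rho>\<close> each ingredient of the iterated operator is real.\<close>

lemma (in star_module) weyl_conj_fedosov_tau:
  assumes \<rho>: "is_fedosov_rho sg br x r nabla \<pi> \<Omega> \<rho>"
    and \<rho>_real: "weyl_conj cx_cnj \<rho> = \<rho>"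
    and \<pi>: "\<And>i j. cx_cnj (\<pi> i j) = - \<pi> j i"
    and act_0: "\<And>X. act X 0 = 0" and act_st: "\<And>X a. st (act X a) = act X (st a)"
  shows "weyl_conj st (fedosov_tau sg br x nabla \<pi> \<rho> sc act a) =
    fedosov_tau sg br x nabla \<pi> \<rho> sc act (fps_coeffwise st a)"
proof -
  let ?S = "fedosov_step sg br x nabla \<pi> \<rho> sc act"
  let ?T = "fedosov_connection sg br x nabla \<pi> \<rho> sc act"
  note odd = is_fedosov_rho_one_form[OF \<rho>]
  have L: "weyl_conj st (action_L act x F) = action_L act x (weyl_conj st F)" for F
  proof -
    have "weyl_conj st (weyl_scale act X F) = weyl_scale act X (weyl_conj st F)" for X
      by (rule weyl_eqI) (simp add: act_st)
    then show ?thesis by (simp add: action_L_def weyl_conj_sum weyl_conj_mult_a)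
  qed
  have neg: "div_it sc (- F) = - div_it sc F" for F
    by (rule weyl_eqI) (simp add: div_it_def)
  have T: "weyl_conj st (?T F) = ?T (weyl_conj st F)" for F
    by (simp add: fedosov_connection_def weyl_conj_add weyl_conj_fedosov_D L weyl_conj_div_it
        weyl_conj_ad_odd[OF odd \<pi>] \<rho>_real neg)
  have "weyl_conj st (?S F) = ?S (weyl_conj st F)" for F
    by (simp add: fedosov_step_connection weyl_conj_add weyl_conj_delta_inv T)
  then have "weyl_conj st ((?S ^^ k) F) = (?S ^^ k) (weyl_conj st F)" for k F
    by (induction k) auto
  from this[of _ "weyl_embed a"]
  have "st (fps_nth ((?S ^^ k) (weyl_embed a) M I) n) =
      fps_nth ((?S ^^ k) (weyl_embed (fps_coeffwise st a)) M I) n" for k M I n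
    by (metis weyl_conj_nth weyl_conj_embed)
  then show ?thesis
    by (intro weyl_eqI)
      (simp add: fedosov_tau_nth[where act = act, OF module_axioms is_fedosov_rho_degree[OF \<rho>] act_0] st_sum)
qed


section \<open>The value of the Wick product at symmetric and exterior degree zero\<close>

lemma sum_lists_Suc:
  fixes f :: "'b::finite list \<Rightarrow> 'c::comm_monoid_add"
  shows "(\<Sum>xs | length xs = Suc m. f xs) = (\<Sum>x\<in>UNIV. \<Sum>xs | length xs = m. f (x # xs))"
proof -
  let ?c = "\<lambda>(x, xs). x # xs" and ?S = "UNIV \<times> {xs :: 'b list. length xs = m}"
  have "{xs :: 'b list. length xs = Suc m} = (\<lambda>(x, xs). x # xs) ` (UNIV \<times> {xs. length xs = m})"
    by (auto simp: length_Suc_conv image_iff)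
  moreover have "inj_on (\<lambda>(x, xs). x # xs) (UNIV \<times> {xs :: 'b list. length xs = m})"
    by (auto simp: inj_on_def)
  ultimately have "(\<Sum>xs | length xs = Suc m. f xs) = (\<Sum>p\<in>?S. f (?c p))"
    by (simp only: sum.reindex o_def)
  then show ?thesis by (simp add: sum.cartesian_product split_def)
qed

lemma prod_sum_lists:
  fixes h :: "nat \<Rightarrow> 'b::finite \<Rightarrow> 'c::comm_semiring_1"
  shows "(\<Prod>p<m. \<Sum>k\<in>UNIV. h p k) = (\<Sum>ks | length ks = m. \<Prod>p<m. h p (ks ! p))"
proof (induction m arbitrary: h)
  case (Suc m)
  show ?case
    unfolding prod.lessThan_Suc_shift sum_lists_Suc
    by (simp add: Suc[of "\<lambda>p. h (Suc p)"] sum_product)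
qed simp

lemma prod_sum_lists2:
  fixes h :: "nat \<Rightarrow> 'b::finite \<Rightarrow> 'd::finite \<Rightarrow> 'c::comm_semiring_1"
  shows "(\<Prod>p<m. \<Sum>k\<in>UNIV. \<Sum>l\<in>UNIV. h p k l) =
    (\<Sum>ks | length ks = m. \<Sum>ls | length ls = m. \<Prod>p<m. h p (ks ! p) (ls ! p))"
proof -
  have "(\<Prod>p<m. \<Sum>k\<in>UNIV. \<Sum>l\<in>UNIV. h p k l) =
      (\<Sum>ks | length ks = m. \<Prod>p<m. \<Sum>l\<in>UNIV. h p (ks ! p) l)"
    by (rule prod_sum_lists)
  also have "\<dots> = (\<Sum>ks | length ks = m. \<Sum>ls | length ls = m. \<Prod>p<m. h p (ks ! p) (ls ! p))"
    by (intro sum.cong refl prod_sum_lists)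
  finally show ?thesis .
qed

lemma module_fps:
  assumes "module (sc :: 'c::comm_ring_1 \<Rightarrow> 'v::ring_1 \<Rightarrow> 'v)"
  shows "module (\<lambda>c. fps_coeffwise (sc c))"
proof -
  interpret module sc by fact
  show ?thesis
    by unfold_locales (auto intro!: fps_ext simp: scale_left_distrib scale_right_distrib)
qed

text \<open>Multilinearity of iterated insertions, with the scalars collected.\<close>

lemma foldr_ins_s_vec:
  fixes sc :: "'r::ordered_ring_with_rat cx \<Rightarrow> 'v::ring_1 \<Rightarrow> 'v" and F :: "('i::finite, 'v) weyl"
  assumes "module sc"
  shows "foldr (\<lambda>k. ins_s_vec sc (Z k)) ks F =
    (\<Sum>is | length is = length ks. weyl_scale sc (\<Prod>p<length ks. Z (ks ! p) (is ! p)) (foldr ins_s is F))"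
proof (induction ks)
  case Nil
  interpret module sc by fact
  show ?case by (rule weyl_eqI) simp
next
  case (Cons k ks)
  interpret module sc by fact
  interpret w: module "\<lambda>c. fps_coeffwise (sc c)" by (rule module_fps) fact
  have comm: "ins_s i (weyl_scale sc c G) = weyl_scale sc c (ins_s i G)" for i c and G :: "('i, 'v) weyl"
  proof (rule weyl_eqI)
    fix M I n
    have "of_nat m * sc c v = sc c (of_nat m * v)" for m v
      by (induction m) (auto simp: distrib_right scale_right_distrib)
    then show "fps_nth (ins_s i (weyl_scale sc c G) M I) n = fps_nth (weyl_scale sc c (ins_s i G) M I) n"
      by (simp only: ins_s_nth weyl_scale_nth)
  qed
  have scale: "weyl_scale sc c (weyl_scale sc d G) = weyl_scale sc (c * d) G" for c d and G :: "('i, 'v) weyl"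
    by (rule weyl_eqI) simp
  have scale_sum: "weyl_scale sc c (\<Sum>i\<in>S. G i) = (\<Sum>i\<in>S. weyl_scale sc c (G i))"
    for c S and G :: "_ \<Rightarrow> ('i, 'v) weyl"
    by (rule weyl_eqI) (simp add: weyl_sum_apply fps_sum_nth scale_sum_right)
  have "foldr (\<lambda>k. ins_s_vec sc (Z k)) (k # ks) F = ins_s_vec sc (Z k) (\<Sum>is | length is = length ks.
      weyl_scale sc (\<Prod>p<length ks. Z (ks ! p) (is ! p)) (foldr ins_s is F))"
    by (simp only: foldr_Cons o_apply Cons)
  also have "\<dots> = (\<Sum>is | length is = length (k # ks).
      weyl_scale sc (\<Prod>p<length (k # ks). Z ((k # ks) ! p) (is ! p)) (foldr ins_s is F))"
    by (simp add: ins_s_vec_def ins_s_sum comm scale_sum scale sum_lists_Suc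
        prod.lessThan_Suc_shift del: prod.lessThan_Suc)
  finally show ?case .
qed

definition taylor_coeff :: "('i, 'a::ring_1) weyl \<Rightarrow> 'i list \<Rightarrow> 'a fps" where
  "taylor_coeff F is = weyl_sigma (foldr ins_s is F)"

lemma taylor_component_coeff:
  fixes sc :: "'r::ordered_ring_with_rat cx \<Rightarrow> 'v::ring_1 \<Rightarrow> 'v"
  assumes "module sc"
  shows "taylor_component sc Z F ks = (\<Sum>is | length is = length ks.
    fps_coeffwise (sc (\<Prod>p<length ks. Z (ks ! p) (is ! p))) (taylor_coeff F is))"
  by (simp add: taylor_component_def foldr_ins_s_vec[OF assms] taylor_coeff_def weyl_sigma_def
      weyl_sum_apply weyl_scale_def)

lemma weyl_sigma_wick_power:
  "weyl_sigma (wick_power sc (*) \<pi> m F G) = (\<Sum>is | length is = m. \<Sum>js | length js = m.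
    fps_coeffwise (sc (\<Prod>p<m. \<pi> (is ! p) (js ! p))) (taylor_coeff F is * taylor_coeff G js))"
proof -
  have "{K. K \<subseteq># {#}} = {{#}}" by auto
  then show ?thesis
    by (simp add: wick_power_def weyl_sigma_def weyl_sum_apply weyl_scale_def weyl_mult_def
        taylor_coeff_def wedge_sign_def fps_bilinear_times)
qed

text \<open>The product \<open>\<Prod>\<^sub>p \<pi>\<^bsub>i\<^sub>p j\<^sub>p\<^esub>\<close> expands, by the hypothesis on \<open>\<pi>\<close>, into products of entries of \<open>g\<close> and of
  components of the vectors \<open>Z\<close> and \<open>Zb\<close>; the latter turn insertions of basis vectors into
  insertions of \<open>Z\<close> and \<open>Zb\<close>. The rest is an exchange of the four finite sums.\<close>

lemma weyl_sigma_wick_power_components: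
  fixes sc :: "'r::ordered_ring_with_rat cx \<Rightarrow> 'v::ring_1 \<Rightarrow> 'v"
    and g :: "'n::finite \<Rightarrow> 'n \<Rightarrow> 'r cx"
  assumes bil: "bilinear_map sc sc sc (*)"
    and \<pi>: "\<And>i j. cx_i * cx_rat (1/2) * \<pi> i j = cx_rat 2 * (\<Sum>k\<in>UNIV. \<Sum>l\<in>UNIV. g k l * Z k i * Zb l j)"
  shows "fps_coeffwise (sc (wick_coeff m)) (weyl_sigma (wick_power sc (*) \<pi> m F G)) =
    fps_coeffwise (sc (cx_rat (2 ^ m / fact m)))
      (\<Sum>ks | length ks = m. \<Sum>ls | length ls = m. fps_coeffwise (sc (\<Prod>p<m. g (ks ! p) (ls ! p)))
        (taylor_component sc Z F ks * taylor_component sc Zb G ls))"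
proof -
  have mod: "module sc"
    using bil by (simp add: bilinear_map_def module_hom_def)
  interpret w: module "\<lambda>c. fps_coeffwise (sc c)" by (rule module_fps[OF mod])
  have mult_left: "sc c v * w = sc c (v * w)" and mult_right: "v * sc c w = sc c (v * w)" for c v w
    using bil by (simp_all add: bilinear_map_def module_hom_iff)
  interpret module sc by fact
  have mult: "fps_coeffwise (sc c) P * fps_coeffwise (sc d) Q = fps_coeffwise (sc (c * d)) (P * Q)" for c d P Q
    by (rule fps_ext) (simp add: fps_mult_nth mult_left mult_right scale_sum_right mult.commute)
  let ?c = "cx_rat (2 ^ m / fact m) :: 'r cx"
  have coeff: "wick_coeff m * (\<Prod>p<m. \<pi> (is ! p) (js ! p)) =
      (\<Sum>ks | length ks = m. \<Sum>ls | length ls = m. ?c * ((\<Prod>p<m. g (ks ! p) (ls ! p)) *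
        ((\<Prod>p<m. Z (ks ! p) (is ! p)) * (\<Prod>p<m. Zb (ls ! p) (js ! p)))))" for "is" js
  proof -
    have "wick_coeff m * (\<Prod>p<m. \<pi> (is ! p) (js ! p)) =
        cx_rat (1 / fact m) * (\<Prod>p<m. cx_i * cx_rat (1/2) * \<pi> (is ! p) (js ! p))"
      by (simp only: wick_coeff_def prod.distrib prod_constant card_lessThan power_mult_distrib mult.assoc)
    also have "\<dots> = cx_rat (1 / fact m) * cx_rat (2 ^ m) *
        (\<Prod>p<m. \<Sum>k\<in>UNIV. \<Sum>l\<in>UNIV. g k l * Z k (is ! p) * Zb l (js ! p))"
      unfolding \<pi> prod.distrib prod_constant card_lessThan cx_rat_power by (simp only: mult.assoc)
    also have "cx_rat (1 / fact m) * cx_rat (2 ^ m) = ?c"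
      by (simp flip: cx_rat_mult)
    finally show ?thesis
      by (simp only: prod_sum_lists2 sum_distrib_left prod.distrib mult.assoc)
  qed
  let ?S = "\<lambda>c. fps_coeffwise (sc c)"
  let ?E = "\<lambda>is js ks ls. ?S (?c * ((\<Prod>p<m. g (ks ! p) (ls ! p)) *
        ((\<Prod>p<m. Z (ks ! p) (is ! p)) * (\<Prod>p<m. Zb (ls ! p) (js ! p)))))
      (taylor_coeff F is * taylor_coeff G js)"
  let ?L = "\<lambda>m. {xs. length xs = m}"
  have "?S (wick_coeff m) (weyl_sigma (wick_power sc (*) \<pi> m F G)) =
      (\<Sum>is\<in>?L m. \<Sum>js\<in>?L m. \<Sum>ks\<in>?L m. \<Sum>ls\<in>?L m. ?E is js ks ls)"
    by (simp only: weyl_sigma_wick_power w.scale_sum_right w.scale_scale coeff w.scale_sum_left)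
  also have "\<dots> = (\<Sum>is\<in>?L m. \<Sum>ks\<in>?L m. \<Sum>js\<in>?L m. \<Sum>ls\<in>?L m. ?E is js ks ls)"
    by (rule sum.cong[OF refl], rule sum.swap)
  also have "\<dots> = (\<Sum>is\<in>?L m. \<Sum>ks\<in>?L m. \<Sum>ls\<in>?L m. \<Sum>js\<in>?L m. ?E is js ks ls)"
    by (rule sum.cong[OF refl], rule sum.cong[OF refl], rule sum.swap)
  also have "\<dots> = (\<Sum>ks\<in>?L m. \<Sum>is\<in>?L m. \<Sum>ls\<in>?L m. \<Sum>js\<in>?L m. ?E is js ks ls)"
    by (rule sum.swap)
  also have "\<dots> = (\<Sum>ks\<in>?L m. \<Sum>ls\<in>?L m. \<Sum>is\<in>?L m. \<Sum>js\<in>?L m. ?E is js ks ls)"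
    by (rule sum.cong[OF refl], rule sum.swap)
  also have "\<dots> = (\<Sum>ks\<in>?L m. \<Sum>ls\<in>?L m. ?S ?c (?S (\<Prod>p<m. g (ks ! p) (ls ! p))
        (taylor_component sc Z F ks * taylor_component sc Zb G ls)))"
    by (rule sum.cong[OF refl], rule sum.cong[OF refl])
      (simp add: taylor_component_coeff[OF mod] sum_product mult w.scale_sum_right)
  finally show ?thesis by (simp only: w.scale_sum_right)
qed

lemma cRe_sum: "cRe (\<Sum>i\<in>S. z i) = (\<Sum>i\<in>S. cRe (z i :: 'r::comm_ring_1 cx))"
  and cIm_sum: "cIm (\<Sum>i\<in>S. z i) = (\<Sum>i\<in>S. cIm (z i :: 'r::comm_ring_1 cx))"
  by (induction S rule: infinite_finite_induct) auto

lemma sum_sum_cong: "(\<And>k l. h k l = h' k l) \<Longrightarrow> (\<Sum>k\<in>K. \<Sum>l\<in>L. h k l) = (\<Sum>k\<in>K. \<Sum>l\<in>L. h' k l)"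
  by simp

text \<open>Both sides are \<open>1/2\<close> times \<open>s + i r = g\<^sup>k\<^sup>l (e\<^sub>k - i f\<^sub>k) \<otimes> (e\<^sub>l + i f\<^sub>l)\<close>. In the Kaehler tensors the terms
  with \<open>f\<^sub>l \<otimes> e\<^sub>k\<close> have their indices exchanged, which changes the sign of those with \<open>B\<close> and keeps
  that of those with \<open>A\<close>.\<close>

lemma wick_tensor_kaehler:
  fixes x :: "'i::finite \<Rightarrow> 'g::ab_group_add" and e f :: "'n::finite \<Rightarrow> 'g"
    and A B :: "('r::ordered_ring_with_rat, 'n) sqmat"
  assumes A: "transpose A = A" and B: "transpose B = - B"
  shows "cx_i * cx_rat (1/2) * wick_tensor (kaehler_r sg x e f A B) (kaehler_s sg x e f A B) i j =
    cx_rat 2 * (\<Sum>k\<in>UNIV. \<Sum>l\<in>UNIV. kaehler_g A B k l * cx_cnj (Zbar sg x e f k i) * Zbar sg x e f l j)"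
proof -
  have entry: "transpose M $ k $ l = M $ l $ k" for M :: "('r, 'n) sqmat" and k l
    by (simp add: transpose_def)
  have A': "A $ k $ l = A $ l $ k" for k l
    using entry[of A k l] unfolding A .
  have B': "B $ k $ l = - B $ l $ k" for k l
    using entry[of B l k] unfolding B by simp
  define E where "E k i = coord sg x (e k) i" for k i
  define Q where "Q k i = coord sg x (f k) i" for k i
  let ?s = "\<lambda>k l. A $ k $ l * (E k i * E l j + Q k i * Q l j) - B $ k $ l * (E k i * Q l j - Q k i * E l j)"
  let ?r = "\<lambda>k l. A $ k $ l * (E k i * Q l j - Q k i * E l j) + B $ k $ l * (E k i * E l j + Q k i * Q l j)"
  have swapA: "(\<Sum>k\<in>UNIV. \<Sum>l\<in>UNIV. A $ k $ l * (Q l i * E k j)) = (\<Sum>k\<in>UNIV. \<Sum>l\<in>UNIV. A $ k $ l * (Q k i * E l j))"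
  proof -
    have *: "A $ k $ l * v = A $ l $ k * v" for k l v by (rule arg_cong[OF A'])
    show ?thesis
      by (subst sum.swap, rule sum.cong[OF refl], rule sum.cong[OF refl], rule *)
  qed
  have swapB: "(\<Sum>k\<in>UNIV. \<Sum>l\<in>UNIV. B $ k $ l * (Q l i * E k j)) = - (\<Sum>k\<in>UNIV. \<Sum>l\<in>UNIV. B $ k $ l * (Q k i * E l j))"
  proof -
    have *: "B $ k $ l * v = - (B $ l $ k * v)" for k l v
      unfolding minus_mult_left by (rule arg_cong[OF B'])
    have "(\<Sum>k\<in>UNIV. \<Sum>l\<in>UNIV. B $ k $ l * (Q l i * E k j)) = (\<Sum>l\<in>UNIV. \<Sum>k\<in>UNIV. B $ k $ l * (Q l i * E k j))"
      by (rule sum.swap)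
    also have "\<dots> = (\<Sum>l\<in>UNIV. \<Sum>k\<in>UNIV. - (B $ l $ k * (Q l i * E k j)))"
      by (rule sum.cong[OF refl], rule sum.cong[OF refl], rule *)
    finally show ?thesis by (simp add: sum_negf)
  qed
  have s: "kaehler_s sg x e f A B $ i $ j = (\<Sum>k\<in>UNIV. \<Sum>l\<in>UNIV. ?s k l)"
  proof -
    have "kaehler_s sg x e f A B $ i $ j = (\<Sum>k\<in>UNIV. \<Sum>l\<in>UNIV.
        (A $ k $ l * (E k i * E l j + Q k i * Q l j) - B $ k $ l * (E k i * Q l j)) - B $ k $ l * (Q l i * E k j))"
      unfolding kaehler_s_def vec_lambda_beta
      by (rule sum_sum_cong) (simp add: tensor_matrix_def E_def Q_def algebra_simps)
    also have "\<dots> = (\<Sum>k\<in>UNIV. \<Sum>l\<in>UNIV.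
        A $ k $ l * (E k i * E l j + Q k i * Q l j) - B $ k $ l * (E k i * Q l j)) +
        (\<Sum>k\<in>UNIV. \<Sum>l\<in>UNIV. B $ k $ l * (Q k i * E l j))"
      by (simp only: sum_subtractf swapB diff_minus_eq_add)
    also have "\<dots> = (\<Sum>k\<in>UNIV. \<Sum>l\<in>UNIV. ?s k l)"
      unfolding sum.distrib[symmetric] by (rule sum_sum_cong) (simp add: right_diff_distrib)
    finally show ?thesis .
  qed
  have r: "kaehler_r sg x e f A B $ i $ j = (\<Sum>k\<in>UNIV. \<Sum>l\<in>UNIV. ?r k l)"
  proof -
    have "kaehler_r sg x e f A B $ i $ j = (\<Sum>k\<in>UNIV. \<Sum>l\<in>UNIV.
        (B $ k $ l * (E k i * E l j + Q k i * Q l j) + A $ k $ l * (E k i * Q l j)) - A $ k $ l * (Q l i * E k j))"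
      unfolding kaehler_r_def vec_lambda_beta
      by (rule sum_sum_cong) (simp add: tensor_matrix_def E_def Q_def algebra_simps)
    also have "\<dots> = (\<Sum>k\<in>UNIV. \<Sum>l\<in>UNIV.
        B $ k $ l * (E k i * E l j + Q k i * Q l j) + A $ k $ l * (E k i * Q l j)) -
        (\<Sum>k\<in>UNIV. \<Sum>l\<in>UNIV. A $ k $ l * (Q k i * E l j))"
      by (simp only: sum_subtractf swapA)
    also have "\<dots> = (\<Sum>k\<in>UNIV. \<Sum>l\<in>UNIV. ?r k l)"
      unfolding sum_subtractf[symmetric] by (rule sum_sum_cong) (simp add: algebra_simps)
    finally show ?thesis .
  qed
  let ?T = "\<lambda>k l. kaehler_g A B k l * ((cx_of (E k i) - cx_i * cx_of (Q k i)) * (cx_of (E l j) + cx_i * cx_of (Q l j)))"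
  have T: "cx_i * wick_tensor (kaehler_r sg x e f A B) (kaehler_s sg x e f A B) i j = (\<Sum>k\<in>UNIV. \<Sum>l\<in>UNIV. ?T k l)"
  proof (rule cx_eqI)
    show "cRe (cx_i * wick_tensor (kaehler_r sg x e f A B) (kaehler_s sg x e f A B) i j) = cRe (\<Sum>k\<in>UNIV. \<Sum>l\<in>UNIV. ?T k l)"
      unfolding cRe_sum using s by (simp add: wick_tensor_def kaehler_g_def algebra_simps)
    show "cIm (cx_i * wick_tensor (kaehler_r sg x e f A B) (kaehler_s sg x e f A B) i j) = cIm (\<Sum>k\<in>UNIV. \<Sum>l\<in>UNIV. ?T k l)"
      unfolding cIm_sum using r by (simp add: wick_tensor_def kaehler_g_def algebra_simps)
  qed
  have "2 * (1/2) * (1/2) = (1/2 :: rat)" by simp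
  then have half: "cx_rat 2 * (cx_rat (1/2) * cx_rat (1/2)) = (cx_rat (1/2) :: 'r cx)"
    by (metis cx_rat_mult mult.assoc)
  have "cx_rat 2 * (\<Sum>k\<in>UNIV. \<Sum>l\<in>UNIV. kaehler_g A B k l * cx_cnj (Zbar sg x e f k i) * Zbar sg x e f l j) =
      cx_rat 2 * (cx_rat (1/2) * cx_rat (1/2)) * (\<Sum>k\<in>UNIV. \<Sum>l\<in>UNIV. ?T k l)"
    unfolding sum_distrib_left
    by (rule sum_sum_cong) (simp add: Zbar_def E_def Q_def algebra_simps)
  then show ?thesis unfolding half T[symmetric] by (simp add: mult_ac)
qed


section \<open>Positivity over an ordered ring\<close>

lemma cx_2_sel [simp]: "cRe (2::'r::comm_ring_1 cx) = 2" "cIm (2::'r cx) = 0"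
  unfolding one_add_one[symmetric] cx_sel by simp_all

lemma cx_nonneg_iff: "cx_nonneg z \<longleftrightarrow> cIm z = 0 \<and> 0 \<le> cRe z"
proof
  assume z: "cIm z = 0 \<and> 0 \<le> cRe z"
  have "z = cx_of (cRe z)" by (rule cx_eqI) (simp_all add: z)
  with z show "cx_nonneg z" unfolding cx_nonneg_def by blast
qed (auto simp: cx_nonneg_def)

lemma fps_nonneg_iff:
  "fps_nonneg H \<longleftrightarrow> H = 0 \<or> (\<exists>d. (\<forall>n<d. fps_nth H n = 0) \<and> 0 < fps_nth H d)"
proof
  assume "fps_nonneg H"
  then have "H = 0 \<or> 0 < fps_nth H (subdegree H)" by (simp add: fps_nonneg_def)
  moreover have "\<forall>n<subdegree H. fps_nth H n = 0" by (simp add: nth_less_subdegree_zero)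
  ultimately show "H = 0 \<or> (\<exists>d. (\<forall>n<d. fps_nth H n = 0) \<and> 0 < fps_nth H d)" by blast
next
  assume "H = 0 \<or> (\<exists>d. (\<forall>n<d. fps_nth H n = 0) \<and> 0 < fps_nth H d)"
  then show "fps_nonneg H"
  proof (elim disjE exE conjE)
    fix d assume d: "\<forall>n<d. fps_nth H n = 0" "0 < fps_nth H d"
    then have "subdegree H = d" by (intro subdegreeI) auto
    then show ?thesis using d by (simp add: fps_nonneg_def)
  qed (simp add: fps_nonneg_def)
qed

lemma cx_fps_nonneg_iff:
  "cx_fps_nonneg F \<longleftrightarrow> (\<forall>n. cIm (fps_nth F n) = 0) \<and>
    (F = 0 \<or> (\<exists>d. (\<forall>n<d. fps_nth F n = 0) \<and> 0 < cRe (fps_nth F d)))"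
proof -
  have pos: "cx_fps_nonneg F \<longleftrightarrow> (\<forall>n. cIm (fps_nth F n) = 0) \<and> fps_nonneg (fps_coeffwise cRe F)"
  proof
    assume "cx_fps_nonneg F"
    then obtain H where H: "fps_nonneg H" and F: "F = fps_coeffwise cx_of H"
      by (auto simp: cx_fps_nonneg_def)
    have "fps_coeffwise cRe F = H" unfolding F by (rule fps_ext) simp
    with H show "(\<forall>n. cIm (fps_nth F n) = 0) \<and> fps_nonneg (fps_coeffwise cRe F)" by (simp add: F)
  next
    assume F: "(\<forall>n. cIm (fps_nth F n) = 0) \<and> fps_nonneg (fps_coeffwise cRe F)"
    then have "F = fps_coeffwise cx_of (fps_coeffwise cRe F)"
      by (intro fps_ext cx_eqI) simp_all
    with F show "cx_fps_nonneg F" unfolding cx_fps_nonneg_def by blast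
  qed
  have zero: "cRe (fps_nth F n) = 0 \<longleftrightarrow> fps_nth F n = 0" if "\<forall>n. cIm (fps_nth F n) = 0" for n
    using that by (metis cx_eqI cx_sel(1) cx_sel(2))
  show ?thesis unfolding pos fps_nonneg_iff
    by (rule conj_cong) (simp_all add: zero fps_eq_iff)
qed

lemma cx_fps_nonneg_Im: "cx_fps_nonneg F \<Longrightarrow> cIm (fps_nth F n) = 0"
  unfolding cx_fps_nonneg_iff by blast

lemma cx_fps_nonnegI:
  "(\<And>n. cIm (fps_nth F n) = 0) \<Longrightarrow> (\<And>n. n < d \<Longrightarrow> fps_nth F n = 0) \<Longrightarrow> 0 < cRe (fps_nth F d) \<Longrightarrow>
    cx_fps_nonneg F"
  unfolding cx_fps_nonneg_iff by blast

lemma cx_fps_nonneg_leading: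
  assumes "cx_fps_nonneg F" "F \<noteq> 0"
  obtains d where "\<And>n. n < d \<Longrightarrow> fps_nth F n = 0" "0 < cRe (fps_nth F d)"
  using assms unfolding cx_fps_nonneg_iff by blast

lemma cx_fps_nonneg_0 [simp]: "cx_fps_nonneg 0"
  by (simp add: cx_fps_nonneg_iff)

lemma cx_fps_nonneg_add:
  assumes "cx_fps_nonneg F" "cx_fps_nonneg G"
  shows "cx_fps_nonneg (F + G)"
proof (cases "F = 0 \<or> G = 0")
  case False
  obtain d where d: "\<And>n. n < d \<Longrightarrow> fps_nth F n = 0" "0 < cRe (fps_nth F d)"
    using cx_fps_nonneg_leading[OF assms(1)] False by blast
  obtain d' where d': "\<And>n. n < d' \<Longrightarrow> fps_nth G n = 0" "0 < cRe (fps_nth G d')"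
    using cx_fps_nonneg_leading[OF assms(2)] False by blast
  have "0 < cRe (fps_nth (F + G) (min d d'))"
  proof (cases d d' rule: linorder_cases)
    case less
    then show ?thesis using d(2) d'(1)[OF less] by simp
  next
    case equal
    then show ?thesis using d(2) d'(2) by (simp add: add_pos_pos)
  next
    case greater
    then show ?thesis using d'(2) d(1)[OF greater] by simp
  qed
  then show ?thesis
    by (rule cx_fps_nonnegI[rotated 2]) (simp_all add: cx_fps_nonneg_Im assms d d')
qed (use assms in auto)

lemma cx_fps_nonneg_sum: "(\<And>i. i \<in> S \<Longrightarrow> cx_fps_nonneg (F i)) \<Longrightarrow> cx_fps_nonneg (\<Sum>i\<in>S. F i)"
  by (induction S rule: infinite_finite_induct) (auto intro: cx_fps_nonneg_add)

lemma cx_fps_nonneg_monom: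
  fixes F :: "'r::ordered_ring_with_rat cx fps"
  assumes "cx_fps_nonneg F" "0 \<le> c"
    and G: "\<And>n. fps_nth G n = (if n < m then 0 else cx_of c * fps_nth F (n - m))"
  shows "cx_fps_nonneg G"
proof (cases "F = 0 \<or> c = 0")
  case True
  then have "fps_nth G n = 0" for n by (auto simp: G cx_of_simps)
  then have "G = 0" by (intro fps_ext) simp
  then show ?thesis by simp
next
  case False
  obtain d where d: "\<And>n. n < d \<Longrightarrow> fps_nth F n = 0" "0 < cRe (fps_nth F d)"
    using cx_fps_nonneg_leading[OF assms(1)] False by blast
  have "0 < cRe (fps_nth G (m + d))"
    using d False assms(2) by (simp add: G)
  then show ?thesis
    by (rule cx_fps_nonnegI[rotated 2]) (auto simp: G d cx_fps_nonneg_Im[OF assms(1)])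
qed

lemma cx_fps_nonneg_cancel:
  fixes F :: "'r::ordered_ring_with_rat cx fps"
  assumes "cx_fps_nonneg (fps_coeffwise ((*) (cx_of c)) F)" "0 < c"
  shows "cx_fps_nonneg F"
proof -
  let ?G = "fps_coeffwise ((*) (cx_of c)) F"
  have zero: "fps_nth F n = 0" if "fps_nth ?G n = 0" for n
  proof -
    have "cRe (fps_nth ?G n) = 0" "cIm (fps_nth ?G n) = 0" using that by simp_all
    then show ?thesis using assms(2) by (auto intro: cx_eqI)
  qed
  have im: "cIm (fps_nth F n) = 0" for n
    using cx_fps_nonneg_Im[OF assms(1), of n] assms(2) by simp
  show ?thesis
  proof (cases "?G = 0")
    case True
    have "fps_nth F n = 0" for n by (rule zero) (simp only: True fps_zero_nth)
    then have "F = 0" by (intro fps_ext) simp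
    then show ?thesis by simp
  next
    case False
    obtain d where d: "\<And>n. n < d \<Longrightarrow> fps_nth ?G n = 0" "0 < cRe (fps_nth ?G d)"
      using cx_fps_nonneg_leading[OF assms(1) False] by blast
    have "0 < cRe (fps_nth F d)" using d(2) assms(2) by (simp add: zero_less_mult_iff)
    then show ?thesis using im zero d(1) by (intro cx_fps_nonnegI[of F d]) blast+
  qed
qed

text \<open>A \<open>t\<close>-adically convergent sum of nonnegative series is nonnegative, since its lowest
  coefficient is that of a finite partial sum.\<close>

lemma cx_fps_nonneg_suminf:
  fixes T :: "nat \<Rightarrow> 'r::ordered_ring_with_rat cx fps"
  assumes nonneg: "\<And>m. cx_fps_nonneg (T m)"
    and vanish: "\<And>m n. n < m \<Longrightarrow> fps_nth (T m) n = 0"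
    and S: "\<And>n. fps_nth S n = (\<Sum>m\<le>n. fps_nth (T m) n)"
  shows "cx_fps_nonneg S"
proof (cases "S = 0")
  case False
  define d where "d = subdegree S"
  have d: "fps_nth S d \<noteq> 0" "\<And>n. n < d \<Longrightarrow> fps_nth S n = 0"
    using False by (auto simp: d_def nth_less_subdegree_zero)
  let ?P = "\<Sum>m\<le>d. T m"
  have P: "fps_nth ?P n = fps_nth S n" if "n \<le> d" for n
    unfolding S fps_sum_nth using that
    by (intro sum.mono_neutral_right) (auto intro: vanish)
  have "cx_fps_nonneg ?P" by (intro cx_fps_nonneg_sum nonneg)
  moreover have "?P \<noteq> 0" using P[of d] d(1) by auto
  ultimately obtain d' where d': "\<And>n. n < d' \<Longrightarrow> fps_nth ?P n = 0" "0 < cRe (fps_nth ?P d')"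
    using cx_fps_nonneg_leading by blast
  have "\<not> d < d'" using d'(1)[of d] P[of d] d(1) by auto
  moreover have "\<not> d' < d" using d'(2) P[of d'] d(2)[of d'] by auto
  ultimately have "d' = d" by simp
  then have "0 < cRe (fps_nth S d)" using d'(2) P[of d] by simp
  moreover have "cIm (fps_nth S n) = 0" for n
    by (simp add: S cIm_sum cx_fps_nonneg_Im[OF nonneg])
  ultimately show ?thesis using d(2) by (intro cx_fps_nonnegI)
qed simp

text \<open>The properties shared by a positive semidefinite matrix over \<open>C\<close> and by \<open>(u, v) \<mapsto> \<omega>(u\<^sup>* v)\<close>.\<close>

locale positive_form =
  fixes scale :: "'r::ordered_ring_with_rat cx \<Rightarrow> 'u::ab_group_add \<Rightarrow> 'u" and b :: "'u \<Rightarrow> 'u \<Rightarrow> 'r cx"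
  assumes add_left: "b (u + v) w = b u w + b v w" and add_right: "b u (v + w) = b u v + b u w"
    and scale_left: "b (scale c u) v = cx_cnj c * b u v" and scale_right: "b u (scale c v) = c * b u v"
    and nonneg: "cx_nonneg (b u u)"
begin

lemma expand: "cx_nonneg (cx_cnj z * (z * b u u) + cx_cnj z * (w * b u v) + (cx_cnj w * (z * b v u) + cx_cnj w * (w * b v v)))"
  using nonneg[of "scale z u + scale w v"] by (simp add: add_left add_right scale_left scale_right algebra_simps)

text \<open>Polarization: the values at \<open>u + v\<close> and \<open>u + i v\<close> are real.\<close>

lemma hermitian: "b v u = cx_cnj (b u v)"
proof -
  have "cIm (b u v) + cIm (b v u) = 0" "cRe (b u v) - cRe (b v u) = 0"
    using nonneg[of u] nonneg[of v] expand[of 1 u 1 v] expand[of 1 u cx_i v] by (simp_all add: cx_nonneg_iff)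
  then show ?thesis by (auto intro!: cx_eqI simp: add_eq_0_iff)
qed

text \<open>The degenerate case of the Cauchy-Schwarz inequality. With \<open>n = |b u v|\<^sup>2\<close> and \<open>\<beta> = b v v\<close>, the test
  vector \<open>-(\<beta> + 1) (b u v) u + n v\<close> has the value \<open>n\<^sup>2 \<beta> - 2 n\<^sup>2 (\<beta> + 1) = - n\<^sup>2 (\<beta> + 2)\<close>, which is negative
  unless \<open>n = 0\<close>. Its coefficients are chosen so that nothing is divided by \<open>\<beta>\<close> or let go to infinity.\<close>

lemma null:
  assumes "b u u = 0"
  shows "b u v = 0" "b v u = 0"
proof -
  define p q n where "p = cRe (b u v)" and "q = cIm (b u v)" and "n = p * p + q * q"
  define \<beta> where "\<beta> = cRe (b v v)"
  have "0 \<le> \<beta>" "cIm (b v v) = 0" using nonneg[of v] by (auto simp: cx_nonneg_iff \<beta>_def)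
  have "0 \<le> cRe (cx_cnj (- (cx_of (\<beta> + 1) * b u v)) * (cx_of n * b u v) +
      (cx_of n * (- (cx_of (\<beta> + 1) * b u v) * b v u) + cx_of n * (cx_of n * b v v)))"
    using expand[of "- (cx_of (\<beta> + 1) * b u v)" u "cx_of n" v] assms by (simp add: cx_nonneg_iff)
  also have "\<dots> = n * n * \<beta> - 2 * (n * n * (\<beta> + 1))"
    unfolding hermitian[of v u]
    by (simp add: p_def[symmetric] q_def[symmetric] \<beta>_def[symmetric], simp add: n_def algebra_simps)
  finally have "n * n * (\<beta> + 2) \<le> 0" by (simp add: algebra_simps)
  then have "n * n \<le> 0" using \<open>0 \<le> \<beta>\<close> by (simp add: mult_le_0_iff)
  then have "n = 0" by (metis mult_eq_0_iff order_antisym zero_le_square)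
  then have "p = 0" "q = 0" by (simp_all add: n_def sum_squares_eq_zero_iff)
  then show "b u v = 0" by (auto intro: cx_eqI simp: p_def q_def)
  then show "b v u = 0" using hermitian[of v u] by simp
qed

end


lemma cx_nonneg_cancel:
  assumes "cx_nonneg (cx_of a * z)" "0 < a"
  shows "cx_nonneg z"
  using assms by (simp add: cx_nonneg_iff zero_le_mult_iff)

lemma (in positive_form) cx_nonneg_diag: "b u u = cx_of (cRe (b u u))" "0 \<le> cRe (b u u)"
  using nonneg[of u] by (auto intro!: cx_eqI simp: cx_nonneg_iff)

definition matrix_form :: "('n \<Rightarrow> 'n \<Rightarrow> 'r cx) \<Rightarrow> ('n \<Rightarrow> 'r cx) \<Rightarrow> ('n \<Rightarrow> 'r cx) \<Rightarrow> 'r::comm_ring_1 cx" where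
  "matrix_form g z w = (\<Sum>k\<in>UNIV. \<Sum>l\<in>UNIV. cx_cnj (z k) * g k l * w l)"

lemma positive_form_matrix:
  assumes "\<And>z. cx_nonneg (matrix_form g z z)"
  shows "positive_form (\<lambda>c z k. c * z k) (matrix_form (g :: 'n::finite \<Rightarrow> 'n \<Rightarrow> 'r::ordered_ring_with_rat cx))"
proof
  show "matrix_form g (u + v) w = matrix_form g u w + matrix_form g v w" for u v w
    unfolding matrix_form_def plus_fun_apply sum.distrib[symmetric] by (rule sum_sum_cong) (simp add: algebra_simps)
  show "matrix_form g u (v + w) = matrix_form g u v + matrix_form g u w" for u v w
    unfolding matrix_form_def plus_fun_apply sum.distrib[symmetric] by (rule sum_sum_cong) (simp add: algebra_simps)
  show "matrix_form g (\<lambda>k. c * u k) v = cx_cnj c * matrix_form g u v" for c u v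
    unfolding matrix_form_def sum_distrib_left by (rule sum_sum_cong) (simp add: algebra_simps)
  show "matrix_form g u (\<lambda>k. c * v k) = c * matrix_form g u v" for c u v
    unfolding matrix_form_def sum_distrib_left by (rule sum_sum_cong) (simp add: algebra_simps)
qed (rule assms)

text \<open>The conditional expressions are the unit vectors.\<close>

lemma matrix_form_unit:
  fixes g :: "'n::finite \<Rightarrow> 'n \<Rightarrow> 'r::ordered_ring_with_rat cx"
  shows "matrix_form g (\<lambda>k. if k = p then 1 else 0) w = (\<Sum>l\<in>UNIV. g p l * w l)"
    "matrix_form g z (\<lambda>k. if k = q then 1 else 0) = (\<Sum>k\<in>UNIV. cx_cnj (z k) * g k q)"
    "matrix_form g (\<lambda>k. if k = p then 1 else 0) (\<lambda>k. if k = q then 1 else 0) = g p q"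
proof -
  have *: "cx_cnj (if P then 1 else 0) * a * c = (if P then a * c else 0)"
    "d * (if P then 1 else 0) = (if P then d else 0)" for P and a c d :: "'r cx"
    by simp_all
  have "(\<Sum>l\<in>UNIV. if k = p then h l else 0) = (if k = p then sum h UNIV else 0)" for k and h :: "'n \<Rightarrow> 'r cx"
    by simp
  then show "matrix_form g (\<lambda>k. if k = p then 1 else 0) w = (\<Sum>l\<in>UNIV. g p l * w l)" for w
    unfolding matrix_form_def * by (simp only: sum.delta finite UNIV_I if_True)
  from this[of "\<lambda>k. if k = q then 1 else 0"]
  show "matrix_form g (\<lambda>k. if k = p then 1 else 0) (\<lambda>k. if k = q then 1 else 0) = g p q"
    unfolding * by (simp only: sum.delta finite UNIV_I if_True)
  show "matrix_form g z (\<lambda>k. if k = q then 1 else 0) = (\<Sum>k\<in>UNIV. cx_cnj (z k) * g k q)"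
    unfolding matrix_form_def * by (simp only: sum.delta finite UNIV_I if_True)
qed

text \<open>Gaussian elimination without fractions, one index \<open>p\<close> at a time. If \<open>g p p = 0\<close>, the row and the
  column of \<open>p\<close> vanish. Otherwise \<open>a = g p p\<close> is positive, and \<open>a g = (g p)\<^sup>* (g p) + h\<close> for the matrix \<open>h\<close>
  of the two-by-two minors with pivot \<open>p\<close>, which has no entries in the row and the column of \<open>p\<close> and is
  again positive semidefinite. The indices that have been used as pivots number the squares.\<close>

lemma psd_matrix_decomposition:
  fixes g :: "'n::finite \<Rightarrow> 'n \<Rightarrow> 'r::ordered_ring_with_rat cx"
  assumes "\<And>z. cx_nonneg (matrix_form g z z)"
  obtains N :: 'r and d :: "'n \<Rightarrow> 'r" and v :: "'n \<Rightarrow> 'n \<Rightarrow> 'r cx"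
  where "0 < N" "\<And>i. 0 \<le> d i"
    "\<And>k l. cx_of N * g k l = (\<Sum>i\<in>UNIV. cx_of (d i) * (cx_cnj (v i k) * v i l))"
proof -
  have "\<exists>N d v. (0::'r) < N \<and> (\<forall>i. 0 \<le> d i) \<and> (\<forall>i. i \<notin> S \<longrightarrow> d i = 0) \<and>
      (\<forall>k l. cx_of N * g k l = (\<Sum>i\<in>UNIV. cx_of (d i) * (cx_cnj (v i k :: 'r cx) * v i l)))"
    if "finite S" "\<And>z. cx_nonneg (matrix_form g z z)" "\<And>k l. k \<notin> S \<or> l \<notin> S \<Longrightarrow> g k l = 0"
    for S and g :: "'n \<Rightarrow> 'n \<Rightarrow> 'r cx"
    using that
  proof (induction S arbitrary: g rule: finite_induct)
    case empty
    have "cx_of 1 * g k l = (\<Sum>i\<in>UNIV. cx_of 0 * (cx_cnj (0 :: 'r cx) * 0))" for k l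
      using empty.prems(2)[of k l] by simp
    then show ?case
      by (intro exI[of _ 1] exI[of _ "\<lambda>_. 0"] exI[of _ "\<lambda>_ _. 0"]) auto
  next
    case (insert p S)
    interpret positive_form "\<lambda>c z k. c * z k" "matrix_form g"
      using insert.prems(1) by (rule positive_form_matrix)
    define u where "u q = (\<lambda>k. if k = q then 1 else 0 :: 'r cx)" for q :: 'n
    have unit: "matrix_form g (u k) (u l) = g k l" for k l
      unfolding u_def by (rule matrix_form_unit(3))
    show ?case
    proof (cases "g p p = 0")
      case True
      have "g p l = 0" "g l p = 0" for l
        using null[of "u p" "u l"] True by (simp_all add: unit)
      then have "g k l = 0" if "k \<notin> S \<or> l \<notin> S" for k l
        using insert.prems(2)[of k l] that by (cases "k = p"; cases "l = p") auto
      from insert.IH[OF insert.prems(1) this]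
      obtain N d v where "(0::'r) < N" "\<forall>i. 0 \<le> d i" "\<forall>i. i \<notin> S \<longrightarrow> d i = 0"
        "\<forall>k l. cx_of N * g k l = (\<Sum>i\<in>UNIV. cx_of (d i) * (cx_cnj (v i k :: 'r cx) * v i l))"
        by blast
      then show ?thesis by (intro exI[of _ N] exI[of _ d] exI[of _ v]) auto
    next
      case False
      define a where "a = cRe (g p p)"
      have g_pp: "g p p = cx_of a" and "0 \<le> a"
        using cx_nonneg_diag[of "u p"] by (simp_all add: unit a_def)
      then have "0 < a" using False by (cases "a = 0") (auto simp: cx_of_simps)
      have herm: "g k p = cx_cnj (g p k)" for k
        using hermitian[of "u k" "u p"] by (simp add: unit)
      define h where "h k l = cx_of a * g k l - g k p * g p l" for k l
      have h_psd: "cx_nonneg (matrix_form h z z)" for z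
      proof -
        (* With w = a z - c e_p, where e_p is the unit vector, a h(z, z) = g(w, w). *)
        define c where "c = matrix_form g (u p) z"
        have c: "c = (\<Sum>l\<in>UNIV. g p l * z l)" unfolding c_def u_def by (rule matrix_form_unit(1))
        have c': "matrix_form g z (u p) = cx_cnj c"
          unfolding c_def by (rule hermitian)
        have c'': "cx_cnj c = (\<Sum>k\<in>UNIV. cx_cnj (z k) * g k p)"
          unfolding c'[symmetric] u_def by (rule matrix_form_unit(2))
        have h_form: "matrix_form h z z = cx_of a * matrix_form g z z - cx_cnj c * c"
        proof -
          have "cx_cnj c * c = (\<Sum>k\<in>UNIV. \<Sum>l\<in>UNIV. (cx_cnj (z k) * g k p) * (g p l * z l))"
            unfolding c'' unfolding c by (rule sum_product)
          then show ?thesis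
            unfolding matrix_form_def sum_distrib_left
            by (simp only:) (simp only: sum_subtractf[symmetric], rule sum_sum_cong, simp add: h_def algebra_simps)
        qed
        have "cx_of a * matrix_form h z z =
            cx_cnj (cx_of a) * (cx_of a * matrix_form g z z) + cx_cnj (cx_of a) * (- c * matrix_form g z (u p)) +
            (cx_cnj (- c) * (cx_of a * matrix_form g (u p) z) + cx_cnj (- c) * (- c * matrix_form g (u p) (u p)))"
          unfolding h_form by (simp add: c' c_def[symmetric] unit g_pp algebra_simps)
        then have "cx_nonneg (cx_of a * matrix_form h z z)"
          using expand[of "cx_of a" z "- c" "u p"] by metis
        then show ?thesis using \<open>0 < a\<close> by (rule cx_nonneg_cancel)
      qed
      have "h k l = 0" if "k \<notin> S \<or> l \<notin> S" for k l
        using that insert.prems(2)[of k l] insert.prems(2)[of k p] insert.prems(2)[of p l]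
        by (cases "k = p"; cases "l = p") (auto simp: h_def g_pp)
      from insert.IH[OF h_psd this]
      obtain N d v where N: "(0::'r) < N" "\<forall>i. 0 \<le> d i" "\<forall>i. i \<notin> S \<longrightarrow> d i = 0"
        "\<forall>k l. cx_of N * h k l = (\<Sum>i\<in>UNIV. cx_of (d i) * (cx_cnj (v i k :: 'r cx) * v i l))"
        by blast
      have "d p = 0" using N(3) insert.hyps(2) by blast
      have "cx_of (N * a) * g k l = (\<Sum>i\<in>UNIV. cx_of ((d(p := N)) i) *
          (cx_cnj ((v(p := g p)) i k) * (v(p := g p)) i l))" for k l
      proof -
        have "cx_of (N * a) * g k l = cx_of N * (cx_cnj (g p k) * g p l) + cx_of N * h k l"
          by (simp add: h_def herm[of k] cx_of_simps algebra_simps)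
        also have "cx_of N * h k l = (\<Sum>i\<in>UNIV. cx_of (d i) * (cx_cnj (v i k) * v i l))"
          using N(4) by blast
        also have "\<dots> = (\<Sum>i\<in>UNIV - {p}. cx_of (d i) * (cx_cnj (v i k) * v i l))"
          by (rule sum.mono_neutral_right) (auto simp: \<open>d p = 0\<close> cx_of_simps)
        also have "\<dots> = (\<Sum>i\<in>UNIV - {p}. cx_of ((d(p := N)) i) *
          (cx_cnj ((v(p := g p)) i k) * (v(p := g p)) i l))"
          by (rule sum.cong) auto
        finally show ?thesis
          by (subst sum.remove[of UNIV p]) simp_all
      qed
      moreover have "0 < N * a" using N(1) \<open>0 < a\<close> by simp
      ultimately show ?thesis
        using N(1-3) by (intro exI[of _ "N * a"] exI[of _ "d(p := N)"] exI[of _ "v(p := g p)"]) auto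
    qed
  qed
  from this[of UNIV g, OF finite_class.finite_UNIV assms]
  obtain N :: 'r and d :: "'n \<Rightarrow> 'r" and v where "0 < N" "\<forall>i. 0 \<le> d i"
      "\<forall>k l. cx_of N * g k l = (\<Sum>i\<in>UNIV. cx_of (d i) * (cx_cnj (v i k :: 'r cx) * v i l))"
    by auto
  then show ?thesis by (intro that[of N d v]) blast+
qed


lemma positive_functional_form:
  assumes alg: "star_algebra sc st" and pos: "positive_functional sc st \<omega>"
  shows "positive_form sc (\<lambda>u v. \<omega> (st u * v))"
proof -
  have hom: "\<omega> (u + v) = \<omega> u + \<omega> v" "\<omega> (sc c u) = c * \<omega> u" for u v c
    using pos by (simp_all add: positive_functional_def module_hom_iff)
  have bil: "sc c u * v = sc c (u * v)" "u * sc c v = sc c (u * v)" for c u v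
    using alg by (simp_all add: star_algebra_def bilinear_map_def module_hom_iff)
  have st: "st (u + v) = st u + st v" "st (sc c u) = sc (cx_cnj c) (st u)" for c u v
    using alg by (simp_all add: star_algebra_def)
  show ?thesis
    using pos by unfold_locales (simp_all add: st bil hom distrib_left distrib_right positive_functional_def)
qed

text \<open>Let \<open>d\<close> be the first index with \<open>\<omega>(a\<^sub>d\<^sup>* a\<^sub>d) \<noteq> 0\<close>. By the Cauchy-Schwarz inequality all terms
  \<open>\<omega>(a\<^sub>i\<^sup>* a\<^sub>j)\<close> with \<open>i < d\<close> or \<open>j < d\<close> vanish, so the lowest coefficient of \<open>\<omega>(a\<^sup>* a)\<close> is \<open>\<omega>(a\<^sub>d\<^sup>* a\<^sub>d)\<close>, in
  order \<open>2d\<close>.\<close>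

lemma positive_functional_fps:
  assumes alg: "star_algebra sc st" and pos: "positive_functional sc st \<omega>"
  shows "cx_fps_nonneg (fps_coeffwise \<omega> (fps_coeffwise st a * a))"
proof -
  interpret positive_form sc "\<lambda>u v. \<omega> (st u * v)" using alg pos by (rule positive_functional_form)
  define p where "p i j = \<omega> (st (fps_nth a i) * fps_nth a j)" for i j
  have herm: "p j i = cx_cnj (p i j)" for i j unfolding p_def by (rule hermitian)
  have null: "p i j = 0" "p j i = 0" if "p i i = 0" for i j
    using null[of "fps_nth a i" "fps_nth a j"] that by (simp_all add: p_def)
  have \<omega>_add: "\<omega> (u + v) = \<omega> u + \<omega> v" for u v
    using pos by (simp add: positive_functional_def module_hom_iff)
  have \<omega>_0: "\<omega> 0 = 0" using \<omega>_add[of 0 0] by simp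
  have \<omega>_sum: "\<omega> (\<Sum>i\<in>S. u i) = (\<Sum>i\<in>S. \<omega> (u i))" for S and u :: "nat \<Rightarrow> _"
    by (induction S rule: infinite_finite_induct) (simp_all add: \<omega>_0 \<omega>_add)
  let ?P = "fps_coeffwise \<omega> (fps_coeffwise st a * a)"
  have coeff: "fps_nth ?P n = (\<Sum>i=0..n. p i (n - i))" for n
    by (simp add: fps_mult_nth \<omega>_sum p_def)
  have real: "cIm (fps_nth ?P n) = 0" for n
  proof -
    have "cx_cnj (fps_nth ?P n) = (\<Sum>i=0..n. p (n - i) i)"
      by (simp only: coeff cx_cnj_sum herm[symmetric])
    also have "\<dots> = fps_nth ?P n"
      unfolding coeff by (subst sum.atLeastAtMost_rev) (auto intro!: sum.cong)
    finally have "cIm (cx_cnj (fps_nth ?P n)) = cIm (fps_nth ?P n)" by (rule arg_cong)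
    then show ?thesis unfolding cx_cnj_sel by simp
  qed
  show ?thesis
  proof (cases "\<forall>i. p i i = 0")
    case True
    have "p i j = 0" for i j by (rule null(1)) (rule True[rule_format])
    then have "fps_nth ?P n = 0" for n unfolding coeff by simp
    then have "?P = 0" by (intro fps_ext) simp
    then show ?thesis by simp
  next
    case False
    define d where "d = (LEAST i. p i i \<noteq> 0)"
    have d: "p d d \<noteq> 0" unfolding d_def by (rule LeastI_ex) (use False in blast)
    have diag_0: "p i i = 0" if "i < d" for i
      using not_less_Least[of i "\<lambda>i. p i i \<noteq> 0"] that unfolding d_def by simp
    have below: "p i j = 0" "p j i = 0" if "i < d" for i j
      by (rule null(1)[OF diag_0[OF that]], rule null(2)[OF diag_0[OF that]])
    have "fps_nth ?P (2 * d) = (\<Sum>i\<in>{d}. p i (2 * d - i))"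
      unfolding coeff
    proof (rule sum.mono_neutral_right)
      show "\<forall>i\<in>{0..2 * d} - {d}. p i (2 * d - i) = 0"
      proof
        fix i assume "i \<in> {0..2 * d} - {d}"
        then have "i < d \<or> 2 * d - i < d" by auto
        then show "p i (2 * d - i) = 0" using below by blast
      qed
    qed auto
    then have lead: "fps_nth ?P (2 * d) = p d d" by simp
    have diag: "p d d = cx_of (cRe (p d d))" "0 \<le> cRe (p d d)"
      unfolding p_def by (rule cx_nonneg_diag)+
    have "cRe (p d d) \<noteq> 0"
    proof
      assume "cRe (p d d) = 0"
      then have "cx_of (cRe (p d d)) = 0" by (simp add: cx_of_simps)
      with d show False unfolding diag(1)[symmetric] by blast
    qed
    then have "0 < cRe (p d d)" using diag(2) by simp
    then have "0 < cRe (fps_nth ?P (2 * d))" by (simp only: lead)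
    moreover have "fps_nth ?P n = 0" if "n < 2 * d" for n
      unfolding coeff
    proof (rule sum.neutral, rule ballI)
      fix i assume "i \<in> {0..n}"
      then have "i < d \<or> n - i < d" using that by auto
      then show "p i (n - i) = 0" using below by blast
    qed
    ultimately show ?thesis using real by (intro cx_fps_nonnegI[of ?P "2 * d"]) blast+
  qed
qed

text \<open>With \<open>N g = \<Sum>\<^sub>i d\<^sub>i v\<^sub>i\<^sup>* v\<^sub>i\<close>, the \<open>m\<close>-th tensor power of \<open>N g\<close> is the combination with coefficients
  \<open>\<Prod>\<^sub>p d\<^bsub>i\<^sub>p\<^esub>\<close> of the squares of \<open>v\<^bsub>i\<^sub>1\<^esub> \<otimes> \<dots> \<otimes> v\<^bsub>i\<^sub>m\<^esub>\<close>, and each of these pairs with \<open>\<omega>(b\<^sub>k\<^sup>* b\<^sub>l)\<close> to a value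
  \<open>\<omega>(c\<^sup>* c)\<close>. The factor \<open>N\<^sup>m\<close> is cancelled in the end.\<close>

lemma tensor_power_nonneg:
  fixes g :: "'n::finite \<Rightarrow> 'n \<Rightarrow> 'r::ordered_ring_with_rat cx" and b :: "'n list \<Rightarrow> 'a::ring_1 fps"
  assumes alg: "star_algebra sc st" and pos: "positive_functional sc st \<omega>"
    and psd: "\<And>z. cx_nonneg (matrix_form g z z)"
  shows "cx_fps_nonneg (fps_coeffwise \<omega> (\<Sum>ks | length ks = m. \<Sum>ls | length ls = m.
    fps_coeffwise (sc (\<Prod>p<m. g (ks ! p) (ls ! p))) (fps_coeffwise st (b ks) * b ls)))"
proof -
  have mod: "module sc" using alg by (simp add: star_algebra_def bilinear_map_def module_hom_def)
  interpret positive_form sc "\<lambda>u v. \<omega> (st u * v)" using alg pos by (rule positive_functional_form)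
  interpret m: module "\<lambda>c. fps_coeffwise ((*) (c :: 'r cx))"
    by (rule module_fps) (unfold_locales, simp_all add: algebra_simps)
  have \<omega>_add: "\<omega> (u + v) = \<omega> u + \<omega> v" and \<omega>_scale: "\<omega> (sc c u) = c * \<omega> u" for u v c
    using pos by (simp_all add: positive_functional_def module_hom_iff)
  have \<omega>_0: "\<omega> 0 = 0" using \<omega>_add[of 0 0] by simp
  have \<omega>_fps_add: "fps_coeffwise \<omega> (F + G) = fps_coeffwise \<omega> F + fps_coeffwise \<omega> G" for F G
    by (rule fps_ext) (simp add: \<omega>_add)
  have \<omega>_fps_0: "fps_coeffwise \<omega> 0 = 0" by (rule fps_ext) (simp add: \<omega>_0)
  have \<omega>_sum: "fps_coeffwise \<omega> (\<Sum>i\<in>S. F i) = (\<Sum>i\<in>S. fps_coeffwise \<omega> (F i))" for S :: "'n list set" and F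
    by (induction S rule: infinite_finite_induct) (simp_all add: \<omega>_fps_0 \<omega>_fps_add)
  have \<omega>_fps_scale: "fps_coeffwise \<omega> (fps_coeffwise (sc c) F) = fps_coeffwise ((*) c) (fps_coeffwise \<omega> F)" for c F
    by (rule fps_ext) (simp add: \<omega>_scale)
  interpret st: conj_additive st using alg by unfold_locales (simp add: star_algebra_def)
  have st_sum: "fps_coeffwise st (\<Sum>i\<in>S. F i) = (\<Sum>i\<in>S. fps_coeffwise st (F i))" for S :: "'n list set" and F
    by (rule fps_ext) (simp add: fps_sum_nth st.st_sum)
  have st_scale: "st (sc c u) = sc (cx_cnj c) (st u)" for c u using alg by (simp add: star_algebra_def)
  have bil: "sc c u * v = sc c (u * v)" "u * sc c v = sc c (u * v)" for c u v
    using alg by (simp_all add: star_algebra_def bilinear_map_def module_hom_iff)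
  have mult: "fps_coeffwise st (fps_coeffwise (sc c) P) * fps_coeffwise (sc d) Q =
      fps_coeffwise (sc (cx_cnj c * d)) (fps_coeffwise st P * Q)" for c d P Q
    by (rule fps_ext)
      (simp add: fps_mult_nth st_scale bil module.scale_sum_right[OF mod] module.scale_scale[OF mod] mult.commute)
  obtain N :: 'r and d :: "'n \<Rightarrow> 'r" and v :: "'n \<Rightarrow> 'n \<Rightarrow> 'r cx" where N: "0 < N" and d: "\<And>i. 0 \<le> d i"
    and g: "\<And>k l. cx_of N * g k l = (\<Sum>i\<in>UNIV. cx_of (d i) * (cx_cnj (v i k) * v i l))"
    by (rule psd_matrix_decomposition[of g, OF psd]) (rule that)
  let ?L = "{xs :: 'n list. length xs = m}" and ?S = "\<lambda>c. fps_coeffwise ((*) (c :: 'r cx))"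
  define F where "F ks ls = fps_coeffwise \<omega> (fps_coeffwise st (b ks) * b ls)" for ks ls
  define c where "c is = (\<Sum>ls\<in>?L. fps_coeffwise (sc (\<Prod>p<m. v (is ! p) (ls ! p))) (b ls))" for "is"
  have square: "fps_coeffwise \<omega> (fps_coeffwise st (c is) * c is) =
      (\<Sum>ks\<in>?L. \<Sum>ls\<in>?L. ?S (\<Prod>p<m. cx_cnj (v (is ! p) (ks ! p)) * v (is ! p) (ls ! p)) (F ks ls))" for "is"
    by (simp add: c_def st_sum sum_product mult \<omega>_sum \<omega>_fps_scale F_def prod.distrib cx_cnj_prod)
  let ?W = "\<Sum>ks\<in>?L. \<Sum>ls\<in>?L. ?S (\<Prod>p<m. g (ks ! p) (ls ! p)) (F ks ls)"
  have coeff: "cx_of (N ^ m) * (\<Prod>p<m. g (ks ! p) (ls ! p)) =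
      (\<Sum>is\<in>?L. cx_of (\<Prod>p<m. d (is ! p)) * (\<Prod>p<m. cx_cnj (v (is ! p) (ks ! p)) * v (is ! p) (ls ! p)))" for ks ls
  proof -
    have "cx_of (N ^ m) = (\<Prod>p<m. cx_of N)"
      using cx_of_prod[of "\<lambda>_. N" "{..<m}"] by simp
    then have "cx_of (N ^ m) * (\<Prod>p<m. g (ks ! p) (ls ! p)) = (\<Prod>p<m. cx_of N * g (ks ! p) (ls ! p))"
      by (simp only: prod.distrib)
    also have "\<dots> = (\<Sum>is\<in>?L. \<Prod>p<m. cx_of (d (is ! p)) * (cx_cnj (v (is ! p) (ks ! p)) * v (is ! p) (ls ! p)))"
      unfolding g by (rule prod_sum_lists)
    finally show ?thesis by (simp only: prod.distrib cx_of_prod)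
  qed
  have "?S (cx_of (N ^ m)) ?W = (\<Sum>ks\<in>?L. \<Sum>ls\<in>?L. \<Sum>is\<in>?L. ?S (cx_of (\<Prod>p<m. d (is ! p)) *
      (\<Prod>p<m. cx_cnj (v (is ! p) (ks ! p)) * v (is ! p) (ls ! p))) (F ks ls))"
    by (simp only: m.scale_sum_right m.scale_scale coeff m.scale_sum_left)
  also have "\<dots> = (\<Sum>ks\<in>?L. \<Sum>is\<in>?L. \<Sum>ls\<in>?L. ?S (cx_of (\<Prod>p<m. d (is ! p)) *
      (\<Prod>p<m. cx_cnj (v (is ! p) (ks ! p)) * v (is ! p) (ls ! p))) (F ks ls))"
    by (rule sum.cong[OF refl], rule sum.swap)
  also have "\<dots> = (\<Sum>is\<in>?L. \<Sum>ks\<in>?L. \<Sum>ls\<in>?L. ?S (cx_of (\<Prod>p<m. d (is ! p)) *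
      (\<Prod>p<m. cx_cnj (v (is ! p) (ks ! p)) * v (is ! p) (ls ! p))) (F ks ls))"
    by (rule sum.swap)
  also have "\<dots> = (\<Sum>is\<in>?L. ?S (cx_of (\<Prod>p<m. d (is ! p))) (fps_coeffwise \<omega> (fps_coeffwise st (c is) * c is)))"
    by (simp only: square m.scale_sum_right m.scale_scale)
  finally have "?S (cx_of (N ^ m)) ?W = \<dots>" .
  moreover have "cx_fps_nonneg \<dots>"
  proof (rule cx_fps_nonneg_sum)
    fix "is" :: "'n list"
    have "0 \<le> (\<Prod>p<m. d (is ! p))" by (intro prod_nonneg) (simp add: d)
    then show "cx_fps_nonneg (?S (cx_of (\<Prod>p<m. d (is ! p))) (fps_coeffwise \<omega> (fps_coeffwise st (c is) * c is)))"
      by (rule cx_fps_nonneg_monom[OF positive_functional_fps[OF alg pos], where m = 0]) simp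
  qed
  ultimately have "cx_fps_nonneg (?S (cx_of (N ^ m)) ?W)" by simp
  then have "cx_fps_nonneg ?W" by (rule cx_fps_nonneg_cancel) (simp add: N)
  then show ?thesis by (simp only: \<omega>_sum \<omega>_fps_scale F_def)
qed


section \<open>Positive semidefiniteness of the matrix of the Kaehler structure\<close>

lemma sum_antisym:
  fixes h :: "'n::finite \<Rightarrow> 'n \<Rightarrow> 'r::linordered_idom"
  assumes "\<And>k l. h l k = - h k l"
  shows "(\<Sum>k\<in>UNIV. \<Sum>l\<in>UNIV. h k l) = 0"
proof -
  have "(\<Sum>k\<in>UNIV. \<Sum>l\<in>UNIV. h k l) = (\<Sum>l\<in>UNIV. \<Sum>k\<in>UNIV. h k l)" by (rule sum.swap)
  also have "\<dots> = (\<Sum>l\<in>UNIV. \<Sum>k\<in>UNIV. - h l k)"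
    by (rule sum_sum_cong) (rule assms)
  finally show ?thesis by (simp add: sum_negf)
qed

lemma basis_coord:
  fixes sg :: "'r::comm_ring_1 \<Rightarrow> 'g::ab_group_add \<Rightarrow> 'g" and x :: "'i::finite \<Rightarrow> 'g"
  assumes "module sg" and basis: "is_basis sg x"
  shows "coord sg x (u + v) i = coord sg x u i + coord sg x v i"
    and "coord sg x (sg c u) i = c * coord sg x u i"
    and "coord sg x (x j) i = (if j = i then 1 else 0)"
    and "(\<Sum>i\<in>UNIV. sg (coord sg x u i) (x i)) = u"
proof -
  interpret module sg by fact
  have ind: "independent (range x)" and span: "span (range x) = UNIV" and inj: "inj x"
    using basis by (simp_all add: is_basis_def)
  show "coord sg x (u + v) i = coord sg x u i + coord sg x v i"
    by (simp add: coord_def representation_add[OF ind] span)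
  show "coord sg x (sg c u) i = c * coord sg x u i"
    by (simp add: coord_def representation_scale[OF ind] span)
  show "coord sg x (x j) i = (if j = i then 1 else 0)"
    using inj by (simp add: coord_def representation_basis[OF ind] inj_eq eq_commute)
  have "(\<Sum>b\<in>range x. sg (representation (range x) u b) b) = u"
    by (rule sum_representation_eq[OF ind]) (simp_all add: span)
  then show "(\<Sum>i\<in>UNIV. sg (coord sg x u i) (x i)) = u"
    by (simp add: sum.reindex[OF inj] coord_def)
qed

text \<open>Let \<open>\<phi>\<close> be the linear form with \<open>\<phi>(e\<^sub>k) = Re z\<^sub>k\<close> and \<open>\<phi>(f\<^sub>k) = Im z\<^sub>k\<close>. Then \<open>(\<phi> \<otimes> \<phi>)(s)\<close>, which is
  nonnegative by hypothesis, is the value of \<open>g\<close> at \<open>z\<close>: the imaginary part of the latter, and the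
  difference of the real parts, are sums of terms antisymmetric in the two indices.\<close>

lemma kaehler_g_psd:
  fixes sg :: "'r::ordered_ring_with_rat \<Rightarrow> 'g::ab_group_add \<Rightarrow> 'g" and x :: "'i::finite \<Rightarrow> 'g"
    and e f :: "'n::finite \<Rightarrow> 'g"
  assumes basis: "is_basis sg x" and kaehler: "kaehler_structure sg br x r e f A B nabla"
  shows "cx_nonneg (matrix_form (kaehler_g A B) z z)"
proof -
  have bil: "bilinear_map sg sg sg nabla" and ef: "is_basis sg (case_sum e f)"
    and A: "transpose A = A" and B: "transpose B = - B"
    and pos: "\<And>\<phi>. module_hom sg (*) \<phi> \<Longrightarrow>
        0 \<le> (\<Sum>i\<in>UNIV. \<Sum>j\<in>UNIV. kaehler_s sg x e f A B $ i $ j * \<phi> (x i) * \<phi> (x j))"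
    using kaehler by (simp_all add: kaehler_structure_def)
  have mod: "module sg" using bil by (simp add: bilinear_map_def module_hom_def)
  interpret module sg by fact
  note co = basis_coord[OF mod ef]
  have entry: "transpose M $ k $ l = M $ l $ k" for M :: "('r, 'n) sqmat" and k l
    by (simp add: transpose_def)
  have A': "A $ l $ k = A $ k $ l" for k l
    using entry[of A k l] unfolding A by simp
  have B': "B $ l $ k = - B $ k $ l" for k l
    using entry[of B k l] unfolding B by simp
  define \<phi> where "\<phi> u = (\<Sum>k\<in>UNIV. cRe (z k) * coord sg (case_sum e f) u (Inl k)) +
      (\<Sum>k\<in>UNIV. cIm (z k) * coord sg (case_sum e f) u (Inr k))" for u
  have lin: "\<phi> (u + v) = \<phi> u + \<phi> v" "\<phi> (sg c u) = c * \<phi> u" for u v c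
    by (simp_all add: \<phi>_def co(1,2) sum.distrib sum_distrib_left algebra_simps)
  have hom: "module_hom sg (*) \<phi>"
    by unfold_locales (simp_all add: lin algebra_simps)
  have co_ef: "coord sg (case_sum e f) (e k) i = (if Inl k = i then 1 else 0)"
    "coord sg (case_sum e f) (f k) i = (if Inr k = i then 1 else 0)" for k i
    using co(3)[of "Inl k" i] co(3)[of "Inr k" i] by simp_all
  have \<phi>_e: "\<phi> (e k) = cRe (z k)" for k
    by (simp add: \<phi>_def co_ef if_distrib cong: if_cong)
  have \<phi>_f: "\<phi> (f k) = cIm (z k)" for k
    by (simp add: \<phi>_def co_ef if_distrib cong: if_cong)
  have \<phi>_0: "\<phi> 0 = 0" using lin(2)[of 0 0] by simp
  have \<phi>_sum: "\<phi> (\<Sum>i\<in>S. u i) = (\<Sum>i\<in>S. \<phi> (u i))" for S and u :: "'i \<Rightarrow> 'g"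
    by (induction S rule: infinite_finite_induct) (simp_all add: lin(1) \<phi>_0)
  have eval: "(\<Sum>i\<in>UNIV. coord sg x u i * \<phi> (x i)) = \<phi> u" for u
    using \<phi>_sum[of "\<lambda>i. sg (coord sg x u i) (x i)" UNIV] by (simp add: basis_coord(4)[OF mod basis] lin(2))
  have tensor: "(\<Sum>i\<in>UNIV. \<Sum>j\<in>UNIV. (coord sg x u i * coord sg x v j) * \<phi> (x i) * \<phi> (x j)) = \<phi> u * \<phi> v" for u v
  proof -
    have "\<phi> u * \<phi> v = (\<Sum>i\<in>UNIV. coord sg x u i * \<phi> (x i)) * (\<Sum>j\<in>UNIV. coord sg x v j * \<phi> (x j))"
      by (simp only: eval)
    also have "\<dots> = (\<Sum>i\<in>UNIV. \<Sum>j\<in>UNIV. (coord sg x u i * \<phi> (x i)) * (coord sg x v j * \<phi> (x j)))"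
      by (rule sum_product)
    also have "\<dots> = (\<Sum>i\<in>UNIV. \<Sum>j\<in>UNIV. (coord sg x u i * coord sg x v j) * \<phi> (x i) * \<phi> (x j))"
      by (rule sum_sum_cong) (simp add: mult_ac)
    finally show ?thesis by simp
  qed
  let ?t = "\<lambda>u v i j. (coord sg x u i * coord sg x v j) * \<phi> (x i) * \<phi> (x j)"
  let ?h = "\<lambda>i j k l. A $ k $ l * (?t (e k) (e l) i j + ?t (f k) (f l) i j) - B $ k $ l * (?t (e k) (f l) i j + ?t (f l) (e k) i j)"
  have "(\<Sum>i\<in>UNIV. \<Sum>j\<in>UNIV. kaehler_s sg x e f A B $ i $ j * \<phi> (x i) * \<phi> (x j)) =
      (\<Sum>i\<in>UNIV. \<Sum>j\<in>UNIV. \<Sum>k\<in>UNIV. \<Sum>l\<in>UNIV. ?h i j k l)"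
    unfolding kaehler_s_def vec_lambda_beta sum_distrib_right
    by (rule sum_sum_cong, rule sum_sum_cong) (simp add: tensor_matrix_def algebra_simps)
  also have "\<dots> = (\<Sum>i\<in>UNIV. \<Sum>k\<in>UNIV. \<Sum>j\<in>UNIV. \<Sum>l\<in>UNIV. ?h i j k l)"
    by (rule sum.cong[OF refl], rule sum.swap)
  also have "\<dots> = (\<Sum>k\<in>UNIV. \<Sum>i\<in>UNIV. \<Sum>j\<in>UNIV. \<Sum>l\<in>UNIV. ?h i j k l)"
    by (rule sum.swap)
  also have "\<dots> = (\<Sum>k\<in>UNIV. \<Sum>i\<in>UNIV. \<Sum>l\<in>UNIV. \<Sum>j\<in>UNIV. ?h i j k l)"
    by (rule sum.cong[OF refl], rule sum.cong[OF refl], rule sum.swap)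
  also have "\<dots> = (\<Sum>k\<in>UNIV. \<Sum>l\<in>UNIV. \<Sum>i\<in>UNIV. \<Sum>j\<in>UNIV. ?h i j k l)"
    by (rule sum.cong[OF refl], rule sum.swap)
  also have "\<dots> = (\<Sum>k\<in>UNIV. \<Sum>l\<in>UNIV. A $ k $ l * (\<phi> (e k) * \<phi> (e l) + \<phi> (f k) * \<phi> (f l)) -
      B $ k $ l * (\<phi> (e k) * \<phi> (f l) + \<phi> (f l) * \<phi> (e k)))"
    by (rule sum_sum_cong) (simp only: tensor[symmetric] sum_subtractf sum.distrib sum_distrib_left distrib_left)
  finally have s: "(\<Sum>i\<in>UNIV. \<Sum>j\<in>UNIV. kaehler_s sg x e f A B $ i $ j * \<phi> (x i) * \<phi> (x j)) =
      (\<Sum>k\<in>UNIV. \<Sum>l\<in>UNIV. A $ k $ l * (cRe (z k) * cRe (z l) + cIm (z k) * cIm (z l)) -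
        B $ k $ l * (cRe (z k) * cIm (z l) + cIm (z l) * cRe (z k)))"
    unfolding \<phi>_e \<phi>_f .
  have "cRe (matrix_form (kaehler_g A B) z z) - (\<Sum>k\<in>UNIV. \<Sum>l\<in>UNIV. A $ k $ l * (cRe (z k) * cRe (z l) + cIm (z k) * cIm (z l)) -
        B $ k $ l * (cRe (z k) * cIm (z l) + cIm (z l) * cRe (z k))) =
      (\<Sum>k\<in>UNIV. \<Sum>l\<in>UNIV. B $ k $ l * (cRe (z k) * cIm (z l) + cIm (z k) * cRe (z l)))"
    unfolding matrix_form_def cRe_sum sum_subtractf[symmetric]
    by (rule sum_sum_cong) (simp add: kaehler_g_def algebra_simps)
  also have "\<dots> = 0"
  proof (rule sum_antisym)
    fix k l
    show "B $ l $ k * (cRe (z l) * cIm (z k) + cIm (z l) * cRe (z k)) =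
        - (B $ k $ l * (cRe (z k) * cIm (z l) + cIm (z k) * cRe (z l)))"
      by (simp add: B'[of k l] algebra_simps)
  qed
  finally have "cRe (matrix_form (kaehler_g A B) z z) =
      (\<Sum>i\<in>UNIV. \<Sum>j\<in>UNIV. kaehler_s sg x e f A B $ i $ j * \<phi> (x i) * \<phi> (x j))"
    unfolding s by simp
  then have "0 \<le> cRe (matrix_form (kaehler_g A B) z z)" using pos[OF hom] by simp
  moreover have "cIm (matrix_form (kaehler_g A B) z z) = 0"
    unfolding matrix_form_def cIm_sum
  proof (rule sum_antisym)
    fix k l
    show "cIm (cx_cnj (z l) * kaehler_g A B l k * z k) = - cIm (cx_cnj (z k) * kaehler_g A B k l * z l)"
      by (simp add: kaehler_g_def A'[of k l] B'[of k l] algebra_simps)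
  qed
  ultimately show ?thesis by (simp add: cx_nonneg_iff)
qed


section \<open>The Wick star product as a sum of squares\<close>

lemma (in star_module) taylor_component_conj:
  fixes F :: "('i::finite, 'v) weyl"
  shows "taylor_component sc (\<lambda>k i. cx_cnj (Z k i)) (weyl_conj st F) ks = fps_coeffwise st (taylor_component sc Z F ks)"
proof -
  have "weyl_conj st (ins_s_vec sc z G) = ins_s_vec sc (\<lambda>i. cx_cnj (z i)) (weyl_conj st G)"
    for z and G :: "('i, 'v) weyl"
    by (simp add: ins_s_vec_def weyl_conj_sum weyl_conj_scale weyl_conj_ins_s)
  then have "weyl_conj st (foldr (\<lambda>k. ins_s_vec sc (Z k)) ks F) =
      foldr (\<lambda>k. ins_s_vec sc (\<lambda>i. cx_cnj (Z k i))) ks (weyl_conj st F)"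
    by (induction ks) simp_all
  then show ?thesis by (simp add: taylor_component_def weyl_sigma_def weyl_conj_def fun_eq_iff)
qed

text \<open>The order of the rationals is respected by any ring homomorphism into \<open>R\<close>, since the
  denominator can be cleared.\<close>

lemma of_Q_nonneg:
  assumes "0 < b"
  shows "0 \<le> (of_Q (of_nat a / of_nat b) :: 'r::ordered_ring_with_rat)"
proof -
  have "of_Q (of_nat a / of_nat b) * of_nat b = (of_nat a :: 'r)"
    unfolding of_Q_of_nat[symmetric] of_Q_mult[symmetric] using assms by simp
  then have "0 \<le> of_Q (of_nat a / of_nat b) * (of_nat b :: 'r)" by simp
  moreover have "0 < (of_nat b :: 'r)" using assms by (rule of_nat_0_less_iff[THEN iffD2])
  ultimately show ?thesis by (simp add: zero_le_mult_iff)
qed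

text \<open>The formula for \<open>\<sigma>(F\<^sup>* \<circ> F)\<close>, as a convergent series and coefficient by coefficient.\<close>

lemma wick_product_squares:
  fixes sc :: "'r::ordered_ring_with_rat cx \<Rightarrow> 'a::ring_1 \<Rightarrow> 'a"
    and F :: "('i::{finite,linorder}, 'a) weyl" and g :: "'n::finite \<Rightarrow> 'n \<Rightarrow> 'r cx"
  assumes alg: "star_algebra sc st"
    and \<pi>: "\<And>i j. cx_i * cx_rat (1/2) * \<pi> i j =
      cx_rat 2 * (\<Sum>k\<in>UNIV. \<Sum>l\<in>UNIV. g k l * cx_cnj (Z k i) * Z l j)"
  defines "Q \<equiv> \<lambda>m. \<Sum>ks | length ks = m. \<Sum>ls | length ls = m.
      fps_coeffwise (sc (\<Prod>p<m. g (ks ! p) (ls ! p)))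
        (fps_coeffwise st (taylor_component sc Z F ks) * taylor_component sc Z F ls)"
  shows "(\<lambda>m. fps_bilinear sc (fps_const (cx_rat (2 ^ m / fact m)) * fps_X ^ m) (Q m))
      sums weyl_sigma (wick_mult sc (*) \<pi> (weyl_conj st F) F)" (is "?f sums ?P")
    and "fps_nth (weyl_sigma (wick_mult sc (*) \<pi> (weyl_conj st F) F)) n =
      (\<Sum>m\<le>n. sc (cx_rat (2 ^ m / fact m)) (fps_nth (Q m) (n - m)))"
proof -
  have bil: "bilinear_map sc sc sc (*)" using alg by (simp add: star_algebra_def)
  have mod: "module sc" using bil by (simp add: bilinear_map_def module_hom_def)
  interpret module sc by fact
  interpret star_module sc st
    using alg by unfold_locales (simp_all add: star_algebra_def)
  have Q: "fps_coeffwise (sc (wick_coeff m)) (weyl_sigma (wick_power sc (*) \<pi> m (weyl_conj st F) F)) =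
      fps_coeffwise (sc (cx_rat (2 ^ m / fact m))) (Q m)" for m
    using weyl_sigma_wick_power_components[where g = g and Z = "\<lambda>k i. cx_cnj (Z k i)" and Zb = Z, OF bil \<pi>]
    by (simp add: Q_def taylor_component_conj)
  have nth: "fps_nth (?f m) n = (if n < m then 0 else sc (cx_rat (2 ^ m / fact m)) (fps_nth (Q m) (n - m)))" for m n
    by (rule wick_term_nth[OF mod])
  have "fps_bilinear sc (fps_const (wick_coeff m) * fps_X ^ m)
      (weyl_sigma (wick_power sc (*) \<pi> m (weyl_conj st F) F)) = ?f m" for m
  proof (rule fps_ext)
    fix n
    have "sc (wick_coeff m) (fps_nth (weyl_sigma (wick_power sc (*) \<pi> m (weyl_conj st F) F)) (n - m)) =
        sc (cx_rat (2 ^ m / fact m)) (fps_nth (Q m) (n - m))"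
      using arg_cong[OF Q[of m], of "\<lambda>P. fps_nth P (n - m)"] by simp
    then show "fps_nth (fps_bilinear sc (fps_const (wick_coeff m) * fps_X ^ m)
      (weyl_sigma (wick_power sc (*) \<pi> m (weyl_conj st F) F))) n = fps_nth (?f m) n"
      by (simp only: wick_term_nth[OF mod])
  qed
  then have P: "?P = suminf ?f"
    unfolding weyl_sigma_def wick_mult_def wick_exponent by simp
  have "?f sums Abs_fps (\<lambda>n. \<Sum>m\<le>n. fps_nth (?f m) n)"
    by (rule fps_sums_locally_finite[where K = "\<lambda>n. n"]) (simp add: nth)
  then show "?f sums ?P" unfolding P by (rule sums_summable[THEN summable_sums])
  show "fps_nth ?P n = (\<Sum>m\<le>n. sc (cx_rat (2 ^ m / fact m)) (fps_nth (Q m) (n - m)))"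
    unfolding P
    by (subst fps_suminf_locally_finite_nth[where K = "\<lambda>n. n"]) (auto simp: nth intro!: sum.cong)
qed

lemma wick_product_positive:
  fixes sc :: "'r::ordered_ring_with_rat cx \<Rightarrow> 'a::ring_1 \<Rightarrow> 'a"
    and F :: "('i::{finite,linorder}, 'a) weyl" and g :: "'n::finite \<Rightarrow> 'n \<Rightarrow> 'r cx"
  assumes alg: "star_algebra sc st" and pos: "positive_functional sc st \<omega>"
    and psd: "\<And>z. cx_nonneg (matrix_form g z z)"
    and \<pi>: "\<And>i j. cx_i * cx_rat (1/2) * \<pi> i j =
      cx_rat 2 * (\<Sum>k\<in>UNIV. \<Sum>l\<in>UNIV. g k l * cx_cnj (Z k i) * Z l j)"
  shows "cx_fps_nonneg (fps_coeffwise \<omega> (weyl_sigma (wick_mult sc (*) \<pi> (weyl_conj st F) F)))"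
proof -
  define Q where "Q = (\<lambda>m. \<Sum>ks | length ks = m. \<Sum>ls | length ls = m.
      fps_coeffwise (sc (\<Prod>p<m. g (ks ! p) (ls ! p)))
        (fps_coeffwise st (taylor_component sc Z F ks) * taylor_component sc Z F ls))"
  let ?c = "\<lambda>m. of_Q (2 ^ m / fact m) :: 'r"
  define T where "T m = Abs_fps (\<lambda>n. if n < m then 0 else cx_of (?c m) * fps_nth (fps_coeffwise \<omega> (Q m)) (n - m))" for m
  have \<omega>_add: "\<omega> (u + v) = \<omega> u + \<omega> v" and \<omega>_scale: "\<omega> (sc c u) = c * \<omega> u" for u v c
    using pos by (simp_all add: positive_functional_def module_hom_iff)
  have \<omega>_0: "\<omega> 0 = 0" using \<omega>_add[of 0 0] by simp
  have \<omega>_sum: "\<omega> (\<Sum>i\<in>S. u i) = (\<Sum>i\<in>S. \<omega> (u i))" for S and u :: "nat \<Rightarrow> _"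
    by (induction S rule: infinite_finite_induct) (simp_all add: \<omega>_0 \<omega>_add)
  show ?thesis
  proof (rule cx_fps_nonneg_suminf[of T])
    fix m
    have c: "0 \<le> ?c m" using of_Q_nonneg[of "fact m" "2 ^ m"] by simp
    have "cx_fps_nonneg (fps_coeffwise \<omega> (Q m))"
      unfolding Q_def by (rule tensor_power_nonneg[OF alg pos psd])
    then show "cx_fps_nonneg (T m)"
      using c by (rule cx_fps_nonneg_monom[where m = m]) (simp add: T_def)
    show "fps_nth (T m) n = 0" if "n < m" for n using that by (simp add: T_def)
  next
    fix n
    have "fps_nth (weyl_sigma (wick_mult sc (*) \<pi> (weyl_conj st F) F)) n =
        (\<Sum>m\<le>n. sc (cx_rat (2 ^ m / fact m)) (fps_nth (Q m) (n - m)))"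
      unfolding Q_def by (rule wick_product_squares(2)[OF alg \<pi>])
    then show "fps_nth (fps_coeffwise \<omega> (weyl_sigma (wick_mult sc (*) \<pi> (weyl_conj st F) F))) n =
        (\<Sum>m\<le>n. fps_nth (T m) n)"
      by (simp add: \<omega>_sum \<omega>_scale T_def cx_rat_def)
  qed
qed

theorem theorem6p7:
  fixes sg :: "'r::ordered_ring_with_rat \<Rightarrow> 'g::ab_group_add \<Rightarrow> 'g"
    and br :: "'g \<Rightarrow> 'g \<Rightarrow> 'g"
    and x :: "'i::{finite,linorder} \<Rightarrow> 'g"
    and r :: "('r, 'i) sqmat"
    and e f :: "'n::finite \<Rightarrow> 'g"
    and A B :: "('r, 'n) sqmat"
    and nabla :: "'g \<Rightarrow> 'g \<Rightarrow> 'g"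
    and sc :: "'r cx \<Rightarrow> 'a::ring_1 \<Rightarrow> 'a"
    and st :: "'a \<Rightarrow> 'a"
    and act :: "'g \<Rightarrow> 'a \<Rightarrow> 'a"
    and \<Omega> \<rho> :: "('i, 'r cx) weyl"
    and \<pi> :: "'i \<Rightarrow> 'i \<Rightarrow> 'r cx"
    and \<tau> :: "'a fps \<Rightarrow> ('i, 'a) weyl"
    and sp :: "'a fps \<Rightarrow> 'a fps \<Rightarrow> 'a fps"
    and comp :: "'a \<Rightarrow> 'n list \<Rightarrow> 'a fps"
  assumes lie: "lie_algebra sg br"
    and basis: "is_basis sg x"
    and r_matrix: "classical_r_matrix sg br x r"
    and nondegenerate: "invertible r"
    and kaehler: "kaehler_structure sg br x r e f A B nabla"
    and star_alg: "star_algebra sc st"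
    and action: "star_action sg br sc st act"
    and Omega: "closed_hermitian_two_form sg br x \<Omega>"
    and pi_def: "\<pi> = wick_tensor r (kaehler_s sg x e f A B)"
    and rho: "is_fedosov_rho sg br x r nabla \<pi> \<Omega> \<rho>"
    and tau_def: "\<tau> = fedosov_tau sg br x nabla \<pi> \<rho> sc act"
    and star_def: "sp = fedosov_star sg br x nabla \<pi> \<rho> sc act"
    and comp_def: "comp = (\<lambda>a. taylor_component sc (Zbar sg x e f) (\<tau> (fps_const a)))"
  shows "(\<forall>a. (\<lambda>m. fps_bilinear sc (fps_const (cx_rat (2 ^ m / fact m)) * fps_X ^ m)
              (\<Sum>ks | length ks = m. \<Sum>ls | length ls = m.
                 fps_coeffwise (sc (\<Prod>p<m. kaehler_g A B (ks ! p) (ls ! p)))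
                   (fps_coeffwise st (comp a ks) * comp a ls)))
            sums sp (fps_const (st a)) (fps_const a))
         \<and> strongly_positive sc st sp"
proof -
  have bil: "bilinear_map sc sc sc (*)" using star_alg by (simp add: star_algebra_def)
  have mod: "module sc" using bil by (simp add: bilinear_map_def module_hom_def)
  interpret module sc by fact
  interpret star_module sc st
    using star_alg by unfold_locales (simp_all add: star_algebra_def)
  let ?Z = "Zbar sg x e f" and ?g = "kaehler_g A B"
  have A: "transpose A = A" and B: "transpose B = - B" and r: "r = kaehler_r sg x e f A B"
    using kaehler by (simp_all add: kaehler_structure_def)
  have \<pi>: "cx_i * cx_rat (1/2) * \<pi> i j =
      cx_rat 2 * (\<Sum>k\<in>UNIV. \<Sum>l\<in>UNIV. ?g k l * cx_cnj (?Z k i) * ?Z l j)" for i j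
    unfolding pi_def r by (rule wick_tensor_kaehler[OF A B])
  (* r is antisymmetric and s is symmetric, so r - i s has conjugate r + i s = - (r - i s)^T. *)
  have \<pi>_cnj: "cx_cnj (\<pi> i j) = - \<pi> j i" for i j
  proof -
    have entry: "transpose M $ i $ j = M $ j $ i" for M :: "('r, 'i) sqmat"
      by (simp add: transpose_def)
    have "r $ j $ i = - r $ i $ j"
      using r_matrix entry[of r] by (simp add: classical_r_matrix_def)
    moreover have "kaehler_s sg x e f A B $ j $ i - kaehler_s sg x e f A B $ i $ j = 0"
    proof -
      let ?d = "\<lambda>k l. A $ k $ l * (coord sg x (e k) j * coord sg x (e l) i + coord sg x (f k) j * coord sg x (f l) i -
        coord sg x (e k) i * coord sg x (e l) j - coord sg x (f k) i * coord sg x (f l) j)"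
      have "kaehler_s sg x e f A B $ j $ i - kaehler_s sg x e f A B $ i $ j = (\<Sum>k\<in>UNIV. \<Sum>l\<in>UNIV. ?d k l)"
        unfolding kaehler_s_def vec_lambda_beta sum_subtractf[symmetric]
        by (rule sum_sum_cong) (simp add: tensor_matrix_def algebra_simps)
      also have "\<dots> = 0"
      proof (rule sum_antisym)
        fix k l
        have "transpose A $ k $ l = A $ l $ k" by (simp add: transpose_def)
        then have sym: "A $ l $ k = A $ k $ l" unfolding A by (rule sym)
        show "?d l k = - ?d k l" unfolding sym by (simp add: algebra_simps)
      qed
      finally show ?thesis .
    qed
    ultimately show ?thesis
      by (auto intro!: cx_eqI simp: pi_def wick_tensor_def)
  qed
  have \<Omega>_real: "weyl_conj cx_cnj \<Omega> = \<Omega>"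
    using Omega by (simp add: closed_hermitian_two_form_def weyl_conj_def)
  have \<rho>_real: "weyl_conj cx_cnj \<rho> = \<rho>"
    using rho \<pi>_cnj \<Omega>_real by (rule fedosov_rho_real)
  have act_0: "act X 0 = 0" for X
    using action module_hom.zero[of sc sc "act X"] by (simp add: star_action_def)
  have act_st: "st (act X a) = act X (st a)" for X a
    using action by (simp add: star_action_def)
  have \<tau>_conj: "\<tau> (fps_coeffwise st a) = weyl_conj st (\<tau> a)" for a
    unfolding tau_def by (rule weyl_conj_fedosov_tau[OF rho \<rho>_real \<pi>_cnj act_0 act_st, symmetric])
  have sp: "sp (fps_coeffwise st a) a = weyl_sigma (wick_mult sc (*) \<pi> (weyl_conj st (\<tau> a)) (\<tau> a))" for a
    unfolding \<tau>_conj[symmetric] by (simp add: star_def fedosov_star_def tau_def)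
  show ?thesis
  proof (intro conjI allI)
    fix a
    have "fps_const (st a) = fps_coeffwise st (fps_const a)"
      by (rule fps_ext) simp
    then show "(\<lambda>m. fps_bilinear sc (fps_const (cx_rat (2 ^ m / fact m)) * fps_X ^ m)
              (\<Sum>ks | length ks = m. \<Sum>ls | length ls = m.
                 fps_coeffwise (sc (\<Prod>p<m. kaehler_g A B (ks ! p) (ls ! p)))
                   (fps_coeffwise st (comp a ks) * comp a ls)))
            sums sp (fps_const (st a)) (fps_const a)"
      using wick_product_squares(1)[where g = ?g and Z = ?Z and F = "\<tau> (fps_const a)", OF star_alg \<pi>]
      by (simp only: sp comp_def)
  next
    show "strongly_positive sc st sp"
      unfolding strongly_positive_def sp
    proof (intro allI impI)
      fix \<omega> a assume "positive_functional sc st \<omega>"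
      then show "cx_fps_nonneg (fps_coeffwise \<omega> (weyl_sigma (wick_mult sc (*) \<pi> (weyl_conj st (\<tau> a)) (\<tau> a))))"
        by (rule wick_product_positive[OF star_alg _ kaehler_g_psd[OF basis kaehler] \<pi>])
    qed
  qed
qed

end
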